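(* Given an $n$-vertex graph $G$ with distance to clique module $k$, POHPP and POHCP can be solved on $G$ in time $k!\cdot n^{O(1)}$.
   Context: All graphs are finite and simple. A non-trivial module of $G$ is a set $M\subsetneq V(G)$ such that any two vertices of $M$ have the same neighbors outside $M$. The distance to clique module of $G$ is the minimum size of a set $W\subseteq V(G)$ such that $G-W$ is a complete graph and $V(G)\setminus W$ is a non-trivial module of $G$. A partial order $\pi$ on $V(G)$ is a reflexive, antisymmetric, transitive relation. An ordered Hamiltonian path $(v_1,\dots,v_n)$ of $G$ (each vertex exactly once, consecutive vertices adjacent) is $\pi$-extending if $(v_i,v_j)\in\pi$ implies $i\le j$. POHPP: given $G$ and $\pi$, decide whether $G$ has a $\pi$-extending ordered Hamiltonian path. POHCP: given $G$ and $\pi$, decide whether $G$ has a $\pi$-extending ordered Hamiltonian path $(v_1,\dots,v_n)$ with $v_1v_n\in E(G)$. *)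

theory Defs
  imports "Graph_Theory.Graph_Theory"
begin

section \<open>Graphs, modules and path-extending orders\<close>

text \<open>
  A finite simple graph is a \<^locale>\<open>pair_graph\<close>: an edge \<open>uv\<close> is the pair of arcs
  \<open>(u, v)\<close>, \<open>(v, u)\<close>.
\<close>

definition neighbors :: "'a pair_pre_digraph \<Rightarrow> 'a \<Rightarrow> 'a set" where
  "neighbors G v = {u. (v, u) \<in> parcs G}"

definition nontrivial_module :: "'a pair_pre_digraph \<Rightarrow> 'a set \<Rightarrow> bool" where
  "nontrivial_module G M \<longleftrightarrow>
     M \<subset> pverts G \<and> (\<forall>u\<in>M. \<forall>v\<in>M. neighbors G u - M = neighbors G v - M)"

definition complete_graph :: "('a, 'b) pre_digraph \<Rightarrow> bool" where
  "complete_graph H \<longleftrightarrow> complete_digraph (card (verts H)) H"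

definition clique_module_deletion_set :: "'a pair_pre_digraph \<Rightarrow> 'a set \<Rightarrow> bool" where
  "clique_module_deletion_set G W \<longleftrightarrow>
     W \<subseteq> pverts G \<and> complete_graph (with_proj G \<restriction> (pverts G - W)) \<and>
     nontrivial_module G (pverts G - W)"

text \<open>Meaningful for non-empty finite graphs only: the empty graph has no non-trivial module.\<close>

definition dist_to_clique_module :: "'a pair_pre_digraph \<Rightarrow> nat" where
  "dist_to_clique_module G = (LEAST k. \<exists>W. clique_module_deletion_set G W \<and> card W = k)"

lemma clique_module_deletion_set_verts:
  assumes "pair_graph G" "pverts G \<noteq> {}"
  shows "clique_module_deletion_set G (pverts G)"
proof -
  interpret pair_graph G by fact
  have "graph (with_proj G \<restriction> {})"
    by unfold_locales (simp_all add: arcs_ends_def symmetric_def)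
  then show ?thesis
    using assms(2)
    by (simp add: clique_module_deletion_set_def complete_graph_def complete_digraph_def
        nontrivial_module_def arcs_ends_def psubset_eq)
qed

definition ordered_hamiltonian_path :: "'a pair_pre_digraph \<Rightarrow> 'a list \<Rightarrow> bool" where
  "ordered_hamiltonian_path G p \<longleftrightarrow> vpath p (with_proj G) \<and> set p = pverts G"

definition extending :: "'a rel \<Rightarrow> 'a list \<Rightarrow> bool" where
  "extending \<pi> p \<longleftrightarrow>
     (\<forall>i < length p. \<forall>j < length p. (p ! i, p ! j) \<in> \<pi> \<longrightarrow> i \<le> j)"

definition POHPP :: "'a pair_pre_digraph \<Rightarrow> 'a rel \<Rightarrow> bool" where
  "POHPP G \<pi> \<longleftrightarrow> (\<exists>p. ordered_hamiltonian_path G p \<and> extending \<pi> p)"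

definition POHCP :: "'a pair_pre_digraph \<Rightarrow> 'a rel \<Rightarrow> bool" where
  "POHCP G \<pi> \<longleftrightarrow>
     (\<exists>p. ordered_hamiltonian_path G p \<and> extending \<pi> p \<and> (hd p, last p) \<in> parcs G)"


section \<open>A random access machine\<close>

text \<open>
  Programs are structured programs over a random access machine with registers and an unbounded
  memory with indirect addressing, both holding natural numbers. Every operation costs one time
  unit. The only arithmetic is successor, (truncated) predecessor and comparison, so within \<open>t\<close>
  time units numbers grow by at most \<open>t\<close> (lemma \<open>exec_bounded\<close> below). Hence unit cost exceeds no
  realistic measure by much: on a logarithmic cost RAM, a run of length \<open>t\<close> takes longer only by
  a factor logarithmic in \<open>t\<close> and the input numbers, which for \<open>t = k! n\<^sup>c\<close> and \<open>k \<le> n\<close> is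
  polynomial in \<open>n\<close>. As no addition or multiplication is available at unit cost, an upper bound
  here is an upper bound on the usual unit cost RAM, too.
\<close>

record state =
  reg :: "nat \<Rightarrow> nat"
  mem :: "nat \<Rightarrow> nat"

datatype aexp = Const nat | Reg nat | Load aexp | Succ aexp | Pred aexp

datatype bexp = Eq aexp aexp | Less aexp aexp | Not bexp | And bexp bexp

datatype com =
    Skip
  | SetReg nat aexp
  | Store aexp aexp \<comment> \<open>address, value\<close>
  | Seq com com
  | If bexp com com
  | While bexp com

primrec aval :: "aexp \<Rightarrow> state \<Rightarrow> nat" where
  "aval (Const c) s = c"
| "aval (Reg r) s = reg s r"
| "aval (Load e) s = mem s (aval e s)"
| "aval (Succ e) s = aval e s + 1"
| "aval (Pred e) s = aval e s - 1"

primrec acost :: "aexp \<Rightarrow> nat" where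
  "acost (Const c) = 1"
| "acost (Reg r) = 1"
| "acost (Load e) = 1 + acost e"
| "acost (Succ e) = 1 + acost e"
| "acost (Pred e) = 1 + acost e"

primrec bval :: "bexp \<Rightarrow> state \<Rightarrow> bool" where
  "bval (Eq e f) s \<longleftrightarrow> aval e s = aval f s"
| "bval (Less e f) s \<longleftrightarrow> aval e s < aval f s"
| "bval (Not b) s \<longleftrightarrow> \<not> bval b s"
| "bval (And b d) s \<longleftrightarrow> bval b s \<and> bval d s"

primrec bcost :: "bexp \<Rightarrow> nat" where
  "bcost (Eq e f) = 1 + acost e + acost f"
| "bcost (Less e f) = 1 + acost e + acost f"
| "bcost (Not b) = 1 + bcost b"
| "bcost (And b d) = 1 + bcost b + bcost d"

text \<open>\<open>exec c s t s'\<close>: started in \<open>s\<close>, the program \<open>c\<close> halts in \<open>s'\<close> after \<open>t\<close> time units.\<close>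

inductive exec :: "com \<Rightarrow> state \<Rightarrow> nat \<Rightarrow> state \<Rightarrow> bool" where
  Skip: "exec Skip s 1 s"
| SetReg: "exec (SetReg r e) s (1 + acost e) (s\<lparr>reg := (reg s)(r := aval e s)\<rparr>)"
| Store: "exec (Store e f) s (1 + acost e + acost f)
            (s\<lparr>mem := (mem s)(aval e s := aval f s)\<rparr>)"
| Seq: "\<lbrakk> exec c s t s'; exec d s' t' s'' \<rbrakk> \<Longrightarrow> exec (Seq c d) s (t + t') s''"
| IfTrue: "\<lbrakk> bval b s; exec c s t s' \<rbrakk> \<Longrightarrow> exec (If b c d) s (1 + bcost b + t) s'"
| IfFalse: "\<lbrakk> \<not> bval b s; exec d s t s' \<rbrakk> \<Longrightarrow> exec (If b c d) s (1 + bcost b + t) s'"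
| WhileFalse: "\<not> bval b s \<Longrightarrow> exec (While b c) s (1 + bcost b) s"
| WhileTrue: "\<lbrakk> bval b s; exec c s t s'; exec (While b c) s' t' s'' \<rbrakk> \<Longrightarrow>
    exec (While b c) s (1 + bcost b + t + t') s''"

inductive_cases SkipE: "exec Skip s t s'"
inductive_cases SetRegE: "exec (SetReg r e) s t s'"
inductive_cases StoreE: "exec (Store e f) s t s'"
inductive_cases SeqE: "exec (Seq c d) s t s'"
inductive_cases WhileE: "exec (While b c) s t s'"

lemma exec_deterministic:
  "exec c s t s' \<Longrightarrow> exec c s u s'' \<Longrightarrow> s'' = s' \<and> u = t"
proof (induction arbitrary: u s'' rule: exec.induct)
  case (Seq c s t s' d t' z)
  from Seq.prems show ?case
    by (rule SeqE) (use Seq.IH in blast)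
next
  case (WhileFalse b s c)
  from WhileFalse.prems show ?case
    by (rule WhileE) (use WhileFalse.hyps in simp_all)
next
  case (WhileTrue b s c t s' t' z)
  obtain u1 r u2 where u: "u = 1 + bcost b + u1 + u2"
    and c: "exec c s u1 r" and w: "exec (While b c) r u2 s''"
    using WhileTrue.prems WhileTrue.hyps(1) by (cases rule: exec.cases) auto
  have r: "r = s' \<and> u1 = t" by (rule WhileTrue.IH(1)[OF c])
  then have "s'' = z \<and> u2 = t'" using WhileTrue.IH(2) w by simp
  then show ?case using r u by simp
next
  case (IfTrue b s c t s' d)
  from IfTrue.prems IfTrue.hyps(1) obtain u1
    where "u = 1 + bcost b + u1" "exec c s u1 s''"
    by (cases rule: exec.cases) auto
  with IfTrue.IH show ?case by blast
next
  case (IfFalse b s d t s' c)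
  from IfFalse.prems IfFalse.hyps(1) obtain u1
    where "u = 1 + bcost b + u1" "exec d s u1 s''"
    by (cases rule: exec.cases) auto
  with IfFalse.IH show ?case by blast
next
  case (Skip s)
  then show ?case by (rule SkipE) simp
next
  case (SetReg r e s)
  then show ?case by (rule SetRegE) simp
next
  case (Store e f s)
  then show ?case by (rule StoreE) simp
qed

primrec aconst :: "aexp \<Rightarrow> nat" where
  "aconst (Const c) = c"
| "aconst (Reg r) = 0"
| "aconst (Load e) = aconst e"
| "aconst (Succ e) = aconst e"
| "aconst (Pred e) = aconst e"

primrec cconst :: "com \<Rightarrow> nat" where
  "cconst Skip = 0"
| "cconst (SetReg r e) = aconst e"
| "cconst (Store e f) = max (aconst e) (aconst f)"
| "cconst (Seq c d) = max (cconst c) (cconst d)"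
| "cconst (If b c d) = max (cconst c) (cconst d)"
| "cconst (While b c) = cconst c"

definition bounded_by :: "nat \<Rightarrow> state \<Rightarrow> bool" where
  "bounded_by B s \<longleftrightarrow> (\<forall>i. reg s i \<le> B \<and> mem s i \<le> B)"

lemma aval_bounded:
  "bounded_by B s \<Longrightarrow> aconst e \<le> B \<Longrightarrow> aval e s \<le> B + acost e"
proof (induction e)
  case (Load e)
  then show ?case by (simp add: bounded_by_def le_SucI trans_le_add1)
next
  case (Reg r)
  then show ?case by (simp add: bounded_by_def le_SucI trans_le_add1)
qed auto

lemma bounded_by_mono: "bounded_by B s \<Longrightarrow> B \<le> B' \<Longrightarrow> bounded_by B' s"
  unfolding bounded_by_def by (meson le_trans)

lemma exec_bounded:
  "exec c s t s' \<Longrightarrow> cconst c \<le> B \<Longrightarrow> bounded_by B s \<Longrightarrow> bounded_by (B + t) s'"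
proof (induction arbitrary: B rule: exec.induct)
  case (SetReg r e s)
  then show ?case
    using aval_bounded[of B s e] by (auto simp: bounded_by_def le_SucI trans_le_add1)
next
  case (Store e f s)
  then show ?case
    using aval_bounded[of B s f] by (auto simp: bounded_by_def le_SucI trans_le_add1)
next
  case (Seq c s t s' d t' s'')
  have "bounded_by (B + t) s'" by (rule Seq.IH(1)) (use Seq.prems in auto)
  then have "bounded_by (B + t + t') s''" by (rule Seq.IH(2)[rotated]) (use Seq.prems in auto)
  then show ?case by (simp only: add.assoc)
next
  case (IfTrue b s c t s' d)
  have "bounded_by (B + t) s'" by (rule IfTrue.IH) (use IfTrue.prems in auto)
  then show ?case by (rule bounded_by_mono) simp
next
  case (IfFalse b s d t s' c)
  have "bounded_by (B + t) s'" by (rule IfFalse.IH) (use IfFalse.prems in auto)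
  then show ?case by (rule bounded_by_mono) simp
next
  case (WhileTrue b s c t s' t' s'')
  have "bounded_by (B + t) s'" by (rule WhileTrue.IH(1)) (use WhileTrue.prems in auto)
  then have "bounded_by (B + t + t') s''"
    by (rule WhileTrue.IH(2)[rotated]) (use WhileTrue.prems in auto)
  then show ?case by (rule bounded_by_mono) simp
next
  case (Skip s)
  from Skip.prems(2) show ?case by (rule bounded_by_mono) simp
next
  case (WhileFalse b s c)
  from WhileFalse.prems(2) show ?case by (rule bounded_by_mono) simp
qed

section \<open>Instances and algorithms\<close>

text \<open>
  The vertices of an input graph are numbered \<open>0, \<dots>, n - 1\<close>. The machine is given \<open>n\<close> in
  register 0 and, in its memory, the adjacency matrix followed by the matrix of the
  partial order (both row by row).  In particular it is given neither \<open>k\<close> nor a deletion set.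
\<close>

definition valid_instance :: "nat pair_pre_digraph \<Rightarrow> nat rel \<Rightarrow> nat \<Rightarrow> bool" where
  "valid_instance G \<pi> n \<longleftrightarrow>
     n \<ge> 1 \<and> pair_graph G \<and> pverts G = {..<n} \<and> partial_order_on (pverts G) \<pi>"

definition input_state :: "nat pair_pre_digraph \<Rightarrow> nat rel \<Rightarrow> nat \<Rightarrow> state" where
  "input_state G \<pi> n =
     \<lparr>reg = (\<lambda>r. if r = 0 then n else 0),
      mem = (\<lambda>a. if a < n * n then of_bool ((a div n, a mod n) \<in> parcs G)
                 else if a < 2 * n * n then of_bool (((a - n * n) div n, (a - n * n) mod n) \<in> \<pi>)
                 else 0)\<rparr>"

text \<open>The answer is left in register 0.\<close>

definition decides_within ::
  "com \<Rightarrow> (nat pair_pre_digraph \<Rightarrow> nat rel \<Rightarrow> bool) \<Rightarrow> (nat \<Rightarrow> nat \<Rightarrow> nat) \<Rightarrow> bool" where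
  "decides_within P Q T \<longleftrightarrow>
     (\<forall>G \<pi> n k. valid_instance G \<pi> n \<and> dist_to_clique_module G = k \<longrightarrow>
        (\<exists>t s. exec P (input_state G \<pi> n) t s \<and> reg s 0 = of_bool (Q G \<pi>) \<and> t \<le> T n k))"

end

theory Submission
  imports Defs
begin

text \<open>
  A clique module is a set of true twins, so a largest twin class \<open>T\<close> leaves out at most \<open>k\<close>
  vertices. For each guess of the two ends \<open>a\<close>, \<open>b\<close> of the path and each of the at most
  \<open>(k + 2)!\<close> orders \<open>p\<close> of the vertices outside \<open>C = T - {a, b}\<close>, it remains to distribute \<open>C\<close>
  over the gaps between consecutive elements of \<open>p\<close>. The vertices of \<open>C\<close> differ only in the
  partial order, which confines each of them to an interval of gaps, and every gap between
  non-adjacent elements of \<open>p\<close> needs a vertex. That is a matching problem between gaps and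
  vertices, solved by always choosing the available vertex with the earliest deadline. The order
  among the vertices of \<open>C\<close> can be ignored, because two vertices in the wrong order can be
  swapped. As \<open>(k + 2)! \<le> k! (n + 1) (n + 2)\<close>, the time bound follows.

  The program is written in a language whose terms contain counting quantifiers over vertices and
  which is compiled to the machine; all remaining loops are those of the enumeration and of the
  matching.
\<close>

section \<open>Polynomially bounded functions\<close>

text \<open>The guessed ends leave the module so that every module vertex has an outside vertex on
  either side. No module vertex is placed before the first or after the last element of
  \<open>p\<close>, and the edge that closes a cycle joins those two elements; so one program with a
  flag \<open>cyc\<close> serves both problems. Completeness takes the actual ends as the guess,
  while soundness holds for every guess. Twin classes replace deletion sets because they can be read
  off the adjacency matrix in polynomial time, whereas no deletion set is given.

  The greedy choice is optimal because gaps are served from left to right: a vertex that fits the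
  current gap has all its predecessors in \<open>p\<close> behind it, so among such vertices only
  the deadline decides about later gaps.

  The factorial must come from the search alone, on a machine that adds only one at a time.
  Therefore executed source commands are counted first, each as one step, and this count is
  multiplied by a polynomial bound on the machine time of a single command. That bound must not
  depend on the values of variables, hence array indices are compared with \<open>n\<close> before
  an address is computed.\<close>

definition poly_bounded :: "(nat \<Rightarrow> nat) \<Rightarrow> bool" where
  "poly_bounded f \<longleftrightarrow> (\<exists>c. \<forall>n\<ge>1. f n \<le> c * n ^ c)"

text \<open>\<open>poly_bounded\<close> merges coefficient and exponent into one constant, as in the
  final time bound. The sum of the two dominates both because \<open>n \<ge> 1\<close>.\<close>

lemma poly_boundedI:
  assumes "\<And>n. n \<ge> 1 \<Longrightarrow> f n \<le> a * n ^ b"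
  shows "poly_bounded f"
  unfolding poly_bounded_def
proof (intro exI allI impI)
  fix n :: nat assume n: "n \<ge> 1"
  have "f n \<le> a * n ^ b" using assms n by blast
  also have "\<dots> \<le> (a + b) * n ^ (a + b)"
    using n by (intro mult_mono power_increasing) auto
  finally show "f n \<le> (a + b) * n ^ (a + b)" .
qed

lemma poly_bounded_const: "poly_bounded (\<lambda>n. a)"
  by (rule poly_boundedI[of _ a 0]) simp

lemma poly_bounded_id: "poly_bounded (\<lambda>n. n)"
  by (rule poly_boundedI[of _ 1 1]) simp

lemma poly_bounded_add:
  assumes "poly_bounded f" "poly_bounded g"
  shows "poly_bounded (\<lambda>n. f n + g n)"
proof -
  obtain c d where c: "\<And>n. n \<ge> 1 \<Longrightarrow> f n \<le> c * n ^ c" and d: "\<And>n. n \<ge> 1 \<Longrightarrow> g n \<le> d * n ^ d"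
    using assms unfolding poly_bounded_def by blast
  show ?thesis
  proof (rule poly_boundedI[of _ "c + d" "c + d"])
    fix n :: nat assume n: "n \<ge> 1"
    have "f n \<le> c * n ^ (c + d)" "g n \<le> d * n ^ (c + d)"
      using c[OF n] d[OF n] n by (meson le_trans mult_le_mono2 power_increasing le_add1 le_add2)+
    then show "f n + g n \<le> (c + d) * n ^ (c + d)" by (simp add: algebra_simps)
  qed
qed

lemma poly_bounded_mult:
  assumes "poly_bounded f" "poly_bounded g"
  shows "poly_bounded (\<lambda>n. f n * g n)"
proof -
  obtain c d where c: "\<And>n. n \<ge> 1 \<Longrightarrow> f n \<le> c * n ^ c" and d: "\<And>n. n \<ge> 1 \<Longrightarrow> g n \<le> d * n ^ d"
    using assms unfolding poly_bounded_def by blast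
  show ?thesis
  proof (rule poly_boundedI[of _ "c * d" "c + d"])
    fix n :: nat assume n: "n \<ge> 1"
    have "f n * g n \<le> (c * n ^ c) * (d * n ^ d)" by (intro mult_le_mono c d n)
    then show "f n * g n \<le> (c * d) * n ^ (c + d)" by (simp add: power_add algebra_simps)
  qed
qed

lemma poly_bounded_Suc: "poly_bounded f \<Longrightarrow> poly_bounded (\<lambda>n. Suc (f n))"
  using poly_bounded_add[OF poly_bounded_const[of 1]] by simp

lemmas poly_bounded_intros =
  poly_bounded_Suc poly_bounded_const poly_bounded_id poly_bounded_add poly_bounded_mult

section \<open>Total correctness of machine programs\<close>

text \<open>Termination, time bound and postcondition in one predicate, so that bounds add up along
  a program. As \<open>exec\<close> is deterministic, the existence of one such run is a statement
  about the only run.\<close>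

definition reach :: "com \<Rightarrow> state \<Rightarrow> nat \<Rightarrow> (state \<Rightarrow> bool) \<Rightarrow> bool" where
  "reach c s T P \<longleftrightarrow> (\<exists>t s'. exec c s t s' \<and> t \<le> T \<and> P s')"

lemma reach_mono: "reach c s T P \<Longrightarrow> T \<le> T' \<Longrightarrow> (\<And>s'. P s' \<Longrightarrow> Q s') \<Longrightarrow> reach c s T' Q"
  unfolding reach_def by (meson le_trans)

lemma reach_Skip: "P s \<Longrightarrow> 1 \<le> T \<Longrightarrow> reach Skip s T P"
  unfolding reach_def by (meson exec.Skip)

lemma reach_SetReg:
  "P (s\<lparr>reg := (reg s)(r := aval e s)\<rparr>) \<Longrightarrow> 1 + acost e \<le> T \<Longrightarrow> reach (SetReg r e) s T P"
  unfolding reach_def using exec.SetReg by blast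

lemma reach_Store:
  "P (s\<lparr>mem := (mem s)(aval e s := aval f s)\<rparr>) \<Longrightarrow> 1 + acost e + acost f \<le> T \<Longrightarrow>
   reach (Store e f) s T P"
  unfolding reach_def using exec.Store by blast

lemma reach_Seq:
  "reach c s T (\<lambda>s'. reach d s' T' P) \<Longrightarrow> T + T' \<le> U \<Longrightarrow> reach (Seq c d) s U P"
  unfolding reach_def by (meson exec.Seq add_le_mono le_trans)

lemma reach_If:
  assumes "bval b s \<Longrightarrow> reach c s T P" "\<not> bval b s \<Longrightarrow> reach d s T P" "1 + bcost b + T \<le> U"
  shows "reach (If b c d) s U P"
proof (cases "bval b s")
  case True
  with assms obtain t s' where "exec c s t s'" "t \<le> T" "P s'" by (auto simp: reach_def)
  with exec.IfTrue[OF True this(1)] assms(3) show ?thesis unfolding reach_def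
    by (intro exI[of _ "1 + bcost b + t"] exI[of _ s']) auto
next
  case False
  with assms obtain t s' where "exec d s t s'" "t \<le> T" "P s'" by (auto simp: reach_def)
  with exec.IfFalse[OF False this(1)] assms(3) show ?thesis unfolding reach_def
    by (intro exI[of _ "1 + bcost b + t"] exI[of _ s']) auto
qed

text \<open>The invariant is indexed by the number of finished iterations and their total
  \<open>m\<close> is fixed beforehand. This takes the place of a termination measure and yields the
  cost of \<open>m\<close> bodies and \<open>m + 1\<close> tests.\<close>

lemma reach_While:
  assumes body: "\<And>i s. i < m \<Longrightarrow> P i s \<Longrightarrow> bval b s \<and> reach c s T (P (Suc i))"
    and stop: "\<And>s. P m s \<Longrightarrow> \<not> bval b s"
    and init: "P 0 s"
    and time: "m * (T + 1 + bcost b) + 1 + bcost b \<le> U"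
  shows "reach (While b c) s U (P m)"
proof -
  have "i \<le> m \<Longrightarrow> P i s \<Longrightarrow> reach (While b c) s ((m - i) * (T + 1 + bcost b) + 1 + bcost b) (P m)" for i s
  proof (induction "m - i" arbitrary: i s)
    case 0
    then have "P m s" by simp
    with exec.WhileFalse[OF stop[OF this]] show ?case using 0 by (auto simp: reach_def)
  next
    case (Suc k)
    then have i: "i < m" by simp
    from body[OF i Suc.prems(2)] obtain t s' where b: "bval b s"
      and c: "exec c s t s'" "t \<le> T" "P (Suc i) s'" by (auto simp: reach_def)
    have "reach (While b c) s' ((m - Suc i) * (T + 1 + bcost b) + 1 + bcost b) (P m)"
      using Suc c i by auto
    then obtain t' s'' where w: "exec (While b c) s' t' s''" "P m s''"
      "t' \<le> (m - Suc i) * (T + 1 + bcost b) + 1 + bcost b" by (auto simp: reach_def)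
    have eq: "m - i = Suc (m - Suc i)" using i by simp
    have "1 + bcost b + t + t' \<le> (m - i) * (T + 1 + bcost b) + 1 + bcost b"
      unfolding eq using w c by simp
    with exec.WhileTrue[OF b c(1) w(1)] w(2) show ?case unfolding reach_def by blast
  qed
  from this[of 0 s] init time show ?thesis by (auto elim: reach_mono)
qed


section \<open>A language with counting quantifiers\<close>

text \<open>
  Terms are evaluated relative to the number \<open>n\<close> of vertices, the two input matrices \<open>I False\<close>
  (adjacency) and \<open>I True\<close> (partial order), variables \<open>\<rho>\<close> and arrays \<open>A j\<close> of length \<open>n\<close>.
  Since quantifiers range over \<open>{..<n}\<close> and there is no arithmetic besides successor and
  predecessor, evaluating a term takes time polynomial in \<open>n\<close>, whatever the values are.
\<close>

datatype tm =
    Num nat | Size | V nat | Inc tm | Dec tm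
  | Inp bool tm tm | Arr nat tm
  | Equ tm tm | Lt tm tm | Neg tm | Conj tm tm
  | Count nat tm

primrec tval :: "nat \<Rightarrow> (bool \<Rightarrow> nat \<Rightarrow> nat \<Rightarrow> bool) \<Rightarrow> (nat \<Rightarrow> nat \<Rightarrow> nat) \<Rightarrow> tm \<Rightarrow> (nat \<Rightarrow> nat) \<Rightarrow> nat" where
  "tval n I A (Num c) \<rho> = c"
| "tval n I A Size \<rho> = n"
| "tval n I A (V x) \<rho> = \<rho> x"
| "tval n I A (Inc t) \<rho> = tval n I A t \<rho> + 1"
| "tval n I A (Dec t) \<rho> = tval n I A t \<rho> - 1"
| "tval n I A (Inp q t u) \<rho> =
     of_bool (tval n I A t \<rho> < n \<and> tval n I A u \<rho> < n \<and> I q (tval n I A t \<rho>) (tval n I A u \<rho>))"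
| "tval n I A (Arr j t) \<rho> = (if tval n I A t \<rho> < n then A j (tval n I A t \<rho>) else 0)"
| "tval n I A (Equ t u) \<rho> = of_bool (tval n I A t \<rho> = tval n I A u \<rho>)"
| "tval n I A (Lt t u) \<rho> = of_bool (tval n I A t \<rho> < tval n I A u \<rho>)"
| "tval n I A (Neg t) \<rho> = of_bool (tval n I A t \<rho> = 0)"
| "tval n I A (Conj t u) \<rho> = of_bool (tval n I A t \<rho> \<noteq> 0 \<and> tval n I A u \<rho> \<noteq> 0)"
| "tval n I A (Count x t) \<rho> = card {i. i < n \<and> tval n I A t (\<rho>(x := i)) \<noteq> 0}"

text \<open>Registers from \<open>scratch\<close> on hold intermediate results, register 0 holds \<open>n\<close>.\<close>

abbreviation scratch :: nat where "scratch \<equiv> 40"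

abbreviation is_var :: "nat \<Rightarrow> bool" where "is_var x \<equiv> 0 < x \<and> x < scratch"

primrec wf_tm :: "tm \<Rightarrow> bool" where
  "wf_tm (Num c) = True"
| "wf_tm Size = True"
| "wf_tm (V x) = is_var x"
| "wf_tm (Inc t) = wf_tm t"
| "wf_tm (Dec t) = wf_tm t"
| "wf_tm (Inp q t u) = (wf_tm t \<and> wf_tm u)"
| "wf_tm (Arr j t) = wf_tm t"
| "wf_tm (Equ t u) = (wf_tm t \<and> wf_tm u)"
| "wf_tm (Lt t u) = (wf_tm t \<and> wf_tm u)"
| "wf_tm (Neg t) = wf_tm t"
| "wf_tm (Conj t u) = (wf_tm t \<and> wf_tm u)"
| "wf_tm (Count x t) = (is_var x \<and> wf_tm t)"

definition add_n :: "nat \<Rightarrow> nat \<Rightarrow> com" where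
  "add_n r f = Seq (SetReg f (Const 0))
     (While (Less (Reg f) (Reg 0))
       (Seq (SetReg r (Succ (Reg r))) (SetReg f (Succ (Reg f)))))"

text \<open>Turns a row number in register \<open>r\<close> and a column number in register \<open>r + 1\<close> into an address.\<close>

definition addr :: "nat \<Rightarrow> com" where
  "addr r = While (Less (Const 0) (Reg r))
     (Seq (add_n (r + 1) (r + 2)) (SetReg r (Pred (Reg r))))"

definition set_bool :: "nat \<Rightarrow> bexp \<Rightarrow> com" where
  "set_bool r b = If b (SetReg r (Const 1)) (SetReg r (Const 0))"

abbreviation nonzero :: "nat \<Rightarrow> bexp" where "nonzero r \<equiv> Less (Const 0) (Reg r)"

text \<open>Memory is read as a table with rows of length \<open>n\<close>: the first
  \<open>n\<close> rows hold the adjacency matrix, the next \<open>n\<close> the order, and row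
  \<open>2 * n + j\<close> holds array \<open>j\<close>. Hence the single \<open>add_n\<close> for
  \<open>Inp True\<close> and the two for \<open>Arr\<close>. \<open>Count\<close> saves the outer
  value of its variable in \<open>r\<close> and counts in \<open>r + 1\<close>, so its body is
  evaluated from \<open>r + 2\<close> on.\<close>

primrec tcom :: "tm \<Rightarrow> nat \<Rightarrow> com" where
  "tcom (Num c) r = SetReg r (Const c)"
| "tcom Size r = SetReg r (Reg 0)"
| "tcom (V x) r = SetReg r (Reg x)"
| "tcom (Inc t) r = Seq (tcom t r) (SetReg r (Succ (Reg r)))"
| "tcom (Dec t) r = Seq (tcom t r) (SetReg r (Pred (Reg r)))"
| "tcom (Inp q t u) r = Seq (tcom t r) (Seq (tcom u (r + 1))
     (If (And (Less (Reg r) (Reg 0)) (Less (Reg (r + 1)) (Reg 0)))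
       (Seq (if q then add_n r (r + 2) else Skip)
         (Seq (addr r) (SetReg r (Load (Reg (r + 1))))))
       (SetReg r (Const 0))))"
| "tcom (Arr j t) r = Seq (tcom t (r + 1))
     (If (Less (Reg (r + 1)) (Reg 0))
       (Seq (SetReg r (Const j)) (Seq (add_n r (r + 2)) (Seq (add_n r (r + 2))
         (Seq (addr r) (SetReg r (Load (Reg (r + 1))))))))
       (SetReg r (Const 0)))"
| "tcom (Equ t u) r = Seq (tcom t r) (Seq (tcom u (r + 1)) (set_bool r (Eq (Reg r) (Reg (r + 1)))))"
| "tcom (Lt t u) r = Seq (tcom t r) (Seq (tcom u (r + 1)) (set_bool r (Less (Reg r) (Reg (r + 1)))))"
| "tcom (Neg t) r = Seq (tcom t r) (set_bool r (Not (nonzero r)))"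
| "tcom (Conj t u) r = Seq (tcom t r) (Seq (tcom u (r + 1))
     (set_bool r (And (nonzero r) (nonzero (r + 1)))))"
| "tcom (Count x t) r = Seq (SetReg r (Reg x)) (Seq (SetReg (r + 1) (Const 0))
     (Seq (SetReg x (Const 0))
     (Seq (While (Less (Reg x) (Reg 0))
       (Seq (tcom t (r + 2))
       (Seq (If (nonzero (r + 2)) (SetReg (r + 1) (Succ (Reg (r + 1)))) Skip)
         (SetReg x (Succ (Reg x))))))
     (Seq (SetReg x (Reg r)) (SetReg r (Reg (r + 1)))))))"

definition addr_time :: "nat \<Rightarrow> nat \<Rightarrow> nat" where
  "addr_time n w = w * (10 * n + 20) + 10"

text \<open>Generous bounds in \<open>n\<close> alone. The second argument of
  \<open>addr_time\<close> bounds the row number: the order matrix ends below row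
  \<open>2 * n\<close>, and array \<open>j\<close> is row \<open>2 * n + j\<close>.\<close>

primrec ttime :: "tm \<Rightarrow> nat \<Rightarrow> nat" where
  "ttime (Num c) = (\<lambda>n. 2)"
| "ttime Size = (\<lambda>n. 2)"
| "ttime (V x) = (\<lambda>n. 2)"
| "ttime (Inc t) = (\<lambda>n. ttime t n + 3)"
| "ttime (Dec t) = (\<lambda>n. ttime t n + 3)"
| "ttime (Inp q t u) = (\<lambda>n. ttime t n + ttime u n + 10 * n + addr_time n (2 * n) + 30)"
| "ttime (Arr j t) = (\<lambda>n. ttime t n + 20 * n + addr_time n (2 * n + j) + 40)"
| "ttime (Equ t u) = (\<lambda>n. ttime t n + ttime u n + 20)"
| "ttime (Lt t u) = (\<lambda>n. ttime t n + ttime u n + 20)"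
| "ttime (Neg t) = (\<lambda>n. ttime t n + 20)"
| "ttime (Conj t u) = (\<lambda>n. ttime t n + ttime u n + 20)"
| "ttime (Count x t) = (\<lambda>n. n * (ttime t n + 20) + 30)"

lemma poly_bounded_addr_time: "poly_bounded f \<Longrightarrow> poly_bounded (\<lambda>n. addr_time n (f n))"
  unfolding addr_time_def by (intro poly_bounded_intros)

lemma poly_bounded_ttime: "poly_bounded (ttime e)"
  apply (induction e) apply simp_all
  apply (intro poly_bounded_intros poly_bounded_addr_time | assumption)+
  done

lemma reach_add_n:
  assumes "0 < r" "0 < f" "r \<noteq> f"
    and "P (s\<lparr>reg := (reg s)(r := reg s r + reg s 0, f := reg s 0)\<rparr>)"
    and "10 * reg s 0 + 6 \<le> T"
  shows "reach (add_n r f) s T P"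
  unfolding add_n_def
proof (rule reach_Seq[where T = 2 and T' = "10 * reg s 0 + 4"])
  let ?I = "\<lambda>i s'. s' = s\<lparr>reg := (reg s)(r := reg s r + i, f := i)\<rparr>"
  show "reach (SetReg f (Const 0)) s 2 (\<lambda>s'. reach
      (While (Less (Reg f) (Reg 0)) (Seq (SetReg r (Succ (Reg r))) (SetReg f (Succ (Reg f)))))
      s' (10 * reg s 0 + 4) P)"
  proof (rule reach_SetReg)
    let ?s = "s\<lparr>reg := (reg s)(f := aval (Const 0) s)\<rparr>"
    have "reach (While (Less (Reg f) (Reg 0)) (Seq (SetReg r (Succ (Reg r))) (SetReg f (Succ (Reg f)))))
      ?s (10 * reg s 0 + 4) (?I (reg s 0))"
    proof (rule reach_While[where T = 6 and P = ?I])
      fix i s' assume i: "i < reg s 0" and s': "?I i s'"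
      have "reach (Seq (SetReg r (Succ (Reg r))) (SetReg f (Succ (Reg f)))) s' 6 (?I (Suc i))"
        using assms s' by (auto intro!: reach_Seq[where T = 3 and T' = 3] reach_SetReg simp: fun_upd_twist)
      then show "bval (Less (Reg f) (Reg 0)) s' \<and>
        reach (Seq (SetReg r (Succ (Reg r))) (SetReg f (Succ (Reg f)))) s' 6 (?I (Suc i))"
        using i s' assms by simp
    qed (use assms in \<open>auto simp: fun_upd_def\<close>)
    then show "reach (While (Less (Reg f) (Reg 0)) (Seq (SetReg r (Succ (Reg r))) (SetReg f (Succ (Reg f)))))
      ?s (10 * reg s 0 + 4) P"
      by (rule reach_mono) (use assms in auto)
  qed simp
qed (use assms in simp)

text \<open>The postcondition is required for every content \<open>v\<close> of the auxiliary
  register: it holds \<open>n\<close> after at least one round, but keeps its old value if the row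
  number is 0.\<close>

lemma reach_addr:
  assumes "0 < r" "reg s r \<le> w"
    and P: "\<And>v. P (s\<lparr>reg := (reg s)(r := 0, r + 1 := reg s (r + 1) + reg s r * reg s 0, r + 2 := v)\<rparr>)"
    and T: "addr_time (reg s 0) w \<le> T"
  shows "reach (addr r) s T P"
proof -
  let ?n = "reg s 0"
  let ?I = "\<lambda>i s'. \<exists>v. s' = s\<lparr>reg := (reg s)(r := reg s r - i, r + 1 := reg s (r + 1) + i * ?n, r + 2 := v)\<rparr>"
  have "reach (addr r) s (addr_time ?n w) (?I (reg s r))"
    unfolding addr_def
  proof (rule reach_While[where T = "10 * ?n + 9" and P = ?I and m = "reg s r"])
    fix i s' assume i: "i < reg s r" and "?I i s'"
    then obtain v where s': "s' = s\<lparr>reg := (reg s)(r := reg s r - i, r + 1 := reg s (r + 1) + i * ?n, r + 2 := v)\<rparr>"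
      by blast
    have "reach (Seq (add_n (r + 1) (r + 2)) (SetReg r (Pred (Reg r)))) s' (10 * ?n + 9) (?I (Suc i))"
      using assms s' i
      by (intro reach_Seq[where T = "10 * ?n + 6" and T' = 3] reach_add_n reach_SetReg exI[of _ "?n"])
        (auto simp: fun_eq_iff)
    then show "bval (nonzero r) s' \<and>
      reach (Seq (add_n (r + 1) (r + 2)) (SetReg r (Pred (Reg r)))) s' (10 * ?n + 9) (?I (Suc i))"
      using i s' by simp
  next
    have "reg s r * (10 * ?n + 9 + 1 + bcost (nonzero r)) \<le> w * (10 * ?n + 20)"
      using assms by (intro mult_le_mono) auto
    then show "reg s r * (10 * ?n + 9 + 1 + bcost (nonzero r)) + 1 + bcost (nonzero r) \<le> addr_time ?n w"
      by (simp add: addr_time_def)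
  qed (auto intro!: exI[of _ "reg s (r + 2)"] simp: fun_eq_iff)
  then show ?thesis by (rule reach_mono) (use P T in auto)
qed

definition represents ::
  "nat \<Rightarrow> (bool \<Rightarrow> nat \<Rightarrow> nat \<Rightarrow> bool) \<Rightarrow> state \<Rightarrow> (nat \<Rightarrow> nat) \<Rightarrow> (nat \<Rightarrow> nat \<Rightarrow> nat) \<Rightarrow> bool" where
  "represents n I s \<rho> A \<longleftrightarrow>
     reg s 0 = n \<and> (\<forall>x. is_var x \<longrightarrow> reg s x = \<rho> x) \<and>
     (\<forall>u<n. \<forall>v<n. mem s (u * n + v) = of_bool (I False u v)) \<and>
     (\<forall>u<n. \<forall>v<n. mem s ((n + u) * n + v) = of_bool (I True u v)) \<and>
     (\<forall>j. \<forall>v<n. mem s ((2 * n + j) * n + v) = A j v)"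

definition keeps_below :: "nat \<Rightarrow> state \<Rightarrow> state \<Rightarrow> bool" where
  "keeps_below r s s' \<longleftrightarrow> mem s' = mem s \<and> (\<forall>x<r. reg s' x = reg s x)"

lemma keeps_below_trans:
  "keeps_below r s s' \<Longrightarrow> keeps_below q s' s'' \<Longrightarrow> r \<le> q \<Longrightarrow> keeps_below r s s''"
  by (auto simp: keeps_below_def)

lemma represents_keeps:
  "represents n I s \<rho> A \<Longrightarrow> keeps_below r s s' \<Longrightarrow> scratch \<le> r \<Longrightarrow> represents n I s' \<rho> A"
  by (auto simp: keeps_below_def represents_def)

text \<open>Generalised over \<open>r\<close>, since subterms are evaluated into higher registers,
  and over \<open>\<rho>\<close>, since the body of \<open>Count\<close> sees a changed variable.
  Keeping all registers below the target protects a first operand while the second is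
  computed.\<close>

lemma tcom_correct:
  assumes "wf_tm e" "represents n I s \<rho> A" "scratch \<le> r"
  shows "reach (tcom e r) s (ttime e n) (\<lambda>s'. keeps_below r s s' \<and> reg s' r = tval n I A e \<rho>)"
  using assms
proof (induction e arbitrary: r s \<rho>)
  case (Num c)
  then show ?case by (auto intro!: reach_SetReg simp: keeps_below_def)
next
  case Size
  then show ?case by (auto intro!: reach_SetReg simp: keeps_below_def represents_def)
next
  case (V x)
  then show ?case by (auto intro!: reach_SetReg simp: keeps_below_def represents_def)
next
  case (Inc t)
  have "reach (tcom t r) s (ttime t n) (\<lambda>s'. keeps_below r s s' \<and> reg s' r = tval n I A t \<rho>)"
    using Inc by simp
  then show ?case unfolding tcom.simps
    by (rule reach_Seq[where T' = 3, OF reach_mono, OF _ order_refl])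
      (auto intro!: reach_SetReg simp: keeps_below_def)
next
  case (Dec t)
  have "reach (tcom t r) s (ttime t n) (\<lambda>s'. keeps_below r s s' \<and> reg s' r = tval n I A t \<rho>)"
    using Dec by simp
  then show ?case unfolding tcom.simps
    by (rule reach_Seq[where T' = 3, OF reach_mono, OF _ order_refl])
      (auto intro!: reach_SetReg simp: keeps_below_def)
next
  case (Neg t)
  have "reach (tcom t r) s (ttime t n) (\<lambda>s'. keeps_below r s s' \<and> reg s' r = tval n I A t \<rho>)"
    using Neg by simp
  then show ?case unfolding tcom.simps set_bool_def
    by (rule reach_Seq[where T' = 20, OF reach_mono, OF _ order_refl])
      (auto intro!: reach_If[where T = 2] reach_SetReg simp: keeps_below_def)
next
  case (Equ t u)
  have 1: "reach (tcom t r) s (ttime t n) (\<lambda>s'. keeps_below r s s' \<and> reg s' r = tval n I A t \<rho>)"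
    using Equ by simp
  have 2: "reach (tcom u (r + 1)) s' (ttime u n) (\<lambda>s''. keeps_below (r + 1) s' s'' \<and> reg s'' (r + 1) = tval n I A u \<rho>)"
    if "keeps_below r s s'" for s'
    using Equ.prems represents_keeps[OF _ that] by (intro Equ.IH) auto
  show ?case unfolding tcom.simps set_bool_def
    apply (rule reach_Seq[where T' = "ttime u n + 20", OF reach_mono[OF 1 order_refl]])
     apply (rule reach_Seq[where T' = 20, OF reach_mono[OF 2 order_refl]])
    by (auto intro!: reach_If[where T = 2] reach_SetReg simp: keeps_below_def)
next
  case (Lt t u)
  have 1: "reach (tcom t r) s (ttime t n) (\<lambda>s'. keeps_below r s s' \<and> reg s' r = tval n I A t \<rho>)"
    using Lt by simp
  have 2: "reach (tcom u (r + 1)) s' (ttime u n) (\<lambda>s''. keeps_below (r + 1) s' s'' \<and> reg s'' (r + 1) = tval n I A u \<rho>)"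
    if "keeps_below r s s'" for s'
    using Lt.prems represents_keeps[OF _ that] by (intro Lt.IH) auto
  show ?case unfolding tcom.simps set_bool_def
    apply (rule reach_Seq[where T' = "ttime u n + 20", OF reach_mono[OF 1 order_refl]])
     apply (rule reach_Seq[where T' = 20, OF reach_mono[OF 2 order_refl]])
    by (auto intro!: reach_If[where T = 2] reach_SetReg simp: keeps_below_def)
next
  case (Conj t u)
  have 1: "reach (tcom t r) s (ttime t n) (\<lambda>s'. keeps_below r s s' \<and> reg s' r = tval n I A t \<rho>)"
    using Conj by simp
  have 2: "reach (tcom u (r + 1)) s' (ttime u n) (\<lambda>s''. keeps_below (r + 1) s' s'' \<and> reg s'' (r + 1) = tval n I A u \<rho>)"
    if "keeps_below r s s'" for s'
    using Conj.prems represents_keeps[OF _ that] by (intro Conj.IH) auto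
  show ?case unfolding tcom.simps set_bool_def
    apply (rule reach_Seq[where T' = "ttime u n + 20", OF reach_mono[OF 1 order_refl]])
     apply (rule reach_Seq[where T' = 20, OF reach_mono[OF 2 order_refl]])
    by (auto intro!: reach_If[where T = 2] reach_SetReg simp: keeps_below_def)
next
  case (Inp q t u)
  have 1: "reach (tcom t r) s (ttime t n) (\<lambda>s'. keeps_below r s s' \<and> reg s' r = tval n I A t \<rho>)"
    using Inp by simp
  have 2: "reach (tcom u (r + 1)) s' (ttime u n) (\<lambda>s''. keeps_below (r + 1) s' s'' \<and> reg s'' (r + 1) = tval n I A u \<rho>)"
    if "keeps_below r s s'" for s'
    using Inp.prems represents_keeps[OF _ that] by (intro Inp.IH) auto
  have 3: "reach (If (And (Less (Reg r) (Reg 0)) (Less (Reg (r + 1)) (Reg 0)))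
       (Seq (if q then add_n r (r + 2) else Skip) (Seq (addr r) (SetReg r (Load (Reg (r + 1))))))
       (SetReg r (Const 0))) s1 (10 * n + addr_time n (2 * n) + 30)
     (\<lambda>s'. keeps_below r s s' \<and> reg s' r = tval n I A (Inp q t u) \<rho>)" (is "reach _ _ _ ?P")
    if k: "keeps_below r s s1" and r1: "reg s1 r = tval n I A t \<rho>" "reg s1 (r + 1) = tval n I A u \<rho>" for s1
  proof (rule reach_If[where T = "10 * n + addr_time n (2 * n) + 10"])
    have rep: "represents n I s1 \<rho> A" using represents_keeps[OF _ k] Inp.prems by simp
    then have n: "reg s1 0 = n" by (simp add: represents_def)
    assume "bval (And (Less (Reg r) (Reg 0)) (Less (Reg (r + 1)) (Reg 0))) s1"
    then have lt: "tval n I A t \<rho> < n" "tval n I A u \<rho> < n" using r1 n by auto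
    show "reach (Seq (if q then add_n r (r + 2) else Skip) (Seq (addr r) (SetReg r (Load (Reg (r + 1))))))
      s1 (10 * n + addr_time n (2 * n) + 10) ?P"
    proof (rule reach_Seq[where T = "10 * n + 6" and T' = "addr_time n (2 * n) + 3"])
      have P: "?P (s2\<lparr>reg := (reg s2)(r := aval (Load (Reg (r + 1))) s2)\<rparr>)"
        if "s2 = s1\<lparr>reg := (reg s1)(r := 0, r + 1 := reg s1 (r + 1) + (if q then reg s1 r + n else reg s1 r) * n, r + 2 := v)\<rparr>" for s2 v
      proof -
        have idx: "reg s2 (r + 1) = (if q then (n + tval n I A t \<rho>) * n + tval n I A u \<rho>
          else tval n I A t \<rho> * n + tval n I A u \<rho>)"
          using that r1 by (simp add: algebra_simps)
        have "mem s2 = mem s1" using that by simp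
        then have "mem s2 (reg s2 (r + 1)) = tval n I A (Inp q t u) \<rho>"
          unfolding idx using rep lt by (simp add: represents_def)
        then show ?thesis using that k by (auto simp: keeps_below_def)
      qed
      show "reach (if q then add_n r (r + 2) else Skip) s1 (10 * n + 6)
        (\<lambda>s'. reach (Seq (addr r) (SetReg r (Load (Reg (r + 1))))) s' (addr_time n (2 * n) + 3) ?P)"
      proof (cases q)
        case True
        have "reach (add_n r (r + 2)) s1 (10 * n + 6)
          (\<lambda>s'. reach (Seq (addr r) (SetReg r (Load (Reg (r + 1))))) s' (addr_time n (2 * n) + 3) ?P)"
          apply (rule reach_add_n)
              apply (use Inp.prems n in simp_all)[3]
           apply (rule reach_Seq[where T' = 3])
            apply (rule reach_addr[where w = "2 * n"])
               apply (use Inp.prems n lt r1 in simp_all)[2]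
             apply (rule reach_SetReg)
              apply (rule P)
              apply (use Inp.prems n True in \<open>auto simp: fun_eq_iff\<close>)
          done
        then show ?thesis using True by simp
      next
        case False
        have "reach Skip s1 (10 * n + 6)
          (\<lambda>s'. reach (Seq (addr r) (SetReg r (Load (Reg (r + 1))))) s' (addr_time n (2 * n) + 3) ?P)"
          apply (rule reach_Skip)
           apply (rule reach_Seq[where T' = 3])
            apply (rule reach_addr[where w = "2 * n"])
               apply (use Inp.prems n lt r1 in simp_all)[2]
             apply (rule reach_SetReg)
              apply (rule P)
              apply (use Inp.prems n False in \<open>auto simp: fun_eq_iff\<close>)
          done
        then show ?thesis using False by simp
      qed
    qed simp
  next
    assume "\<not> bval (And (Less (Reg r) (Reg 0)) (Less (Reg (r + 1)) (Reg 0))) s1"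
    moreover have "represents n I s1 \<rho> A" using represents_keeps[OF _ k] Inp.prems by simp
    then have "reg s1 0 = n" by (simp add: represents_def)
    ultimately have "\<not> (tval n I A t \<rho> < n \<and> tval n I A u \<rho> < n)" using r1 by auto
    then show "reach (SetReg r (Const 0)) s1 (10 * n + addr_time n (2 * n) + 10) ?P"
      using k by (auto intro!: reach_SetReg simp: keeps_below_def)
  qed simp
  show ?case unfolding tcom.simps
    apply (rule reach_Seq[where T' = "ttime u n + (10 * n + addr_time n (2 * n) + 30)", OF reach_mono[OF 1 order_refl]])
     apply (rule reach_Seq[where T' = "10 * n + addr_time n (2 * n) + 30", OF reach_mono[OF 2 order_refl]])
       apply simp
      apply (rule 3)
    by (auto elim: keeps_below_trans simp: keeps_below_def)
next
  case (Arr j t)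
  have 1: "reach (tcom t (r + 1)) s (ttime t n) (\<lambda>s'. keeps_below (r + 1) s s' \<and> reg s' (r + 1) = tval n I A t \<rho>)"
    using Arr by simp
  let ?T = "addr_time n (2 * n + j)"
  have 2: "reach (If (Less (Reg (r + 1)) (Reg 0))
       (Seq (SetReg r (Const j)) (Seq (add_n r (r + 2)) (Seq (add_n r (r + 2))
         (Seq (addr r) (SetReg r (Load (Reg (r + 1))))))))
       (SetReg r (Const 0))) s1 (20 * n + ?T + 40)
     (\<lambda>s'. keeps_below r s s' \<and> reg s' r = tval n I A (Arr j t) \<rho>)" (is "reach _ _ _ ?P")
    if k: "keeps_below (r + 1) s s1" and r1: "reg s1 (r + 1) = tval n I A t \<rho>" for s1
  proof (rule reach_If[where T = "20 * n + ?T + 20"])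
    have rep: "represents n I s1 \<rho> A" using represents_keeps[OF _ k] Arr.prems by simp
    then have n: "reg s1 0 = n" by (simp add: represents_def)
    assume "bval (Less (Reg (r + 1)) (Reg 0)) s1"
    then have lt: "tval n I A t \<rho> < n" using r1 n by auto
    have P: "?P (s2\<lparr>reg := (reg s2)(r := aval (Load (Reg (r + 1))) s2)\<rparr>)"
      if "s2 = s1\<lparr>reg := (reg s1)(r := 0, r + 1 := reg s1 (r + 1) + (j + n + n) * n, r + 2 := v)\<rparr>" for s2 v
    proof -
      have "reg s1 (r + 1) + (j + n + n) * n = (2 * n + j) * n + tval n I A t \<rho>"
        using r1 by (simp add: algebra_simps)
      then show ?thesis
        using that rep k r1 lt by (auto simp: keeps_below_def represents_def)
    qed
    show "reach (Seq (SetReg r (Const j)) (Seq (add_n r (r + 2)) (Seq (add_n r (r + 2))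
         (Seq (addr r) (SetReg r (Load (Reg (r + 1)))))))) s1 (20 * n + ?T + 20) ?P"
      apply (rule reach_Seq[where T = 2 and T' = "20 * n + ?T + 15"])
       apply (rule reach_SetReg)
        apply (rule reach_Seq[where T = "10 * n + 6" and T' = "10 * n + ?T + 9"])
         apply (rule reach_add_n)
             apply (use Arr.prems n in simp_all)[3]
          apply (rule reach_Seq[where T = "10 * n + 6" and T' = "?T + 3"])
           apply (rule reach_add_n)
               apply (use Arr.prems n in simp_all)[3]
            apply (rule reach_Seq[where T' = 3])
             apply (rule reach_addr[where w = "2 * n + j"])
                apply (use Arr.prems n lt r1 in simp_all)[2]
              apply (rule reach_SetReg)
               apply (rule P)
               apply (use Arr.prems n in \<open>auto simp: fun_eq_iff\<close>)
      done
  next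
    assume "\<not> bval (Less (Reg (r + 1)) (Reg 0)) s1"
    moreover have "represents n I s1 \<rho> A" using represents_keeps[OF _ k] Arr.prems by simp
    then have "reg s1 0 = n" by (simp add: represents_def)
    ultimately have "\<not> tval n I A t \<rho> < n" using r1 by auto
    then show "reach (SetReg r (Const 0)) s1 (20 * n + ?T + 20) ?P"
      using k by (auto intro!: reach_SetReg simp: keeps_below_def)
  qed simp
  show ?case unfolding tcom.simps
    apply (rule reach_Seq[where T' = "20 * n + ?T + 40", OF reach_mono[OF 1 order_refl]])
     apply (rule 2)
    by auto
next
  case (Count x t)
  then have x: "is_var x" and wf: "wf_tm t" by auto
  let ?c = "\<lambda>i. card {j. j < i \<and> tval n I A t (\<rho>(x := j)) \<noteq> 0}"
  \<comment> \<open>Register \<open>x\<close> runs through the vertices during the loop, so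
    \<open>keeps_below r\<close> fails inside it. \<open>Inv\<close> exempts \<open>x\<close>, whose
    old value waits in \<open>r\<close>.\<close>
  define Inv :: "nat \<Rightarrow> state \<Rightarrow> bool" where "Inv i s' \<longleftrightarrow> reg s' x = i \<and> reg s' r = \<rho> x \<and> reg s' (r + 1) = ?c i \<and>
    mem s' = mem s \<and> (\<forall>y<r. y \<noteq> x \<longrightarrow> reg s' y = reg s y)" for i s'
  have rep: "represents n I s' (\<rho>(x := i)) A" if "Inv i s'" for i s'
    using that Count.prems x by (auto simp: Inv_def represents_def)
  have body: "reach (Seq (tcom t (r + 2))
       (Seq (If (nonzero (r + 2)) (SetReg (r + 1) (Succ (Reg (r + 1)))) Skip)
         (SetReg x (Succ (Reg x))))) s' (ttime t n + 15) (Inv (Suc i))" if i: "Inv i s'" for i s'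
  proof (rule reach_Seq[where T' = 15])
    show "reach (tcom t (r + 2)) s' (ttime t n) (\<lambda>s''. reach
         (Seq (If (nonzero (r + 2)) (SetReg (r + 1) (Succ (Reg (r + 1)))) Skip) (SetReg x (Succ (Reg x)))) s'' 15 (Inv (Suc i)))"
    proof (rule reach_mono[OF Count.IH order_refl])
      show "wf_tm t" "represents n I s' (\<rho>(x := i)) A" "scratch \<le> r + 2"
        using wf rep[OF i] Count.prems by auto
      fix s'' assume s'': "keeps_below (r + 2) s' s'' \<and> reg s'' (r + 2) = tval n I A t (\<rho>(x := i))"
      have "{j. j < Suc i \<and> tval n I A t (\<rho>(x := j)) \<noteq> 0} =
        (if tval n I A t (\<rho>(x := i)) = 0 then {} else {i}) \<union> {j. j < i \<and> tval n I A t (\<rho>(x := j)) \<noteq> 0}"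
        by (auto simp: less_Suc_eq)
      then have "?c (Suc i) = (if tval n I A t (\<rho>(x := i)) = 0 then ?c i else Suc (?c i))"
        by simp
      then show "reach (Seq (If (nonzero (r + 2)) (SetReg (r + 1) (Succ (Reg (r + 1)))) Skip) (SetReg x (Succ (Reg x)))) s'' 15 (Inv (Suc i))"
        using i s'' x Count.prems
        by (intro reach_Seq[where T = 9 and T' = 3] reach_If[where T = 3] reach_SetReg reach_Skip)
          (auto simp: Inv_def keeps_below_def)
    qed
  qed simp
  have loop: "reach (While (Less (Reg x) (Reg 0)) (Seq (tcom t (r + 2))
       (Seq (If (nonzero (r + 2)) (SetReg (r + 1) (Succ (Reg (r + 1)))) Skip)
         (SetReg x (Succ (Reg x)))))) s' (n * (ttime t n + 20) + 5) (Inv n)" if "Inv 0 s'" for s'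
  proof (rule reach_While[where P = Inv, OF _ _ that])
    show "bval (Less (Reg x) (Reg 0)) s' \<and> reach (Seq (tcom t (r + 2))
       (Seq (If (nonzero (r + 2)) (SetReg (r + 1) (Succ (Reg (r + 1)))) Skip)
         (SetReg x (Succ (Reg x))))) s' (ttime t n + 15) (Inv (Suc i))"
      if "i < n" "Inv i s'" for i s'
    proof
      show "bval (Less (Reg x) (Reg 0)) s'"
        using that rep[of i s'] x by (auto simp: represents_def Inv_def)
    qed (rule body[OF that(2)])
    show "\<not> bval (Less (Reg x) (Reg 0)) s'" if "Inv n s'" for s'
      using that rep[of n s'] x by (auto simp: represents_def Inv_def)
  qed (auto simp: algebra_simps)
  show ?case unfolding tcom.simps
    apply (rule reach_Seq[where T = 2 and T' = "n * (ttime t n + 20) + 20"])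
     apply (rule reach_SetReg)
      apply (rule reach_Seq[where T = 2 and T' = "n * (ttime t n + 20) + 15"])
       apply (rule reach_SetReg)
        apply (rule reach_Seq[where T = 2 and T' = "n * (ttime t n + 20) + 12"])
         apply (rule reach_SetReg)
          apply (rule reach_Seq[where T' = 5])
           apply (rule reach_mono[OF loop order_refl])
            apply (use Count.prems x in \<open>auto simp: Inv_def represents_def\<close>)[]
           apply (rule reach_Seq[where T = 2 and T' = 2])
            apply (rule reach_SetReg)
             apply (rule reach_SetReg)
    using Count.prems x by (auto simp: Inv_def represents_def keeps_below_def)
qed


section \<open>Imperative programs over the terms, and their compilation\<close>

datatype hcom =
    Asg nat tm
  | Put nat tm tm
  | Sq hcom hcom (infixr \<open>;;\<close> 60)
  | Cond tm hcom hcom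
  | Loop tm hcom

type_synonym store = "(nat \<Rightarrow> nat) \<times> (nat \<Rightarrow> nat \<Rightarrow> nat)"

text \<open>Every assignment and every test is one step, whatever its terms cost. \<open>Put\<close>
  has no rule for an index outside the array, because the compiled store would then hit another
  row.\<close>

inductive hexec :: "nat \<Rightarrow> (bool \<Rightarrow> nat \<Rightarrow> nat \<Rightarrow> bool) \<Rightarrow> hcom \<Rightarrow> store \<Rightarrow> nat \<Rightarrow> store \<Rightarrow> bool"
  for n I where
  Asg: "hexec n I (Asg x e) (\<rho>, A) 1 (\<rho>(x := tval n I A e \<rho>), A)"
| Put: "tval n I A e \<rho> < n \<Longrightarrow>
    hexec n I (Put j e f) (\<rho>, A) 1 (\<rho>, A(j := (A j)(tval n I A e \<rho> := tval n I A f \<rho>)))"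
| Sq: "hexec n I c s t s' \<Longrightarrow> hexec n I d s' t' s'' \<Longrightarrow> hexec n I (c ;; d) s (t + t') s''"
| CondTrue: "tval n I A e \<rho> \<noteq> 0 \<Longrightarrow> hexec n I c (\<rho>, A) t s' \<Longrightarrow> hexec n I (Cond e c d) (\<rho>, A) (1 + t) s'"
| CondFalse: "tval n I A e \<rho> = 0 \<Longrightarrow> hexec n I d (\<rho>, A) t s' \<Longrightarrow> hexec n I (Cond e c d) (\<rho>, A) (1 + t) s'"
| LoopFalse: "tval n I A e \<rho> = 0 \<Longrightarrow> hexec n I (Loop e c) (\<rho>, A) 1 (\<rho>, A)"
| LoopTrue: "tval n I A e \<rho> \<noteq> 0 \<Longrightarrow> hexec n I c (\<rho>, A) t s' \<Longrightarrow> hexec n I (Loop e c) s' t' s'' \<Longrightarrow>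
    hexec n I (Loop e c) (\<rho>, A) (1 + t + t') s''"

primrec wf_hcom :: "hcom \<Rightarrow> bool" where
  "wf_hcom (Asg x e) = (is_var x \<and> wf_tm e)"
| "wf_hcom (Put j e f) = (wf_tm e \<and> wf_tm f)"
| "wf_hcom (c ;; d) = (wf_hcom c \<and> wf_hcom d)"
| "wf_hcom (Cond e c d) = (wf_tm e \<and> wf_hcom c \<and> wf_hcom d)"
| "wf_hcom (Loop e c) = (wf_tm e \<and> wf_hcom c)"

primrec hcompile :: "hcom \<Rightarrow> com" where
  "hcompile (Asg x e) = Seq (tcom e scratch) (SetReg x (Reg scratch))"
| "hcompile (Put j e f) = Seq (tcom f scratch) (Seq (tcom e (scratch + 2))
     (Seq (SetReg (scratch + 1) (Const j)) (Seq (add_n (scratch + 1) (scratch + 3))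
     (Seq (add_n (scratch + 1) (scratch + 3)) (Seq (addr (scratch + 1))
       (Store (Reg (scratch + 2)) (Reg scratch)))))))"
| "hcompile (c ;; d) = Seq (hcompile c) (hcompile d)"
| "hcompile (Cond e c d) = Seq (tcom e scratch) (If (nonzero scratch) (hcompile c) (hcompile d))"
| "hcompile (Loop e c) = Seq (tcom e scratch)
     (While (nonzero scratch) (Seq (hcompile c) (tcom e scratch)))"

text \<open>Machine time per counted step. Costs of alternatives are added rather than maximised, so
  that closure under sums suffices to keep the bound polynomial.\<close>

primrec step_time :: "hcom \<Rightarrow> nat \<Rightarrow> nat" where
  "step_time (Asg x e) = (\<lambda>n. ttime e n + 2)"
| "step_time (Put j e f) = (\<lambda>n. ttime f n + ttime e n + 20 * n + addr_time n (2 * n + j) + 40)"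
| "step_time (c ;; d) = (\<lambda>n. step_time c n + step_time d n)"
| "step_time (Cond e c d) = (\<lambda>n. ttime e n + step_time c n + step_time d n + 5)"
| "step_time (Loop e c) = (\<lambda>n. ttime e n + step_time c n + 5)"

lemma poly_bounded_step_time: "poly_bounded (step_time c)"
  apply (induction c) apply simp_all
  apply (intro poly_bounded_intros poly_bounded_addr_time poly_bounded_ttime | assumption)+
  done

lemma array_index_inj:
  fixes n :: nat
  assumes "u < n" "v < n"
  shows "(2 * n + i) * n + u = (2 * n + j) * n + v \<longleftrightarrow> i = j \<and> u = v"
proof
  assume eq: "(2 * n + i) * n + u = (2 * n + j) * n + v"
  have "((2 * n + i) * n + u) div n = 2 * n + i" "((2 * n + j) * n + v) div n = 2 * n + j"
    using assms by simp_all
  with eq have "i = j" by simp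
  with eq show "i = j \<and> u = v" by simp
qed simp

lemma index_less: "u < a \<Longrightarrow> v < n \<Longrightarrow> u * n + v < a * (n :: nat)"
  by (metis add.commute div_less_iff_less_mult div_mult_self1 div_less
      add.right_neutral bot_nat_0.not_eq_extremum less_nat_zero_code)

lemma represents_put:
  assumes "represents n I s \<rho> A" "v < n"
    and "reg s' 0 = n" "\<And>x. is_var x \<Longrightarrow> reg s' x = reg s x"
    and "mem s' = (mem s)((2 * n + j) * n + v := w)"
  shows "represents n I s' \<rho> (A(j := (A j)(v := w)))"
  unfolding represents_def
proof (intro conjI allI impI)
  fix u x assume ux: "u < n" "x < n"
  \<comment> \<open>Both matrices lie below address \<open>2 * n * n\<close>, where the arrays
    begin.\<close>
  have "u * n + x < (2 * n) * n" "(n + u) * n + x < (2 * n) * n"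
    using ux by (auto intro!: index_less)
  moreover have "(2 * n) * n \<le> (2 * n + j) * n + v" by (simp add: algebra_simps)
  ultimately have ne: "u * n + x \<noteq> (2 * n + j) * n + v" "(n + u) * n + x \<noteq> (2 * n + j) * n + v"
    by linarith+
  show "mem s' (u * n + x) = of_bool (I False u x)"
    using assms ne(1) ux by (simp add: represents_def)
  show "mem s' ((n + u) * n + x) = of_bool (I True u x)"
    using assms ne(2) ux by (simp add: represents_def)
next
  fix i x assume "x < n"
  then show "mem s' ((2 * n + i) * n + x) = (A(j := (A j)(v := w))) i x"
    using assms by (auto simp: represents_def array_index_inj)
qed (use assms in \<open>auto simp: represents_def\<close>)

lemma hcompile_correct:
  assumes "hexec n I c z N z'" "wf_hcom c" "represents n I s (fst z) (snd z)"
  shows "reach (hcompile c) s (N * step_time c n) (\<lambda>s'. represents n I s' (fst z') (snd z'))"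
  using assms
proof (induction arbitrary: s rule: hexec.induct)
  case (Asg x e \<rho> A)
  have 1: "reach (tcom e scratch) s (ttime e n) (\<lambda>s'. keeps_below scratch s s' \<and> reg s' scratch = tval n I A e \<rho>)"
    using Asg by (intro tcom_correct) auto
  show ?case unfolding hcompile.simps
    apply (rule reach_Seq[where T' = 2, OF reach_mono[OF 1 order_refl]])
     apply (rule reach_SetReg)
    using Asg represents_keeps[of n I s \<rho> A scratch] by (auto simp: represents_def keeps_below_def)
next
  case (Put A e \<rho> j f)
  have 1: "reach (tcom f scratch) s (ttime f n) (\<lambda>s'. keeps_below scratch s s' \<and> reg s' scratch = tval n I A f \<rho>)"
    using Put by (intro tcom_correct) auto
  have 2: "reach (tcom e (scratch + 2)) s1 (ttime e n) (\<lambda>s'. keeps_below (scratch + 2) s1 s' \<and> reg s' (scratch + 2) = tval n I A e \<rho>)"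
    if "keeps_below scratch s s1" for s1
    using Put.prems represents_keeps[OF _ that] by (intro tcom_correct) auto
  let ?T = "addr_time n (2 * n + j)"
  let ?v = "tval n I A e \<rho>" and ?w = "tval n I A f \<rho>"
  have 3: "reach (Seq (SetReg (scratch + 1) (Const j)) (Seq (add_n (scratch + 1) (scratch + 3))
     (Seq (add_n (scratch + 1) (scratch + 3)) (Seq (addr (scratch + 1))
       (Store (Reg (scratch + 2)) (Reg scratch)))))) s2 (20 * n + ?T + 40)
       (\<lambda>s'. represents n I s' \<rho> (A(j := (A j)(?v := ?w))))"
    if k1: "keeps_below scratch s s1" and r1: "reg s1 scratch = ?w"
      and k2: "keeps_below (scratch + 2) s1 s2" and r2: "reg s2 (scratch + 2) = ?v" for s1 s2
  proof -
    have k: "keeps_below scratch s s2" using keeps_below_trans[OF k1 k2] by simp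
    have w: "reg s2 scratch = ?w" using r1 k2 by (auto simp: keeps_below_def)
    have rep: "represents n I s2 \<rho> A" using represents_keeps[OF _ k] Put.prems by auto
    then have n: "reg s2 0 = n" by (simp add: represents_def)
    have P: "represents n I (s3\<lparr>mem := (mem s3)(aval (Reg (scratch + 2)) s3 := aval (Reg scratch) s3)\<rparr>)
        \<rho> (A(j := (A j)(?v := ?w)))"
      if "s3 = s2\<lparr>reg := (reg s2)(scratch + 1 := 0, scratch + 2 := ?v + (j + n + n) * n, scratch + 3 := x)\<rparr>" for s3 x
      using rep Put.hyps by (rule represents_put)
        (use that n w in \<open>auto simp: add_ac mult_2 ac_simps\<close>)
    show ?thesis
      apply (rule reach_Seq[where T = 2 and T' = "20 * n + ?T + 35"])
       apply (rule reach_SetReg)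
        apply (rule reach_Seq[where T = "10 * n + 6" and T' = "10 * n + ?T + 20"])
         apply (rule reach_add_n)
             apply (use n in simp_all)[3]
          apply (rule reach_Seq[where T = "10 * n + 6" and T' = "?T + 13"])
           apply (rule reach_add_n)
               apply (use n in simp_all)[3]
            apply (rule reach_Seq[where T' = 3])
             apply (rule reach_addr[where w = "2 * n + j"])
                apply (use n in simp_all)[2]
              apply (rule reach_Store)
               apply (rule P)
               apply (use n r2 in \<open>auto simp: fun_eq_iff\<close>)
      done
  qed
  show ?case unfolding hcompile.simps
    apply (rule reach_Seq[where T' = "ttime e n + (20 * n + ?T + 40)", OF reach_mono[OF 1 order_refl]])
     apply (rule reach_Seq[where T' = "20 * n + ?T + 40", OF reach_mono[OF 2 order_refl]])
      apply simp
     apply (simp only: fst_conv snd_conv)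
     apply (rule 3)
    by auto
next
  case (Sq c z t z' d t' z'')
  have 1: "reach (hcompile c) s (t * step_time c n) (\<lambda>s'. represents n I s' (fst z') (snd z'))"
    using Sq by simp
  show ?case unfolding hcompile.simps
    apply (rule reach_Seq[OF reach_mono[OF 1 order_refl]])
     apply (rule Sq.IH(2))
    using Sq by (auto simp: algebra_simps)
next
  case (CondTrue A e \<rho> c t z' d)
  have 1: "reach (tcom e scratch) s (ttime e n) (\<lambda>s'. keeps_below scratch s s' \<and> reg s' scratch = tval n I A e \<rho>)"
    using CondTrue by (intro tcom_correct) auto
  show ?case unfolding hcompile.simps
    apply (rule reach_Seq[where T' = "t * step_time c n + 5", OF reach_mono[OF 1 order_refl]])
     apply (rule reach_If[where T = "t * step_time c n"])
       apply (rule CondTrue.IH)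
    using CondTrue represents_keeps[of n I s \<rho> A scratch] by (auto simp: algebra_simps)
next
  case (CondFalse A e \<rho> d t z' c)
  have 1: "reach (tcom e scratch) s (ttime e n) (\<lambda>s'. keeps_below scratch s s' \<and> reg s' scratch = tval n I A e \<rho>)"
    using CondFalse by (intro tcom_correct) auto
  show ?case unfolding hcompile.simps
    apply (rule reach_Seq[where T' = "t * step_time d n + 5", OF reach_mono[OF 1 order_refl]])
     apply (rule reach_If[where T = "t * step_time d n"])
       defer
       apply (rule CondFalse.IH)
    using CondFalse represents_keeps[of n I s \<rho> A scratch] by (auto simp: algebra_simps)
next
  case (LoopFalse A e \<rho> c)
  have 1: "reach (tcom e scratch) s (ttime e n) (\<lambda>s'. keeps_below scratch s s' \<and> reg s' scratch = tval n I A e \<rho>)"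
    using LoopFalse by (intro tcom_correct) auto
  have 2: "reach (While (nonzero scratch) (Seq (hcompile c) (tcom e scratch))) s' 5 (\<lambda>s'. represents n I s' \<rho> A)"
    if "keeps_below scratch s s'" "reg s' scratch = 0" for s'
    unfolding reach_def
    using that LoopFalse represents_keeps[OF _ that(1)]
    by (intro exI[of _ "1 + bcost (nonzero scratch)"] exI[of _ s'] conjI exec.WhileFalse) auto
  show ?case unfolding hcompile.simps
    apply (rule reach_Seq[where T' = 5, OF reach_mono[OF 1 order_refl]])
    using 2 LoopFalse by auto
next
  case (LoopTrue A e \<rho> c t z' t' z'')
  let ?W = "While (nonzero scratch) (Seq (hcompile c) (tcom e scratch))"
  have "reach (tcom e scratch) s (ttime e n) (\<lambda>s'. keeps_below scratch s s' \<and> reg s' scratch = tval n I A e \<rho>)"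
    using LoopTrue by (intro tcom_correct) auto
  then obtain t0 s0 where e0: "exec (tcom e scratch) s t0 s0" "t0 \<le> ttime e n"
    and k0: "keeps_below scratch s s0" "reg s0 scratch = tval n I A e \<rho>" by (auto simp: reach_def)
  have "represents n I s0 \<rho> A" using LoopTrue.prems represents_keeps[OF _ k0(1)] by auto
  then have "reach (hcompile c) s0 (t * step_time c n) (\<lambda>s'. represents n I s' (fst z') (snd z'))"
    using LoopTrue by simp
  then obtain t1 s1 where e1: "exec (hcompile c) s0 t1 s1" "t1 \<le> t * step_time c n"
    and r1: "represents n I s1 (fst z') (snd z')" by (auto simp: reach_def)
  from LoopTrue.IH(2)[OF LoopTrue.prems(1) r1] obtain t2 s2 where
    e2: "exec (Seq (tcom e scratch) ?W) s1 t2 s2" "t2 \<le> t' * step_time (Loop e c) n"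
    and r2: "represents n I s2 (fst z'') (snd z'')" by (auto simp: reach_def)
  \<comment> \<open>The compiled loop evaluates its test once in front of the machine loop and again
    at the end of every body. The evaluation that opens the run of the remaining iterations is split
    off here and becomes the end of the first body.\<close>
  from e2(1) obtain t3 t4 s3 where e3: "exec (tcom e scratch) s1 t3 s3" and e4: "exec ?W s3 t4 s2"
    and t2: "t2 = t3 + t4" by (auto elim: SeqE)
  have "bval (nonzero scratch) s0" using k0 LoopTrue.hyps by simp
  from exec.Seq[OF e0(1) exec.WhileTrue[OF this exec.Seq[OF e1(1) e3] e4]]
  have "exec (hcompile (Loop e c)) s (t0 + (1 + bcost (nonzero scratch) + (t1 + t3) + t4)) s2"
    by simp
  moreover have "t0 + (1 + bcost (nonzero scratch) + (t1 + t3) + t4) \<le> (1 + t + t') * step_time (Loop e c) n"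
  proof -
    let ?K = "step_time (Loop e c) n"
    have "t * step_time c n \<le> t * ?K" by (intro mult_le_mono2) simp
    moreover have "ttime e n + 5 \<le> ?K" by simp
    ultimately have "t0 + (1 + bcost (nonzero scratch) + (t1 + t3) + t4) \<le> ?K + t * ?K + t' * ?K"
      using e0(2) e1(2) e2(2) t2 unfolding bcost.simps acost.simps by linarith
    then show ?thesis by (simp only: distrib_right mult_1)
  qed
  ultimately show ?case using r2 unfolding reach_def by blast
qed


section \<open>Reasoning about high-level programs\<close>

definition spec ::
  "nat \<Rightarrow> (bool \<Rightarrow> nat \<Rightarrow> nat \<Rightarrow> bool) \<Rightarrow> hcom \<Rightarrow> store \<Rightarrow> nat \<Rightarrow> (store \<Rightarrow> bool) \<Rightarrow> bool" where
  "spec n I c z N Q \<longleftrightarrow> (\<exists>t z'. hexec n I c z t z' \<and> t \<le> N \<and> Q z')"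

lemma spec_mono: "spec n I c z N Q \<Longrightarrow> N \<le> N' \<Longrightarrow> (\<And>z. Q z \<Longrightarrow> Q' z) \<Longrightarrow> spec n I c z N' Q'"
  unfolding spec_def by (meson le_trans)

lemma spec_Asg:
  "Q (\<rho>(x := tval n I A e \<rho>), A) \<Longrightarrow> 1 \<le> N \<Longrightarrow> spec n I (Asg x e) (\<rho>, A) N Q"
  unfolding spec_def using hexec.Asg by blast

lemma spec_Put:
  "tval n I A e \<rho> < n \<Longrightarrow> Q (\<rho>, A(j := (A j)(tval n I A e \<rho> := tval n I A f \<rho>))) \<Longrightarrow> 1 \<le> N \<Longrightarrow>
   spec n I (Put j e f) (\<rho>, A) N Q"
  unfolding spec_def using hexec.Put by blast

lemma spec_Sq:
  "spec n I c z N (\<lambda>z'. spec n I d z' N' Q) \<Longrightarrow> N + N' \<le> M \<Longrightarrow> spec n I (c ;; d) z M Q"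
  unfolding spec_def by (meson hexec.Sq add_le_mono le_trans)

lemma spec_Cond:
  assumes "tval n I A e \<rho> \<noteq> 0 \<Longrightarrow> spec n I c (\<rho>, A) N Q"
    and "tval n I A e \<rho> = 0 \<Longrightarrow> spec n I d (\<rho>, A) N Q" and "1 + N \<le> M"
  shows "spec n I (Cond e c d) (\<rho>, A) M Q"
proof (cases "tval n I A e \<rho> = 0")
  case True
  then obtain t z where t: "hexec n I d (\<rho>, A) t z" "t \<le> N" "Q z" using assms by (auto simp: spec_def)
  from hexec.CondFalse[of n I A e \<rho>, OF True t(1)] have "hexec n I (Cond e c d) (\<rho>, A) (1 + t) z" .
  moreover have "1 + t \<le> M" using t assms by linarith
  ultimately show ?thesis unfolding spec_def using t by blast
next
  case False
  then obtain t z where t: "hexec n I c (\<rho>, A) t z" "t \<le> N" "Q z" using assms by (auto simp: spec_def)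
  from hexec.CondTrue[of n I A e \<rho>, OF False t(1)] have "hexec n I (Cond e c d) (\<rho>, A) (1 + t) z" .
  moreover have "1 + t \<le> M" using t assms by linarith
  ultimately show ?thesis unfolding spec_def using t by blast
qed

lemma spec_Loop_stop:
  "tval n I A e \<rho> = 0 \<Longrightarrow> Q (\<rho>, A) \<Longrightarrow> 1 \<le> N \<Longrightarrow> spec n I (Loop e c) (\<rho>, A) N Q"
  unfolding spec_def using hexec.LoopFalse by blast

text \<open>Unfolds one iteration against an arbitrary claim about the rest of the loop. The search
  loop, whose number of iterations is not known beforehand, is treated this way.\<close>

lemma spec_Loop_step:
  assumes "tval n I A e \<rho> \<noteq> 0" "spec n I c (\<rho>, A) N (\<lambda>z. spec n I (Loop e c) z N' Q)" "1 + N + N' \<le> M"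
  shows "spec n I (Loop e c) (\<rho>, A) M Q"
proof -
  obtain t z where t: "hexec n I c (\<rho>, A) t z" "t \<le> N" and "spec n I (Loop e c) z N' Q"
    using assms(2) unfolding spec_def[of n I c] by blast
  then obtain t' z' where t': "hexec n I (Loop e c) z t' z'" "t' \<le> N'" "Q z'"
    by (auto simp: spec_def)
  have "hexec n I (Loop e c) (\<rho>, A) (1 + t + t') z'"
    using assms(1) t(1) t'(1) by (rule hexec.LoopTrue)
  moreover have "1 + t + t' \<le> M" using t t' assms(3) by linarith
  ultimately show ?thesis unfolding spec_def using t' by blast
qed

lemma spec_Loop_for:
  assumes body: "\<And>j \<rho> A. j < m \<Longrightarrow> P j (\<rho>, A) \<Longrightarrow> tval n I A e \<rho> \<noteq> 0 \<and> spec n I c (\<rho>, A) N (P (Suc j))"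
    and stop: "\<And>\<rho> A. P m (\<rho>, A) \<Longrightarrow> tval n I A e \<rho> = 0"
    and init: "P 0 z" and time: "m * (N + 1) + 1 \<le> M"
  shows "spec n I (Loop e c) z M (P m)"
proof -
  have "j \<le> m \<Longrightarrow> P j z \<Longrightarrow> spec n I (Loop e c) z ((m - j) * (N + 1) + 1) (P m)" for j z
  proof (induction "m - j" arbitrary: j z)
    case 0
    then have "P m z" by simp
    moreover obtain \<rho> A where "z = (\<rho>, A)" by (cases z)
    ultimately show ?case using stop by (auto intro: spec_Loop_stop)
  next
    case (Suc k)
    then have j: "j < m" by simp
    obtain \<rho> A where z: "z = (\<rho>, A)" by (cases z)
    have eq: "m - j = Suc (m - Suc j)" using j by simp
    show ?case unfolding z
    proof (rule spec_Loop_step)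
      show "tval n I A e \<rho> \<noteq> 0" using body j Suc.prems z by blast
      show "spec n I c (\<rho>, A) N (\<lambda>z. spec n I (Loop e c) z ((m - Suc j) * (N + 1) + 1) (P m))"
      proof (rule spec_mono)
        show "spec n I c (\<rho>, A) N (P (Suc j))" using body[OF j] Suc.prems z by blast
        show "spec n I (Loop e c) z' ((m - Suc j) * (N + 1) + 1) (P m)" if "P (Suc j) z'" for z'
          using Suc.hyps that j by auto
      qed simp
      show "1 + N + ((m - Suc j) * (N + 1) + 1) \<le> (m - j) * (N + 1) + 1" unfolding eq by simp
    qed
  qed
  from this[of 0 z] init time show ?thesis by (auto elim: spec_mono)
qed

section \<open>Derived connectives, quantifiers and bounded search\<close>

definition Disj :: "tm \<Rightarrow> tm \<Rightarrow> tm" where "Disj t u = Neg (Conj (Neg t) (Neg u))"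
definition Imp :: "tm \<Rightarrow> tm \<Rightarrow> tm" where "Imp t u = Neg (Conj t (Neg u))"
definition Iff :: "tm \<Rightarrow> tm \<Rightarrow> tm" where "Iff t u = Equ (Neg t) (Neg u)"
definition Le :: "tm \<Rightarrow> tm \<Rightarrow> tm" where "Le t u = Neg (Lt u t)"
definition Forall :: "nat \<Rightarrow> tm \<Rightarrow> tm" where "Forall x t = Neg (Count x (Neg t))"
definition Exists :: "nat \<Rightarrow> tm \<Rightarrow> tm" where "Exists x t = Neg (Forall x (Neg t))"

text \<open>The least \<open>x < n\<close> satisfying \<open>t\<close>, or \<open>n\<close> if there is none; \<open>y\<close> must be fresh.\<close>

definition First :: "nat \<Rightarrow> nat \<Rightarrow> tm \<Rightarrow> tm" where
  "First x y t = Count y (Forall x (Imp (Le (V x) (V y)) (Neg t)))"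

lemmas tm_abbrevs = Disj_def Imp_def Iff_def Le_def Forall_def Exists_def First_def

lemma tval_Disj [simp]:
  "tval n I A (Disj t u) \<rho> = of_bool (tval n I A t \<rho> \<noteq> 0 \<or> tval n I A u \<rho> \<noteq> 0)"
  by (simp add: Disj_def)

lemma tval_Imp [simp]:
  "tval n I A (Imp t u) \<rho> = of_bool (tval n I A t \<rho> \<noteq> 0 \<longrightarrow> tval n I A u \<rho> \<noteq> 0)"
  by (simp add: Imp_def)

lemma tval_Iff [simp]:
  "tval n I A (Iff t u) \<rho> = of_bool (tval n I A t \<rho> \<noteq> 0 \<longleftrightarrow> tval n I A u \<rho> \<noteq> 0)"
  by (simp add: Iff_def)

lemma tval_Le [simp]:
  "tval n I A (Le t u) \<rho> = of_bool (tval n I A t \<rho> \<le> tval n I A u \<rho>)"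
  by (simp add: Le_def not_less)

lemma tval_Forall [simp]:
  "tval n I A (Forall x t) \<rho> = of_bool (\<forall>i<n. tval n I A t (\<rho>(x := i)) \<noteq> 0)"
  by (auto simp: Forall_def)

lemma tval_Exists [simp]:
  "tval n I A (Exists x t) \<rho> = of_bool (\<exists>i<n. tval n I A t (\<rho>(x := i)) \<noteq> 0)"
  by (auto simp: Exists_def)

text \<open>The counted values of \<open>y\<close> form the initial segment below the least
  solution, so their number is that solution. Quantifying the assumption over \<open>j\<close>
  expresses that \<open>y\<close> has no influence on \<open>t\<close>.\<close>

lemma tval_First:
  assumes t: "\<And>i j. i < n \<Longrightarrow> tval n I A t (\<rho>(y := j, x := i)) \<noteq> 0 \<longleftrightarrow> P i" and "x \<noteq> y"
  shows "tval n I A (First x y t) \<rho> < n \<Longrightarrow> P (tval n I A (First x y t) \<rho>)"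
    and "\<not> tval n I A (First x y t) \<rho> < n \<Longrightarrow> i < n \<Longrightarrow> \<not> P i"
proof -
  let ?v = "tval n I A (First x y t) \<rho>"
  have v: "?v = card {j. j < n \<and> (\<forall>i<n. i \<le> j \<longrightarrow> \<not> P i)}"
    using assms by (auto simp: First_def intro!: arg_cong[where f = card])
  have none: "?v = n" if "\<forall>i<n. \<not> P i"
  proof -
    have "{j. j < n \<and> (\<forall>i<n. i \<le> j \<longrightarrow> \<not> P i)} = {..<n}" using that by auto
    then show ?thesis unfolding v by simp
  qed
  have least: "P ?v \<and> ?v < n" if i: "P i" "i < n" for i
  proof -
    obtain l where l: "P l" "l \<le> i" "\<And>i. i < l \<Longrightarrow> \<not> P i"
      using LeastI[of P, OF i(1)] Least_le[of P, OF i(1)] not_less_Least[of _ P] by blast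
    have "j < n \<and> (\<forall>i<n. i \<le> j \<longrightarrow> \<not> P i) \<longleftrightarrow> j < l" for j
    proof
      assume "j < n \<and> (\<forall>i<n. i \<le> j \<longrightarrow> \<not> P i)"
      then have "\<not> l \<le> j" using l(1,2) i(2) by (meson le_less_trans)
      then show "j < l" by simp
    next
      assume j: "j < l"
      have "\<not> P i'" if "i' \<le> j" for i' by (rule l(3)) (use j that in simp)
      moreover have "j < n" using j l(2) i(2) by simp
      ultimately show "j < n \<and> (\<forall>i<n. i \<le> j \<longrightarrow> \<not> P i)" by blast
    qed
    then have "?v = l" unfolding v by simp
    then show ?thesis using l i(2) by simp
  qed
  show "?v < n \<Longrightarrow> P ?v" using none least by (metis less_irrefl)
  show "\<not> ?v < n \<Longrightarrow> i < n \<Longrightarrow> \<not> P i" using least by blast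
qed


section \<open>Inserting a clique module into an ordered vertex sequence\<close>

text \<open>Both translations between paths and gap assignments obtain their list in this way: from
  positions in a given path, or from a numeric key.\<close>

lemma sorted_by_key_exists:
  fixes f :: "'b \<Rightarrow> nat"
  assumes "finite S" "inj_on f S"
  obtains q where "distinct q" "set q = S" "\<And>i j. i < j \<Longrightarrow> j < length q \<Longrightarrow> f (q ! i) < f (q ! j)"
proof
  let ?l = "sorted_list_of_set (f ` S)"
  let ?q = "map (inv_into S f) ?l"
  have set: "set ?l = f ` S" using assms by simp
  have inv: "f (inv_into S f x) = x" if "x \<in> f ` S" for x using that by (rule f_inv_into_f)
  show "distinct ?q"
    using assms set by (simp add: distinct_map inj_on_inv_into)
  show "set ?q = S" using assms set by simp
  have "sorted_wrt (<) ?l" by simp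
  then show "f (?q ! i) < f (?q ! j)" if "i < j" "j < length ?q" for i j
    using that inv set by (simp add: sorted_wrt_iff_nth_less nth_mem[of _ ?l, unfolded set] del: set_sorted_list_of_set)
qed

locale ordered_graph =
  fixes V :: "nat set" and E R :: "nat \<Rightarrow> nat \<Rightarrow> bool"
  assumes finite_V: "finite V"
    and E_sym: "E x y \<Longrightarrow> E y x"
    and R_antisym: "R x y \<Longrightarrow> R y x \<Longrightarrow> x = y"
    and R_trans: "R x y \<Longrightarrow> R y z \<Longrightarrow> R x z"
    and R_refl: "x \<in> V \<Longrightarrow> R x x"
begin

definition ham :: "nat list \<Rightarrow> bool" where
  "ham q \<longleftrightarrow> distinct q \<and> set q = V \<and>
     (\<forall>i. Suc i < length q \<longrightarrow> E (q ! i) (q ! Suc i)) \<and>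
     (\<forall>i j. i < length q \<longrightarrow> j < length q \<longrightarrow> R (q ! i) (q ! j) \<longrightarrow> i \<le> j)"

text \<open>Gap \<open>i\<close> of a list \<open>p\<close> lies between \<open>p ! (i - 1)\<close> and \<open>p ! i\<close>.\<close>

definition fits :: "nat list \<Rightarrow> nat \<Rightarrow> nat \<Rightarrow> bool" where
  "fits p c i \<longleftrightarrow> 0 < i \<and> i < length p \<and> E (p ! (i - 1)) c \<and> E c (p ! i) \<and>
     (\<forall>j < length p. (i \<le> j \<longrightarrow> \<not> R (p ! j) c) \<and> (j < i \<longrightarrow> \<not> R c (p ! j)))"

definition gap :: "nat list \<Rightarrow> nat \<Rightarrow> bool" where
  "gap p i \<longleftrightarrow> 0 < i \<and> i < length p \<and> \<not> E (p ! (i - 1)) (p ! i)"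

definition obeys :: "nat list \<Rightarrow> bool" where
  "obeys p \<longleftrightarrow> (\<forall>i j. i < j \<longrightarrow> j < length p \<longrightarrow> \<not> R (p ! j) (p ! i))"

text \<open>Any number of vertices may share a position, as they will form a clique with common
  outside neighbors. Only positions between non-adjacent elements have to be hit.\<close>

definition fills :: "nat list \<Rightarrow> nat set \<Rightarrow> (nat \<Rightarrow> nat) \<Rightarrow> bool" where
  "fills p C g \<longleftrightarrow> (\<forall>c\<in>C. fits p c (g c)) \<and> (\<forall>i. gap p i \<longrightarrow> (\<exists>c\<in>C. g c = i))"

text \<open>The number of predecessors grows strictly along \<open>R\<close>. Scaling it by
  \<open>M\<close>, which exceeds every vertex, leaves room to add the vertex itself and so to make
  the key injective.\<close>

lemma linear_extension:
  obtains r :: "nat \<Rightarrow> nat" where "inj_on r V"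
    "\<And>x y. x \<in> V \<Longrightarrow> y \<in> V \<Longrightarrow> R x y \<Longrightarrow> x \<noteq> y \<Longrightarrow> r x < r y"
proof -
  define M where "M = Suc (Max (insert 0 V))"
  have M: "x < M" if "x \<in> V" for x using that finite_V by (simp add: M_def le_imp_less_Suc)
  let ?d = "\<lambda>x. card {y \<in> V. R y x}"
  let ?r = "\<lambda>x. ?d x * M + x"
  show thesis
  proof
    show "inj_on ?r V"
    proof (rule inj_onI)
      fix x y assume "x \<in> V" "y \<in> V" "?r x = ?r y"
      then show "x = y" using M by (metis mod_less mod_mult_self3)
    qed
    fix x y assume xy: "x \<in> V" "y \<in> V" "R x y" "x \<noteq> y"
    have "{z \<in> V. R z x} \<subset> {z \<in> V. R z y}"
    proof
      show "{z \<in> V. R z x} \<subseteq> {z \<in> V. R z y}" using xy R_trans by blast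
      have "y \<in> {z \<in> V. R z y}" "y \<notin> {z \<in> V. R z x}" using xy R_refl R_antisym by blast+
      then show "{z \<in> V. R z x} \<noteq> {z \<in> V. R z y}" by blast
    qed
    then have "?d x < ?d y" using finite_V by (intro psubset_card_mono) auto
    then have "Suc (?d x) * M \<le> ?d y * M" by (intro mult_le_mono1) simp
    then show "?r x < ?r y" using M[OF xy(1)] by simp
  qed
qed

end

section \<open>Hamiltonian paths versus assignments of a clique module to gaps\<close>

locale clique_module = ordered_graph +
  fixes C :: "nat set"
  assumes C_sub: "C \<subseteq> V"
    and C_clique: "x \<in> C \<Longrightarrow> y \<in> C \<Longrightarrow> x \<noteq> y \<Longrightarrow> E x y"
    and C_module: "x \<in> C \<Longrightarrow> y \<in> C \<Longrightarrow> z \<in> V - C \<Longrightarrow> E x z \<Longrightarrow> E y z"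
begin

lemma C_module': "x \<in> C \<Longrightarrow> y \<in> C \<Longrightarrow> z \<in> V - C \<Longrightarrow> E z x \<Longrightarrow> E z y"
  using C_module E_sym by blast

text \<open>Deleting the module vertices from \<open>q\<close> gives \<open>p\<close>, and
  \<open>g c\<close> is the index of the first outside vertex after \<open>c\<close>. It exists and
  is not 0 because the path starts and ends outside the module.\<close>

lemma ham_fills:
  assumes q: "ham q" and ends: "hd q \<in> V - C" "last q \<in> V - C"
  obtains p g where "distinct p" "set p = V - C" "hd p = hd q" "last p = last q"
    "obeys p" "fills p C g"
proof -
  let ?l = "length q"
  have d: "distinct q" and setq: "set q = V"
    and adj: "\<And>i. Suc i < ?l \<Longrightarrow> E (q ! i) (q ! Suc i)"
    and ord: "\<And>i j. i < ?l \<Longrightarrow> j < ?l \<Longrightarrow> R (q ! i) (q ! j) \<Longrightarrow> i \<le> j"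
    using q by (auto simp: ham_def)
  have ne: "q \<noteq> []" using ends setq by auto
  define pos where "pos = inv_into {..<?l} ((!) q)"
  have bij: "bij_betw ((!) q) {..<?l} V" using d setq by (simp add: bij_betw_nth)
  have pos: "pos x < ?l" "q ! pos x = x" if "x \<in> V" for x
    using that bij_betw_inv_into[OF bij] bij_betw_inv_into_right[OF bij]
    by (auto simp: pos_def bij_betw_def)
  have posq: "pos (q ! i) = i" if "i < ?l" for i
    using that bij_betw_inv_into_left[OF bij] by (simp add: pos_def)
  have pos_eq: "x = y" if "x \<in> V" "y \<in> V" "pos x = pos y" for x y
    using that pos by metis
  have Rpos: "pos x \<le> pos y" if "x \<in> V" "y \<in> V" "R x y" for x y
    using ord[of "pos x" "pos y"] pos that by simp
  have "inj_on pos (V - C)" using pos_eq by (auto intro: inj_onI)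
  then obtain p where p: "distinct p" "set p = V - C"
    and psort: "\<And>i j. i < j \<Longrightarrow> j < length p \<Longrightarrow> pos (p ! i) < pos (p ! j)"
    using sorted_by_key_exists[of "V - C" pos] finite_V by auto
  let ?m = "length p"
  have psort': "pos (p ! i) \<le> pos (p ! j)" if "i \<le> j" "j < ?m" for i j
    using psort[of i j] that by (cases "i = j") auto
  have pV: "p ! i \<in> V - C" if "i < ?m" for i using that p nth_mem by blast
  have pne: "p \<noteq> []" using ends p by auto
  have hd0: "pos (hd q) = 0" using posq[of 0] ne by (simp add: hd_conv_nth)
  have lastl: "pos (last q) = ?l - 1" using posq[of "?l - 1"] ne by (simp add: last_conv_nth)
  obtain i0 where i0: "i0 < ?m" "p ! i0 = hd q" using ends p by (metis in_set_conv_nth)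
  have "i0 = 0" using psort[of 0 i0] i0 hd0 by (cases i0) auto
  then have hdp: "hd p = hd q" using i0 pne by (simp add: hd_conv_nth)
  obtain i1 where i1: "i1 < ?m" "p ! i1 = last q" using ends p by (metis in_set_conv_nth)
  have "i1 = ?m - 1"
  proof (rule ccontr)
    assume "i1 \<noteq> ?m - 1"
    then have "pos (p ! i1) < pos (p ! (?m - 1))" using i1 by (intro psort) auto
    moreover have "pos (p ! (?m - 1)) < ?l" using pV[of "?m - 1"] pos i1 by auto
    ultimately show False using i1 lastl by simp
  qed
  then have lastp: "last p = last q" using i1 pne by (simp add: last_conv_nth)
  define g where "g c = (LEAST i. i < ?m \<and> pos c < pos (p ! i))" for c
  have g: "g c < ?m \<and> pos c < pos (p ! g c)" "\<And>i. i < g c \<Longrightarrow> pos (p ! i) < pos c" "0 < g c"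
    if c: "c \<in> C" for c
  proof -
    have cV: "c \<in> V" using c C_sub by blast
    have "pos c \<noteq> ?l - 1" using c ends pos_eq[OF cV] lastl by auto
    then have "?m - 1 < ?m \<and> pos c < pos (p ! (?m - 1))"
      using pos(1)[OF cV] lastl lastp pne by (simp add: last_conv_nth)
    then show 1: "g c < ?m \<and> pos c < pos (p ! g c)" unfolding g_def by (rule LeastI)
    show lt: "pos (p ! i) < pos c" if "i < g c" for i
    proof -
      have "\<not> (i < ?m \<and> pos c < pos (p ! i))" using that unfolding g_def by (rule not_less_Least)
      moreover have "i < ?m" using that 1 by simp
      moreover have "pos (p ! i) \<noteq> pos c" using pV[OF \<open>i < ?m\<close>] pos_eq[of "p ! i" c] cV c by auto
      ultimately show ?thesis by simp
    qed
    show "0 < g c"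
    proof (rule ccontr)
      assume "\<not> 0 < g c"
      then have "pos c < pos (hd p)" using 1 pne by (simp add: hd_conv_nth)
      then show False using hdp hd0 by simp
    qed
  qed
  have between: "q ! k \<in> C" if k: "pos (p ! i) < k" "k < pos (p ! Suc i)" "Suc i < ?m" for i k
  proof (rule ccontr)
    assume nC: "q ! k \<notin> C"
    have kl: "k < ?l" using k(2) pos(1)[of "p ! Suc i"] pV[OF k(3)] by simp
    then have "q ! k \<in> V" using setq nth_mem by blast
    then have "q ! k \<in> set p" using nC p(2) by blast
    then obtain j where j: "j < ?m" "p ! j = q ! k" by (metis in_set_conv_nth)
    then have "pos (p ! j) = k" using posq kl by simp
    then show False using k j psort'[of j i] psort'[of "Suc i" j] by (cases "j \<le> i") auto
  qed
  have "obeys p"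
    unfolding obeys_def
  proof (intro allI impI notI)
    fix i j assume "i < j" "j < ?m" "R (p ! j) (p ! i)"
    then show False using psort[of i j] Rpos[of "p ! j" "p ! i"] pV[of i] pV[of j] by simp
  qed
  moreover have "fills p C g"
    unfolding fills_def
  proof (intro conjI ballI allI impI)
    fix c assume c: "c \<in> C"
    then have cV: "c \<in> V" using C_sub by blast
    obtain i where i: "g c = Suc i" using g(3)[OF c] by (cases "g c") auto
    have im: "Suc i < ?m" and ci: "pos c < pos (p ! Suc i)" and ic: "pos (p ! i) < pos c"
      using g(1,2)[OF c] i by auto
    have V1: "p ! i \<in> V - C" "p ! Suc i \<in> V - C" using pV im by simp_all
    \<comment> \<open>The successor of \<open>p ! i\<close> in \<open>q\<close> need not be
      \<open>c\<close>, but it is a module vertex, and the module property carries its edge over to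
      \<open>c\<close>. The same works for the predecessor of \<open>p ! Suc i\<close>.\<close>
    have "Suc (pos (p ! i)) < ?l" using ic pos(1)[OF cV] by simp
    from adj[OF this] have "E (p ! i) (q ! Suc (pos (p ! i)))" using pos(2)[of "p ! i"] V1 by simp
    moreover have "q ! Suc (pos (p ! i)) \<in> C" using ic ci im by (intro between) auto
    ultimately have E1: "E (p ! i) c" using C_module' c V1 by blast
    have "Suc (pos (p ! Suc i) - 1) < ?l" using ci pos(1)[of "p ! Suc i"] V1 by simp
    from adj[OF this] have "E (q ! (pos (p ! Suc i) - 1)) (p ! Suc i)"
      using ci pos(2)[of "p ! Suc i"] V1 by simp
    moreover have "q ! (pos (p ! Suc i) - 1) \<in> C" using ic ci im by (intro between) auto
    ultimately have E2: "E c (p ! Suc i)" using C_module c V1 by blast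
    have "\<not> R (p ! j) c" if "Suc i \<le> j" "j < ?m" for j
      using psort'[OF that] Rpos[of "p ! j" c] ci pV[of j] that cV by auto
    moreover have "\<not> R c (p ! j)" if "j < Suc i" for j
      using g(2)[OF c, of j] Rpos[of c "p ! j"] pV[of j] that cV i im by auto
    ultimately show "fits p c (g c)" using E1 E2 i im by (auto simp: fits_def)
  next
    fix i assume "gap p i"
    then obtain k where k: "i = Suc k" and im: "Suc k < ?m" and nE: "\<not> E (p ! k) (p ! Suc k)"
      by (cases i) (auto simp: gap_def)
    have V1: "p ! k \<in> V" "p ! Suc k \<in> V" using pV im by auto
    have lt: "pos (p ! k) < pos (p ! Suc k)" using psort im by simp
    have l1: "Suc (pos (p ! k)) < ?l" using lt pos(1)[OF V1(2)] by simp
    let ?z = "q ! Suc (pos (p ! k))"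
    have "E (p ! k) ?z" using adj[OF l1] pos(2)[OF V1(1)] by simp
    \<comment> \<open>Non-adjacent elements cannot be consecutive in the path, so the path continues
      from \<open>p ! k\<close> with a module vertex, and this vertex is sent to the gap.\<close>
    then have "?z \<noteq> p ! Suc k" using nE by auto
    then have lt2: "Suc (pos (p ! k)) < pos (p ! Suc k)" using lt pos(2)[OF V1(2)] by (metis Suc_lessI)
    then have zC: "?z \<in> C" using im by (intro between) auto
    have "g ?z = Suc k"
      unfolding g_def
    proof (rule Least_equality)
      show "Suc k < ?m \<and> pos ?z < pos (p ! Suc k)" using im lt2 posq[OF l1] by simp
      fix y assume y: "y < ?m \<and> pos ?z < pos (p ! y)"
      show "Suc k \<le> y"
      proof (rule ccontr)
        assume "\<not> Suc k \<le> y"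
        then have "pos (p ! y) \<le> pos (p ! k)" using im by (intro psort') auto
        then show False using y posq[OF l1] by simp
      qed
    qed
    then show "\<exists>c\<in>C. g c = i" using zC k by blast
  qed
  ultimately show thesis using that p hdp lastp by blast
qed

text \<open>
  Two module vertices placed in the wrong order can be swapped; the potential
  \<open>\<Sum>c\<in>C. g c * r c\<close> for a linear extension \<open>r\<close> shows that this sorts all of them.
\<close>

lemma fills_monotone:
  assumes set: "set p = V - C" and "fills p C g0"
    and r: "\<And>x y. x \<in> V \<Longrightarrow> y \<in> V \<Longrightarrow> R x y \<Longrightarrow> x \<noteq> y \<Longrightarrow> r x < (r y :: nat)"
  obtains g where "fills p C g" "\<And>c d. c \<in> C \<Longrightarrow> d \<in> C \<Longrightarrow> R c d \<Longrightarrow> g c \<le> g d"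
proof -
  have finC: "finite C" using C_sub finite_V finite_subset by blast
  let ?P = "\<lambda>g. \<Sum>c\<in>C. g c * r c"
  \<comment> \<open>Positions stay below \<open>length p\<close>, so the potential is bounded and
    some filling attains its maximum.\<close>
  have "\<exists>g. fills p C g \<and> (\<forall>h. fills p C h \<longrightarrow> ?P h \<le> ?P g)"
  proof (rule ex_has_greatest_nat)
    show "fills p C g0" by fact
    show "\<forall>g. fills p C g \<longrightarrow> ?P g < Suc (\<Sum>c\<in>C. length p * r c)"
      unfolding less_Suc_eq_le
      by (intro allI impI sum_mono mult_le_mono1) (simp add: fills_def fits_def less_imp_le)
  qed
  then obtain g where g: "fills p C g" and max: "\<And>h. fills p C h \<Longrightarrow> ?P h \<le> ?P g" by blast
  show thesis
  proof
    show "fills p C g" by fact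
    fix c d assume c: "c \<in> C" and d: "d \<in> C" and Rcd: "R c d"
    show "g c \<le> g d"
    proof (rule ccontr)
      assume "\<not> g c \<le> g d"
      then have lt: "g d < g c" and ne: "c \<noteq> d" by auto
      let ?h = "g(c := g d, d := g c)"
      have fc: "fits p c (g c)" and fd: "fits p d (g d)" using g c d by (auto simp: fills_def)
      have pV: "p ! j \<in> V - C" if "j < length p" for j using that set nth_mem by blast
      \<comment> \<open>An element from \<open>g d\<close> on that had to precede \<open>c\<close>
        would by transitivity have to precede \<open>d\<close>. An element before \<open>g d\<close>
        is also before \<open>g c\<close>, so it cannot have to follow \<open>c\<close>. The
        argument for \<open>d\<close> below mirrors this one.\<close>
      have 1: "fits p c (g d)"
        unfolding fits_def
      proof (intro conjI allI impI)
        show "E (p ! (g d - 1)) c" using fd C_module'[OF d c pV[of "g d - 1"]] by (auto simp: fits_def)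
        show "E c (p ! g d)" using fd C_module[OF d c pV[of "g d"]] by (auto simp: fits_def)
        show "\<not> R (p ! j) c" if "j < length p" "g d \<le> j" for j
          using fd that R_trans[OF _ Rcd] by (auto simp: fits_def)
        show "\<not> R c (p ! j)" if "j < length p" "j < g d" for j
          using fc that lt by (auto simp: fits_def)
      qed (use fd in \<open>auto simp: fits_def\<close>)
      have 2: "fits p d (g c)"
        unfolding fits_def
      proof (intro conjI allI impI)
        show "E (p ! (g c - 1)) d" using fc C_module'[OF c d pV[of "g c - 1"]] by (auto simp: fits_def)
        show "E d (p ! g c)" using fc C_module[OF c d pV[of "g c"]] by (auto simp: fits_def)
        show "\<not> R (p ! j) d" if "j < length p" "g c \<le> j" for j
          using fd that lt by (auto simp: fits_def)
        show "\<not> R d (p ! j)" if "j < length p" "j < g c" for j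
          using fc that R_trans[OF Rcd] unfolding fits_def by blast
      qed (use fc in \<open>auto simp: fits_def\<close>)
      have "fills p C ?h"
        unfolding fills_def
      proof (intro conjI ballI allI impI)
        show "fits p x (?h x)" if "x \<in> C" for x using that 1 2 g by (auto simp: fills_def)
        fix i assume "gap p i"
        then obtain x where x: "x \<in> C" "g x = i" using g by (auto simp: fills_def)
        show "\<exists>x\<in>C. ?h x = i"
        proof (cases "x = c \<or> x = d")
          case True
          then show ?thesis
          proof
            assume "x = c" then show ?thesis using x d by (intro bexI[of _ d]) auto
          next
            assume "x = d" then show ?thesis using x c ne by (intro bexI[of _ c]) auto
          qed
        next
          case False
          then show ?thesis using x by (intro bexI[of _ x]) auto
        qed
      qed
      then have "?P ?h \<le> ?P g" by (rule max)
      moreover have split: "(\<Sum>x\<in>C. f x) = f c + (f d + (\<Sum>x\<in>C - {c} - {d}. f x))" for f :: "nat \<Rightarrow> nat"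
        using sum.remove[OF finC c, of f] sum.remove[of "C - {c}" d f] finC d ne by simp
      have "(\<Sum>x\<in>C - {c} - {d}. ?h x * r x) = (\<Sum>x\<in>C - {c} - {d}. g x * r x)"
        by (rule sum.cong) auto
      ultimately have "g d * r c + g c * r d \<le> g c * r c + g d * r d"
        unfolding split[of "\<lambda>x. ?h x * r x"] split[of "\<lambda>x. g x * r x"] using ne by simp
      \<comment> \<open>The swap raises the potential by \<open>(g c - g d) * (r d - r c)\<close>,
        which is positive and contradicts maximality.\<close>
      moreover have "r c < r d" using c d C_sub Rcd ne by (intro r) auto
      moreover obtain x where "g c = g d + Suc x" using lt less_iff_Suc_add by auto
      moreover obtain y where "r d = r c + Suc y" using \<open>r c < r d\<close> less_iff_Suc_add by auto
      ultimately show False by (simp add: algebra_simps)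
    qed
  qed
qed

text \<open>
  Sort all vertices by level, \<open>2 * j + 1\<close> for the \<open>j\<close>-th element of \<open>p\<close> and \<open>2 * i\<close> for a module
  vertex in gap \<open>i\<close>, breaking ties by a linear extension.
\<close>

lemma fills_ham:
  assumes p: "distinct p" "set p = V - C" "p \<noteq> []" and resp: "obeys p" and "fills p C g0"
  obtains q where "ham q" "hd q = hd p" "last q = last p"
proof -
  obtain r :: "nat \<Rightarrow> nat" where rinj: "inj_on r V"
    and r: "\<And>x y. x \<in> V \<Longrightarrow> y \<in> V \<Longrightarrow> R x y \<Longrightarrow> x \<noteq> y \<Longrightarrow> r x < r y"
    by (rule linear_extension) blast
  obtain g where g: "fills p C g" and gmono: "\<And>c d. c \<in> C \<Longrightarrow> d \<in> C \<Longrightarrow> R c d \<Longrightarrow> g c \<le> g d"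
    by (rule fills_monotone[OF p(2) \<open>fills p C g0\<close> r]) blast+
  have fits: "fits p c (g c)" if "c \<in> C" for c using g that by (simp add: fills_def)
  define idx where "idx x = inv_into {..<length p} ((!) p) x" for x
  have bij: "bij_betw ((!) p) {..<length p} (V - C)" using p by (simp add: bij_betw_nth)
  have idx: "idx x < length p" "p ! idx x = x" if "x \<in> V - C" for x
    using that bij_betw_inv_into[OF bij] bij_betw_inv_into_right[OF bij]
    by (auto simp: idx_def bij_betw_def)
  have idxp: "idx (p ! i) = i" if "i < length p" for i
    using that bij_betw_inv_into_left[OF bij] by (simp add: idx_def)
  have pV: "p ! j \<in> V" "p ! j \<notin> C" if "j < length p" for j using that p(2) nth_mem by blast+
  define lev where "lev x = (if x \<in> C then 2 * g x else 2 * idx x + 1)" for x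
  \<comment> \<open>Outside vertices have distinct odd levels, so ties occur only between module
    vertices in one gap. As \<open>K\<close> exceeds every tie value, \<open>key\<close> is the
    lexicographic order on level and tie.\<close>
  define tie where "tie x = (if x \<in> C then r x else 0)" for x
  define K where "K = Suc (Max (insert 0 (r ` V)))"
  define key where "key x = lev x * K + tie x" for x
  have tieK: "tie x < K" if "x \<in> V" for x
    using that finite_V by (auto simp: tie_def K_def le_imp_less_Suc)
  have key_less: "key x < key y \<longleftrightarrow> lev x < lev y \<or> lev x = lev y \<and> tie x < tie y"
    if "x \<in> V" "y \<in> V" for x y
  proof -
    have *: "a * K + s < b * K + t" if "a < b" "s < K" for a b s t
    proof -
      have "Suc a * K \<le> b * K" using that by (intro mult_le_mono1) simp
      then show ?thesis using that by simp
    qed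
    from *[of "lev x" "lev y" "tie x" "tie y"] *[of "lev y" "lev x" "tie y" "tie x"]
      tieK[OF that(1)] tieK[OF that(2)]
    show ?thesis unfolding key_def by (cases "lev x" "lev y" rule: linorder_cases) auto
  qed
  have lev_p: "lev (p ! j) = 2 * j + 1" if "j < length p" for j
    using pV[OF that] idxp[OF that] by (simp add: lev_def)
  have inj: "inj_on key V"
  proof (rule inj_onI)
    fix x y assume xy: "x \<in> V" "y \<in> V" "key x = key y"
    then have le: "lev x = lev y" "tie x = tie y"
      using key_less[of x y] key_less[of y x] by (auto simp: key_def)
    show "x = y"
    proof (cases "x \<in> C")
      case True
      then have "y \<in> C" using le by (auto simp: lev_def split: if_splits) presburger
      then show ?thesis using True le rinj xy by (auto simp: tie_def inj_on_def)
    next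
      case False
      then have yC: "y \<notin> C" using le by (auto simp: lev_def split: if_splits) presburger
      then have "idx x = idx y" using False le by (simp add: lev_def)
      then show ?thesis using idx(2)[of x] idx(2)[of y] xy False yC by (metis DiffI)
    qed
  qed
  obtain q where q: "distinct q" "set q = V"
    and qsort: "\<And>i j. i < j \<Longrightarrow> j < length q \<Longrightarrow> key (q ! i) < key (q ! j)"
    using sorted_by_key_exists[OF finite_V inj] by blast
  have qV: "q ! i \<in> V" if "i < length q" for i using that q nth_mem by blast
  have Rkey: "key x < key y" if xy: "x \<in> V" "y \<in> V" "R x y" "x \<noteq> y" for x y
  proof (cases "x \<in> C"; cases "y \<in> C")
    assume "x \<in> C" "y \<in> C"
    then show ?thesis using gmono[of x y] r[of x y] xy key_less by (auto simp: lev_def tie_def)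
  next
    assume x: "x \<in> C" and y: "y \<notin> C"
    with fits[OF x] idx[of y] xy have "\<not> idx y < g x" unfolding fits_def by auto
    then show ?thesis using x y xy key_less by (auto simp: lev_def)
  next
    assume x: "x \<notin> C" and y: "y \<in> C"
    with fits[OF y] idx[of x] xy have "\<not> g y \<le> idx x" unfolding fits_def by auto
    then show ?thesis using x y xy key_less by (auto simp: lev_def)
  next
    assume x: "x \<notin> C" and y: "y \<notin> C"
    have "\<not> idx y < idx x" using resp idx[of x] idx[of y] x y xy unfolding obeys_def by (metis DiffI)
    moreover have "idx x \<noteq> idx y" using idx(2)[of x] idx(2)[of y] x y xy by auto
    ultimately show ?thesis using x y xy key_less by (auto simp: lev_def)
  qed
  have "ham q"
    unfolding ham_def
  proof (intro conjI allI impI)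
    fix i j assume ij: "i < length q" "j < length q" "R (q ! i) (q ! j)"
    show "i \<le> j"
    proof (rule ccontr)
      assume "\<not> i \<le> j"
      then have ji: "j < i" by simp
      then have "q ! i \<noteq> q ! j" using q ij by (simp add: nth_eq_iff_index_eq)
      then have "key (q ! i) < key (q ! j)" using Rkey qV ij by blast
      then show False using qsort[OF ji ij(1)] by simp
    qed
  next
    fix i assume i: "Suc i < length q"
    let ?x = "q ! i" and ?y = "q ! Suc i"
    have xV: "?x \<in> V" and yV: "?y \<in> V" using qV i by auto
    have xy: "key ?x < key ?y" using qsort i by simp
    have none: "key z \<le> key ?x \<or> key ?y \<le> key z" if z: "z \<in> V" for z
    proof -
      obtain k where k: "k < length q" "q ! k = z" using z q by (metis in_set_conv_nth)
      show ?thesis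
        using qsort[of k i] qsort[of "Suc i" k] k i
        by (cases "k < i"; cases "k = i"; cases "k = Suc i") auto
    qed
    show "E ?x ?y"
    proof (cases "?x \<in> C"; cases "?y \<in> C")
      assume "?x \<in> C" "?y \<in> C"
      moreover have "?x \<noteq> ?y" using xy by auto
      ultimately show ?thesis using C_clique by blast
    next
      assume x: "?x \<in> C" and y: "?y \<notin> C"
      \<comment> \<open>The level of \<open>p ! g ?x\<close> is the one directly above that of
        \<open>?x\<close>. No key lies strictly between \<open>?x\<close> and \<open>?y\<close>, so
        an outside vertex \<open>?y\<close> can only be \<open>p ! g ?x\<close>, to which
        \<open>fits\<close> makes \<open>?x\<close> adjacent.\<close>
      have gx: "g ?x < length p" using fits[OF x] by (simp add: fits_def)
      have iy: "idx ?y < length p" "p ! idx ?y = ?y" using idx[of ?y] y yV by auto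
      have "lev ?x < lev (p ! g ?x)" using lev_p[OF gx] x by (simp add: lev_def)
      then have "key ?x < key (p ! g ?x)" using key_less[OF xV pV(1)[OF gx]] by simp
      then have "key ?y \<le> key (p ! g ?x)" using none[OF pV(1)[OF gx]] by simp
      then have "\<not> lev (p ! g ?x) < lev ?y" using key_less[OF pV(1)[OF gx] yV] by auto
      moreover have "\<not> lev ?y < lev ?x" using xy key_less[OF xV yV] by auto
      ultimately have "idx ?y = g ?x" using lev_p[OF gx] x y by (simp add: lev_def)
      then show ?thesis using fits[OF x] iy by (auto simp: fits_def)
    next
      assume x: "?x \<notin> C" and y: "?y \<in> C"
      have gy: "g ?y - 1 < length p" "0 < g ?y" using fits[OF y] by (auto simp: fits_def)
      have ix: "idx ?x < length p" "p ! idx ?x = ?x" using idx[of ?x] x xV by auto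
      have "lev (p ! (g ?y - 1)) < lev ?y" using lev_p[OF gy(1)] gy(2) y by (simp add: lev_def)
      then have "key (p ! (g ?y - 1)) < key ?y" using key_less[OF pV(1)[OF gy(1)] yV] by simp
      then have "key (p ! (g ?y - 1)) \<le> key ?x" using none[OF pV(1)[OF gy(1)]] by simp
      then have "\<not> lev ?x < lev (p ! (g ?y - 1))" using key_less[OF xV pV(1)[OF gy(1)]] by auto
      moreover have "\<not> lev ?y < lev ?x" using xy key_less[OF xV yV] by auto
      ultimately have "idx ?x = g ?y - 1" using lev_p[OF gy(1)] x y gy by (simp add: lev_def)
      then show ?thesis using fits[OF y] ix by (auto simp: fits_def)
    next
      assume x: "?x \<notin> C" and y: "?y \<notin> C"
      have ix: "idx ?x < length p" "p ! idx ?x = ?x" using idx[of ?x] x xV by auto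
      have iy: "idx ?y < length p" "p ! idx ?y = ?y" using idx[of ?y] y yV by auto
      have lt: "idx ?x < idx ?y"
        using xy key_less[OF xV yV] x y by (auto simp: lev_def tie_def)
      have si: "Suc (idx ?x) < length p" using lt iy by simp
      let ?z = "p ! Suc (idx ?x)"
      have "lev ?x < lev ?z" using lev_p[OF si] x by (simp add: lev_def)
      then have "key ?x < key ?z" using key_less[OF xV pV(1)[OF si]] by simp
      then have "key ?y \<le> key ?z" using none[OF pV(1)[OF si]] by simp
      then have "\<not> lev ?z < lev ?y" using key_less[OF pV(1)[OF si] yV] by auto
      then have eq: "idx ?y = Suc (idx ?x)" using lt lev_p[OF si] y by (simp add: lev_def)
      \<comment> \<open>Otherwise this gap has received a module vertex, whose even level lies
        strictly between the two consecutive odd ones.\<close>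
      show ?thesis
      proof (rule ccontr)
        assume "\<not> E ?x ?y"
        then have "gap p (idx ?y)" using eq ix iy by (simp add: gap_def)
        then obtain c where c: "c \<in> C" "g c = idx ?y" using g by (auto simp: fills_def)
        have cV: "c \<in> V" using c C_sub by blast
        have "lev ?x < lev c" "lev c < lev ?y" using c x y eq by (simp_all add: lev_def)
        then show False using none[OF cV] key_less[OF xV cV] key_less[OF cV yV] by auto
      qed
    qed
  qed (use q in auto)
  \<comment> \<open>By \<open>0 < g c\<close> and \<open>g c < length p\<close>, the level of every
    module vertex is above that of the first element of \<open>p\<close> and below that of the
    last.\<close>
  moreover have "hd q = hd p"
  proof -
    have 0: "0 < length p" using p by simp
    obtain k where k: "k < length q" "q ! k = p ! 0" using pV(1)[OF 0] q by (metis in_set_conv_nth)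
    have q0: "0 < length q" using k by linarith
    have "k = 0"
    proof (rule ccontr)
      assume "k \<noteq> 0"
      then have "key (q ! 0) < key (p ! 0)" using qsort[of 0 k] k by simp
      then have *: "lev (q ! 0) < 1 \<or> lev (q ! 0) = 1 \<and> tie (q ! 0) < tie (p ! 0)"
        using key_less[OF qV[OF q0] pV(1)[OF 0]] lev_p[OF 0] by simp
      show False
      proof (cases "q ! 0 \<in> C")
        case True
        then have "0 < g (q ! 0)" using fits by (simp add: fits_def)
        then show False using * True by (simp add: lev_def)
      next
        case False
        then show False using * pV(2)[OF 0] by (simp add: lev_def tie_def)
      qed
    qed
    then show ?thesis using k q0 p by (metis hd_conv_nth length_0_conv less_numeral_extra(3))
  qed
  moreover have "last q = last p"
  proof -
    let ?l = "length p - 1"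
    have 0: "?l < length p" using p by simp
    obtain k where k: "k < length q" "q ! k = p ! ?l" using pV(1)[OF 0] q by (metis in_set_conv_nth)
    have q0: "length q - 1 < length q" using k by simp
    let ?x = "q ! (length q - 1)"
    have "k = length q - 1"
    proof (rule ccontr)
      assume "k \<noteq> length q - 1"
      then have "key (p ! ?l) < key ?x" using qsort[of k "length q - 1"] k by simp
      then have *: "2 * ?l + 1 < lev ?x \<or> lev ?x = 2 * ?l + 1 \<and> tie (p ! ?l) < tie ?x"
        using key_less[OF pV(1)[OF 0] qV[OF q0]] lev_p[OF 0] by auto
      show False
      proof (cases "?x \<in> C")
        case True
        then have "g ?x < length p" using fits by (simp add: fits_def)
        then show False using * True by (auto simp: lev_def)
      next
        case False
        then show False using * idx(1)[of ?x] qV[OF q0] by (auto simp: lev_def tie_def)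
      qed
    qed
    then show ?thesis using k p by (metis last_conv_nth length_0_conv less_nat_zero_code)
  qed
  ultimately show thesis using that by blast
qed

section \<open>Earliest deadline first\<close>

definition matching :: "nat list \<Rightarrow> (nat \<Rightarrow> nat) \<Rightarrow> bool" where
  "matching p \<mu> \<longleftrightarrow> inj_on \<mu> {i. gap p i} \<and> (\<forall>i. gap p i \<longrightarrow> \<mu> i \<in> C \<and> fits p (\<mu> i) i)"

text \<open>The index of the first element of \<open>p\<close> that has to come after
  \<open>c\<close>, or \<open>length p\<close> if there is none. Written as a cardinality, it
  translates directly into a \<open>Count\<close> term.\<close>

definition deadline :: "nat list \<Rightarrow> nat \<Rightarrow> nat" where
  "deadline p c = card {j. j < length p \<and> (\<forall>i\<le>j. \<not> R c (p ! i))}"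

text \<open>\<open>asg c = 0\<close> means that \<open>c\<close> has not been assigned to a gap.\<close>

definition avail :: "nat list \<Rightarrow> (nat \<Rightarrow> nat) \<Rightarrow> nat \<Rightarrow> nat \<Rightarrow> bool" where
  "avail p asg i c \<longleftrightarrow> c \<in> C \<and> asg c = 0 \<and> fits p c i"

text \<open>The last clause carries the exchange argument: if there is a matching at all, then one
  agrees with every choice made so far. It is conditional, so that the invariant can also be kept on
  unsolvable instances until the greedy choice gets stuck.\<close>

definition greedy_inv :: "nat list \<Rightarrow> (nat \<Rightarrow> nat) \<Rightarrow> nat \<Rightarrow> bool" where
  "greedy_inv p asg i \<longleftrightarrow>
     (\<forall>c\<in>C. asg c \<noteq> 0 \<longrightarrow> gap p (asg c) \<and> asg c < i \<and> fits p c (asg c)) \<and>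
     (\<forall>j<i. gap p j \<longrightarrow> (\<exists>c\<in>C. asg c = j)) \<and>
     ((\<exists>\<mu>. matching p \<mu>) \<longrightarrow> (\<exists>\<mu>. matching p \<mu> \<and> (\<forall>c\<in>C. asg c \<noteq> 0 \<longrightarrow> \<mu> (asg c) = c)))"

lemma gap_pos: "gap p i \<Longrightarrow> i \<noteq> 0"
  by (simp add: gap_def)

lemma fills_matching: "fills p C g \<Longrightarrow> \<exists>\<mu>. matching p \<mu>"
proof -
  assume g: "fills p C g"
  let ?\<mu> = "\<lambda>i. SOME c. c \<in> C \<and> g c = i"
  have \<mu>: "?\<mu> i \<in> C \<and> g (?\<mu> i) = i" if "gap p i" for i
  proof -
    have "\<exists>c. c \<in> C \<and> g c = i" using g that unfolding fills_def by blast
    then show ?thesis by (rule someI_ex)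
  qed
  have "matching p ?\<mu>"
    unfolding matching_def
  proof (intro conjI allI impI inj_onI)
    show "i = j" if "i \<in> {i. gap p i}" "j \<in> {i. gap p i}" "?\<mu> i = ?\<mu> j" for i j
      using \<mu>[of i] \<mu>[of j] that by (metis mem_Collect_eq)
    show "?\<mu> i \<in> C" if "gap p i" for i using \<mu>[OF that] by blast
    show "fits p (?\<mu> i) i" if "gap p i" for i
      using g \<mu>[OF that] unfolding fills_def by metis
  qed
  then show ?thesis by blast
qed

lemma greedy_inv_init: "(\<And>c. c \<in> C \<Longrightarrow> asg c = 0) \<Longrightarrow> greedy_inv p asg (Suc 0)"
  by (auto simp: greedy_inv_def gap_def)

lemma greedy_inv_skip: "greedy_inv p asg i \<Longrightarrow> \<not> gap p i \<Longrightarrow> greedy_inv p asg (Suc i)"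
  by (auto simp: greedy_inv_def less_Suc_eq)

text \<open>A matching that agrees with the earlier choices assigns to gap \<open>i\<close> a vertex
  that, by injectivity, serves no earlier gap and is thus still free.\<close>

lemma greedy_avail:
  assumes inv: "greedy_inv p asg i" and "gap p i" and "matching p \<mu>0"
  shows "\<exists>c. avail p asg i c"
proof -
  obtain \<mu> where \<mu>: "matching p \<mu>" "\<And>c. c \<in> C \<Longrightarrow> asg c \<noteq> 0 \<Longrightarrow> \<mu> (asg c) = c"
    using inv assms(3) unfolding greedy_inv_def by blast
  let ?c = "\<mu> i"
  have c: "?c \<in> C" "fits p ?c i" using \<mu>(1) assms(2) by (auto simp: matching_def)
  have "asg ?c = 0"
  proof (rule ccontr)
    assume nz: "asg ?c \<noteq> 0"
    then have "\<mu> (asg ?c) = \<mu> i" using \<mu>(2) c by blast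
    moreover have "gap p (asg ?c)" "asg ?c < i" using inv c nz by (auto simp: greedy_inv_def)
    ultimately show False using \<mu>(1) assms(2) by (auto simp: matching_def inj_on_def)
  qed
  then show ?thesis using c by (auto simp: avail_def)
qed

text \<open>As \<open>d\<close> already fits the earlier gap \<open>i\<close>, nothing from
  \<open>k\<close> on has to precede it. Were some element before \<open>k\<close> forced to follow
  \<open>d\<close>, its deadline would be below \<open>k\<close>, whereas that of \<open>c\<close>
  is at least \<open>k\<close>. Adjacency is the same for both by the module property.\<close>

lemma fits_deadline:
  assumes C: "c \<in> C" "d \<in> C" and p: "set p = V - C"
    and fits: "fits p d i" "fits p c k" and ik: "i \<le> k" and dl: "deadline p c \<le> deadline p d"
  shows "fits p d k"
  unfolding fits_def
proof (intro conjI allI impI)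
  have pV: "p ! j \<in> V - C" if "j < length p" for j using that p nth_mem by blast
  have k: "0 < k" "k < length p" using fits by (auto simp: fits_def)
  show "E (p ! (k - 1)) d" using C_module'[OF C pV[of "k - 1"]] fits(2) by (auto simp: fits_def)
  show "E d (p ! k)" using C_module[OF C pV[of k]] fits(2) by (auto simp: fits_def)
  show "\<not> R (p ! j) d" if "j < length p" "k \<le> j" for j using that ik fits(1) by (auto simp: fits_def)
  fix j assume j: "j < length p" "j < k"
  let ?D = "\<lambda>c. {j. j < length p \<and> (\<forall>i\<le>j. \<not> R c (p ! i))}"
  show "\<not> R d (p ! j)"
  proof
    assume "R d (p ! j)"
    then have "?D d \<subseteq> {..<j}" by (auto simp flip: not_le)
    then have "card (?D d) \<le> j" using card_mono[of "{..<j}" "?D d"] by simp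
    moreover have "{..<k} \<subseteq> ?D c" using fits(2) by (auto simp: fits_def)
    then have "k \<le> card (?D c)" using card_mono[of "?D c" "{..<k}"] by simp
    ultimately show False using dl j by (simp add: deadline_def)
  qed
qed (use fits in \<open>auto simp: fits_def\<close>)

text \<open>Let \<open>\<mu>\<close> be a matching that agrees with the earlier choices. If it uses
  \<open>c\<close> for a later gap \<open>k\<close>, then \<open>c\<close> and
  \<open>\<mu> i\<close> trade places, which \<open>fits_deadline\<close> permits since
  \<open>c\<close> has the earliest deadline. If it does not use \<open>c\<close>, then
  \<open>c\<close> simply replaces \<open>\<mu> i\<close>.\<close>

lemma greedy_inv_step:
  assumes inv: "greedy_inv p asg i" and gap: "gap p i" and p: "set p = V - C"
    and c: "avail p asg i c" and best: "\<And>d. avail p asg i d \<Longrightarrow> deadline p c \<le> deadline p d"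
  shows "greedy_inv p (asg(c := i)) (Suc i)"
  unfolding greedy_inv_def
proof (intro conjI ballI impI allI)
  let ?a = "asg(c := i)"
  have cC: "c \<in> C" and c0: "asg c = 0" and cfit: "fits p c i" using c by (auto simp: avail_def)
  show "gap p (?a d)" "?a d < Suc i" "fits p d (?a d)" if "d \<in> C" "?a d \<noteq> 0" for d
    using that inv gap cfit by (auto simp: greedy_inv_def less_Suc_eq)
  show "\<exists>d\<in>C. ?a d = j" if j: "j < Suc i" "gap p j" for j
  proof (cases "j = i")
    case True
    then show ?thesis using cC by auto
  next
    case False
    then have "j < i" using j by simp
    then obtain d where "d \<in> C" "asg d = j" using inv j unfolding greedy_inv_def by blast
    moreover have "d \<noteq> c" using calculation c0 gap_pos[OF j(2)] by auto
    ultimately show ?thesis by auto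
  qed
  assume "\<exists>\<mu>. matching p \<mu>"
  then obtain \<mu> where m: "matching p \<mu>" and agree: "\<And>c. c \<in> C \<Longrightarrow> asg c \<noteq> 0 \<Longrightarrow> \<mu> (asg c) = c"
    using inv unfolding greedy_inv_def by blast
  have inj: "\<And>j k. gap p j \<Longrightarrow> gap p k \<Longrightarrow> \<mu> j = \<mu> k \<Longrightarrow> j = k"
    using m by (auto simp: matching_def inj_on_def)
  have mfit: "\<mu> j \<in> C" "fits p (\<mu> j) j" if "gap p j" for j using m that by (auto simp: matching_def)
  \<comment> \<open>Gaps before \<open>i\<close> are served by vertices already marked as assigned,
    and \<open>\<mu>\<close> agrees with them. As \<open>c\<close> is unmarked, \<open>\<mu>\<close>
    can use it only from gap \<open>i\<close> on.\<close>
  have early: "\<mu> j \<noteq> c" "asg (\<mu> j) = j" if j: "j < i" "gap p j" for j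
  proof -
    obtain d where d: "d \<in> C" "asg d = j" using inv j unfolding greedy_inv_def by blast
    then have "\<mu> j = d" using agree gap_pos[OF j(2)] by auto
    then show "asg (\<mu> j) = j" "\<mu> j \<noteq> c" using d c0 gap_pos[OF j(2)] by auto
  qed
  have asg_lt: "asg d < i" "gap p (asg d)" if "d \<in> C" "asg d \<noteq> 0" for d
    using inv that by (auto simp: greedy_inv_def)
  show "\<exists>\<mu>. matching p \<mu> \<and> (\<forall>d\<in>C. ?a d \<noteq> 0 \<longrightarrow> \<mu> (?a d) = d)"
  proof (cases "\<exists>k. gap p k \<and> \<mu> k = c")
    case True
    then obtain k where k: "gap p k" "\<mu> k = c" by blast
    have ik: "i \<le> k" using early(1)[of k] k by (meson not_le)
    have "asg (\<mu> i) = 0"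
    proof (rule ccontr)
      assume nz: "asg (\<mu> i) \<noteq> 0"
      then show False
        using agree[of "\<mu> i"] asg_lt[of "\<mu> i"] mfit(1)[OF gap] inj[of "asg (\<mu> i)" i] gap by auto
    qed
    then have "avail p asg i (\<mu> i)" using mfit[OF gap] by (simp add: avail_def)
    then have dfit: "fits p (\<mu> i) k"
      using fits_deadline[OF cC mfit(1)[OF gap] p mfit(2)[OF gap] _ ik best] mfit(2)[OF k(1)] k(2) by simp
    let ?\<mu> = "\<mu>(k := \<mu> i, i := c)"
    have "matching p ?\<mu>"
      unfolding matching_def
    proof (intro conjI allI impI)
      show "inj_on ?\<mu> {i. gap p i}"
        using inj k gap by (auto simp: inj_on_def)
      show "?\<mu> j \<in> C" "fits p (?\<mu> j) j" if "gap p j" for j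
        using that mfit cC cfit dfit gap by auto
    qed
    moreover have "?\<mu> (?a d) = d" if d: "d \<in> C" "?a d \<noteq> 0" for d
    proof (cases "d = c")
      case False
      then have "asg d < i" "\<mu> (asg d) = d" using d agree asg_lt by auto
      then show ?thesis using False ik by auto
    qed simp
    ultimately show ?thesis by blast
  next
    case False
    let ?\<mu> = "\<mu>(i := c)"
    have "matching p ?\<mu>"
      unfolding matching_def
    proof (intro conjI allI impI)
      show "inj_on ?\<mu> {i. gap p i}"
        using inj False gap by (auto simp: inj_on_def)
      show "?\<mu> j \<in> C" "fits p (?\<mu> j) j" if "gap p j" for j
        using that mfit cC cfit by auto
    qed
    moreover have "?\<mu> (?a d) = d" if d: "d \<in> C" "?a d \<noteq> 0" for d
    proof (cases "d = c")
      case False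
      then have "asg d < i" "\<mu> (asg d) = d" using d agree asg_lt by auto
      then show ?thesis using False by auto
    qed simp
    ultimately show ?thesis by blast
  qed
qed

text \<open>Positions have no capacity, so the vertices left over by the greedy pass may go to any
  position they fit.\<close>

lemma greedy_fills:
  assumes inv: "greedy_inv p asg (length p)" and all: "\<And>c. c \<in> C \<Longrightarrow> \<exists>i. fits p c i"
  shows "\<exists>g. fills p C g"
proof -
  let ?g = "\<lambda>c. if asg c \<noteq> 0 then asg c else (SOME i. fits p c i)"
  have "fills p C ?g"
    unfolding fills_def
  proof (intro conjI ballI allI impI)
    show "fits p c (?g c)" if "c \<in> C" for c
      using inv that someI_ex[OF all[OF that]] by (auto simp: greedy_inv_def)
    fix i assume i: "gap p i"
    then obtain c where "c \<in> C" "asg c = i" using inv by (auto simp: greedy_inv_def gap_def)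
    then show "\<exists>c\<in>C. ?g c = i" using gap_pos[OF i] by (intro bexI[of _ c]) auto
  qed
  then show ?thesis by blast
qed

end

section \<open>Twin classes\<close>

context ordered_graph
begin

text \<open>Equality of closed neighborhoods; for distinct vertices of \<open>V\<close> it includes
  adjacency. This is why a twin class is a clique as well as a module.\<close>

definition twin :: "nat \<Rightarrow> nat \<Rightarrow> bool" where
  "twin x y \<longleftrightarrow> (\<forall>z\<in>V. (z = x \<or> E x z) \<longleftrightarrow> (z = y \<or> E y z))"

definition twins :: "nat \<Rightarrow> nat set" where
  "twins v = {u \<in> V. twin v u}"

lemma clique_module_twins:
  "clique_module V E R (twins v - {a, b})"
proof unfold_locales
  have t: "twin x y" if "x \<in> twins v" "y \<in> twins v" for x y using that by (auto simp: twins_def twin_def)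
  show "twins v - {a, b} \<subseteq> V" by (auto simp: twins_def)
  show "E x y" if "x \<in> twins v - {a, b}" "y \<in> twins v - {a, b}" "x \<noteq> y" for x y
    using t[of x y] that by (auto simp: twin_def twins_def)
  show "E y z" if "x \<in> twins v - {a, b}" "y \<in> twins v - {a, b}" "z \<in> V - (twins v - {a, b})" "E x z" for x y z
    using t[of x y] that by (auto simp: twin_def)
qed

text \<open>From left to right, \<open>a\<close> and \<open>b\<close> are the ends of the path. From
  right to left they need not be: the ends are those of \<open>p\<close>, and \<open>a\<close> only
  guarantees that \<open>p\<close> is non-empty. The predicate \<open>ends\<close> is kept abstract
  to cover the closing edge of a cycle.\<close>

lemma ham_iff_fills:
  assumes "V \<noteq> {}"
  shows "(\<exists>q. ham q \<and> ends (hd q) (last q)) \<longleftrightarrow>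
    (\<exists>a\<in>V. \<exists>b\<in>V. \<exists>p g. distinct p \<and> set p = V - (twins v - {a, b}) \<and> ends (hd p) (last p) \<and>
       obeys p \<and> fills p (twins v - {a, b}) g)"
proof
  assume "\<exists>q. ham q \<and> ends (hd q) (last q)"
  then obtain q where q: "ham q" "ends (hd q) (last q)" by blast
  have "q \<noteq> []" using q assms by (auto simp: ham_def)
  then have e: "hd q \<in> V" "last q \<in> V" using q(1) by (auto simp: ham_def)
  interpret clique_module V E R "twins v - {hd q, last q}" by (rule clique_module_twins)
  obtain p g where "distinct p" "set p = V - (twins v - {hd q, last q})" "hd p = hd q" "last p = last q"
    "obeys p" "fills p (twins v - {hd q, last q}) g"
    using ham_fills[OF q(1)] e by blast
  with e q(2) show "\<exists>a\<in>V. \<exists>b\<in>V. \<exists>p g. distinct p \<and> set p = V - (twins v - {a, b}) \<and> ends (hd p) (last p) \<and>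
       obeys p \<and> fills p (twins v - {a, b}) g" by metis
next
  assume "\<exists>a\<in>V. \<exists>b\<in>V. \<exists>p g. distinct p \<and> set p = V - (twins v - {a, b}) \<and> ends (hd p) (last p) \<and>
       obeys p \<and> fills p (twins v - {a, b}) g"
  then obtain a b p g where p: "a \<in> V" "distinct p" "set p = V - (twins v - {a, b})" "ends (hd p) (last p)"
       "obeys p" "fills p (twins v - {a, b}) g" by blast
  interpret clique_module V E R "twins v - {a, b}" by (rule clique_module_twins)
  have "p \<noteq> []" using p by auto
  then obtain q where "ham q" "hd q = hd p" "last q = last p"
    using fills_ham[OF p(2,3) _ p(5,6)] by blast
  then show "\<exists>q. ham q \<and> ends (hd q) (last q)" using p by metis
qed

end


section \<open>The algorithm\<close>

text \<open>
  Variables: 1 a representative \<open>v\<close> of a largest twin class, 2 the answer, 3 and 4 the guessed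
  ends \<open>a\<close>, \<open>b\<close> of the path, 5 the number \<open>m\<close> of vertices outside the module
  \<open>twins v - {a, b}\<close>, 6 the depth of the enumeration, 7 the current gap, 8 a vertex, 9 failure of
  the greedy assignment. Variables from 20 on are bound. Array 0 holds the sequence of vertices
  outside the module, array 1 the greedy assignment of module vertices to gaps.
\<close>

definition twin_tm :: "nat \<Rightarrow> nat \<Rightarrow> tm" where
  "twin_tm k l = Forall 20 (Iff (Disj (Equ (V 20) (V k)) (Inp False (V k) (V 20)))
     (Disj (Equ (V 20) (V l)) (Inp False (V l) (V 20))))"

definition largest_tm :: "nat \<Rightarrow> tm" where
  "largest_tm k = Forall 24 (Le (Count 21 (twin_tm 24 21)) (Count 21 (twin_tm k 21)))"

definition outside_tm :: "nat \<Rightarrow> tm" where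
  "outside_tm k = Disj (Neg (twin_tm 1 k)) (Disj (Equ (V k) (V 3)) (Equ (V k) (V 4)))"

definition fits_tm :: "nat \<Rightarrow> nat \<Rightarrow> tm" where
  "fits_tm k l = Conj (Conj (Lt (Num 0) (V l)) (Lt (V l) (V 5)))
     (Conj (Conj (Inp False (Arr 0 (Dec (V l))) (V k)) (Inp False (V k) (Arr 0 (V l))))
       (Forall 26 (Imp (Lt (V 26) (V 5))
         (Conj (Imp (Le (V l) (V 26)) (Neg (Inp True (Arr 0 (V 26)) (V k))))
           (Imp (Lt (V 26) (V l)) (Neg (Inp True (V k) (Arr 0 (V 26)))))))))"

definition avail_tm :: "nat \<Rightarrow> tm" where
  "avail_tm k = Conj (Neg (outside_tm k)) (Conj (Equ (Arr 1 (V k)) (Num 0)) (fits_tm k 7))"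

definition deadline_tm :: "nat \<Rightarrow> tm" where
  "deadline_tm k = Count 27 (Conj (Lt (V 27) (V 5))
     (Forall 28 (Imp (Le (V 28) (V 27)) (Neg (Inp True (V k) (Arr 0 (V 28)))))))"

definition best_tm :: "nat \<Rightarrow> tm" where
  "best_tm k = Conj (avail_tm k) (Forall 29 (Imp (avail_tm 29) (Le (deadline_tm k) (deadline_tm 29))))"

definition obeys_tm :: tm where
  "obeys_tm = Forall 30 (Forall 31 (Imp (Conj (Lt (V 30) (V 31)) (Lt (V 31) (V 5)))
     (Neg (Inp True (Arr 0 (V 31)) (Arr 0 (V 30))))))"

definition covered_tm :: tm where
  "covered_tm = Forall 30 (Imp (Neg (outside_tm 30)) (Exists 31 (fits_tm 30 31)))"

definition ends_tm :: "bool \<Rightarrow> tm" where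
  "ends_tm cyc = (if cyc then Inp False (Arr 0 (Num 0)) (Arr 0 (Dec (V 5))) else Num 1)"

text \<open>A result of \<open>First\<close> outside the vertex range signals that no vertex is
  available. In the absence of an empty command, \<open>Asg 8 (Num 0)\<close> stands for doing
  nothing.\<close>

definition assign_gap :: hcom where
  "assign_gap =
     Cond (Inp False (Arr 0 (Dec (V 7))) (Arr 0 (V 7))) (Asg 8 (Num 0))
       (Asg 8 (First 30 31 (best_tm 30)) ;;
        Cond (Lt (V 8) Size) (Put 1 (V 8) (V 7)) (Asg 9 (Num 1))) ;;
     Asg 7 (Inc (V 7))"

definition check :: "bool \<Rightarrow> hcom" where
  "check cyc =
     Asg 9 (Num 0) ;;
     Asg 7 (Num 0) ;;
     Loop (Lt (V 7) Size) (Put 1 (V 7) (Num 0) ;; Asg 7 (Inc (V 7))) ;;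
     Asg 7 (Num 1) ;;
     Loop (Lt (V 7) (V 5)) assign_gap ;;
     Cond (Conj (Conj (Equ (V 9) (Num 0)) (ends_tm cyc)) (Conj obeys_tm covered_tm))
       (Asg 2 (Num 1)) (Asg 7 (Num 0))"

definition next_candidate :: hcom where
  "next_candidate = Put 0 (V 6) (Inc (Arr 0 (V 6)))"

text \<open>Backtracking without recursion: array 0 up to the depth in variable 6 is the stack, and
  its top entry is the candidate under test. The value \<open>n\<close> marks an exhausted level;
  the depth then drops and the candidate below advances.\<close>

definition dfs_body :: "bool \<Rightarrow> hcom" where
  "dfs_body cyc =
     Asg 8 (Arr 0 (V 6)) ;;
     Cond (Lt (V 8) Size)
       (Cond (Conj (outside_tm 8) (Forall 20 (Imp (Lt (V 20) (V 6)) (Neg (Equ (Arr 0 (V 20)) (V 8))))))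
         (Cond (Equ (Inc (V 6)) (V 5))
           (check cyc ;; next_candidate)
           (Asg 6 (Inc (V 6)) ;; Put 0 (V 6) (Num 0)))
         next_candidate)
       (Asg 6 (Dec (V 6)) ;; next_candidate)"

definition dfs_test :: tm where
  "dfs_test = Neg (Conj (Equ (V 6) (Num 0)) (Le Size (Arr 0 (V 6))))"

definition main :: "bool \<Rightarrow> hcom" where
  "main cyc =
     Asg 1 (First 22 23 (largest_tm 22)) ;;
     Asg 3 (Num 0) ;;
     Loop (Lt (V 3) Size)
       (Asg 4 (Num 0) ;;
        Loop (Lt (V 4) Size)
          (Asg 5 (Count 25 (outside_tm 25)) ;;
           Asg 6 (Num 0) ;;
           Put 0 (V 6) (Num 0) ;;
           Loop dfs_test (dfs_body cyc) ;;
           Asg 4 (Inc (V 4))) ;;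
        Asg 3 (Inc (V 3)))"

lemmas program_defs = tm_abbrevs twin_tm_def largest_tm_def outside_tm_def fits_tm_def avail_tm_def
  deadline_tm_def best_tm_def obeys_tm_def covered_tm_def ends_tm_def assign_gap_def check_def
  next_candidate_def dfs_body_def dfs_test_def main_def

lemma wf_main: "wf_hcom (main cyc)"
  by (simp add: program_defs)

section \<open>Meaning of the terms used by the algorithm\<close>

locale numbered_graph = ordered_graph "{..<n}" E R for n E R
begin

definition input :: "bool \<Rightarrow> nat \<Rightarrow> nat \<Rightarrow> bool" where
  "input q = (if q then R else E)"

abbreviation val :: "(nat \<Rightarrow> nat \<Rightarrow> nat) \<Rightarrow> tm \<Rightarrow> (nat \<Rightarrow> nat) \<Rightarrow> nat" where
  "val \<equiv> tval n input"

abbreviation run :: "hcom \<Rightarrow> store \<Rightarrow> nat \<Rightarrow> (store \<Rightarrow> bool) \<Rightarrow> bool" where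
  "run \<equiv> spec n input"

lemma input_simps [simp]: "input False = E" "input True = R"
  by (simp_all add: input_def)

lemma val_twin:
  "\<rho> k < n \<Longrightarrow> \<rho> l < n \<Longrightarrow> k \<noteq> 20 \<Longrightarrow> l \<noteq> 20 \<Longrightarrow> val A (twin_tm k l) \<rho> = of_bool (twin (\<rho> k) (\<rho> l))"
  by (auto simp: twin_tm_def twin_def)

lemma val_largest:
  assumes "\<rho> k < n" "k \<notin> {20, 21, 24}"
  shows "val A (largest_tm k) \<rho> = of_bool (\<forall>u<n. card (twins u) \<le> card (twins (\<rho> k)))"
proof -
  have "val A (Count 21 (twin_tm l 21)) \<sigma> = card (twins (\<sigma> l))" if "\<sigma> l < n" "l \<notin> {20, 21}" for l \<sigma>
  proof -
    have "{i. i < n \<and> val A (twin_tm l 21) (\<sigma>(21 := i)) \<noteq> 0} = twins (\<sigma> l)"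
      using that by (auto simp: val_twin twins_def)
    then show ?thesis by simp
  qed
  then show ?thesis using assms by (simp add: largest_tm_def del: tval.simps(12))
qed

end

locale search = numbered_graph +
  fixes v a b :: nat
  assumes v: "v < n" and a: "a < n" and b: "b < n"
begin

abbreviation module :: "nat set" where "module \<equiv> twins v - {a, b}"

sublocale clique_module "{..<n}" E R module
  by (rule clique_module_twins)

definition env :: "nat list \<Rightarrow> (nat \<Rightarrow> nat) \<Rightarrow> (nat \<Rightarrow> nat \<Rightarrow> nat) \<Rightarrow> bool" where
  "env p \<rho> A \<longleftrightarrow> \<rho> 1 = v \<and> \<rho> 3 = a \<and> \<rho> 4 = b \<and> \<rho> 5 = length p \<and> (\<forall>i<length p. A 0 i = p ! i)"

definition seq :: "nat list \<Rightarrow> bool" where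
  "seq p \<longleftrightarrow> distinct p \<and> set p = {..<n} - module"

lemma seq_length: "seq p \<Longrightarrow> length p = card ({..<n} - module)"
  by (metis seq_def distinct_card)

lemma card_outside: "card ({..<n} - module) \<le> n"
  using card_mono[of "{..<n}" "{..<n} - module"] by auto

lemma outside_pos: "0 < card ({..<n} - module)"
  using a by (auto simp: card_gt_0_iff)

lemma seq_nth: "seq p \<Longrightarrow> i < length p \<Longrightarrow> p ! i < n"
  unfolding seq_def using nth_mem by blast

lemma val_outside:
  assumes "\<rho> 1 = v" "\<rho> 3 = a" "\<rho> 4 = b" "\<rho> k < n" "k \<noteq> 20"
  shows "val A (outside_tm k) \<rho> = of_bool (\<rho> k \<notin> module)"
  using assms v by (auto simp: outside_tm_def val_twin twins_def)

lemma val_fits: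
  assumes e: "env p \<rho> A" and p: "seq p" and k: "\<rho> k < n" "k \<noteq> 26" "l \<noteq> 26"
  shows "val A (fits_tm k l) \<rho> = of_bool (fits p (\<rho> k) (\<rho> l))"
proof -
  have len: "length p \<le> n" using seq_length[OF p] card_outside by simp
  have p5: "\<rho> 5 = length p" using e by (simp add: env_def)
  have arr: "val A (Arr 0 t) \<sigma> = p ! val A t \<sigma>" "p ! val A t \<sigma> < n" if "val A t \<sigma> < length p" for t \<sigma>
    using that e len seq_nth[OF p] by (auto simp: env_def)
  show ?thesis
  proof (cases "0 < \<rho> l \<and> \<rho> l < length p")
    case True
    have *: "val A (Forall 26 (Imp (Lt (V 26) (V 5))
         (Conj (Imp (Le (V l) (V 26)) (Neg (Inp True (Arr 0 (V 26)) (V k))))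
           (Imp (Lt (V 26) (V l)) (Neg (Inp True (V k) (Arr 0 (V 26)))))))) \<rho> \<noteq> 0 \<longleftrightarrow>
      (\<forall>j<length p. (\<rho> l \<le> j \<longrightarrow> \<not> R (p ! j) (\<rho> k)) \<and> (j < \<rho> l \<longrightarrow> \<not> R (\<rho> k) (p ! j)))"
      using k p5 len arr seq_nth[OF p] by (auto simp del: tval.simps(7))
    have "val A (Inp False (Arr 0 (Dec (V l))) (V k)) \<rho> \<noteq> 0 \<longleftrightarrow> E (p ! (\<rho> l - 1)) (\<rho> k)"
      "val A (Inp False (V k) (Arr 0 (V l))) \<rho> \<noteq> 0 \<longleftrightarrow> E (\<rho> k) (p ! \<rho> l)"
      using True arr[of "Dec (V l)" \<rho>] arr[of "V l" \<rho>] k by (auto simp del: tval.simps(7))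
    with * show ?thesis using True p5 unfolding fits_tm_def fits_def
      by (simp del: tval.simps(6,7) tval_Forall)
  next
    case False
    then show ?thesis using p5 by (auto simp: fits_tm_def fits_def)
  qed
qed

lemma val_avail:
  assumes e: "env p \<rho> A" and p: "seq p" and k: "\<rho> k < n" "k \<notin> {20, 26}"
  shows "val A (avail_tm k) \<rho> = of_bool (avail p (A 1) (\<rho> 7) (\<rho> k))"
proof -
  have "val A (outside_tm k) \<rho> = of_bool (\<rho> k \<notin> module)"
    using e k by (intro val_outside) (auto simp: env_def)
  then show ?thesis using k val_fits[OF e p, of k 7] by (auto simp: avail_tm_def avail_def)
qed

lemma val_deadline:
  assumes e: "env p \<rho> A" and p: "seq p" and k: "\<rho> k < n" "k \<notin> {27, 28}"
  shows "val A (deadline_tm k) \<rho> = deadline p (\<rho> k)"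
proof -
  have len: "length p \<le> n" using seq_length[OF p] card_outside by simp
  have "(j < n \<and> val A (Conj (Lt (V 27) (V 5))
     (Forall 28 (Imp (Le (V 28) (V 27)) (Neg (Inp True (V k) (Arr 0 (V 28))))))) (\<rho>(27 := j)) \<noteq> 0) \<longleftrightarrow>
     j < length p \<and> (\<forall>i\<le>j. \<not> R (\<rho> k) (p ! i))" for j
  proof (cases "j < length p")
    case True
    have "A 0 i = p ! i \<and> p ! i < n \<and> i < n" if "i \<le> j" for i
      using True that e seq_nth[OF p] len by (auto simp: env_def)
    then show ?thesis using True k len e by (auto simp: env_def)
  qed (use e in \<open>auto simp: env_def\<close>)
  then show ?thesis by (simp only: deadline_tm_def deadline_def tval.simps(12))
qed

lemma env_upd: "x \<notin> {1, 3, 4, 5} \<Longrightarrow> env p (\<rho>(x := i)) A = env p \<rho> A"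
  by (simp add: env_def)

lemma val_best:
  assumes e: "env p \<rho> A" and p: "seq p" and k: "\<rho> k < n" "k \<notin> {20, 26, 27, 28, 29}"
  shows "val A (best_tm k) \<rho> \<noteq> 0 \<longleftrightarrow> avail p (A 1) (\<rho> 7) (\<rho> k) \<and>
    (\<forall>d. avail p (A 1) (\<rho> 7) d \<longrightarrow> deadline p (\<rho> k) \<le> deadline p d)"
proof -
  have "d < n" if "avail p (A 1) (\<rho> 7) d" for d using that C_sub by (auto simp: avail_def)
  moreover have e29: "env p (\<rho>(29 := d)) A" for d using e by (simp add: env_upd)
  moreover have "val A (avail_tm 29) (\<rho>(29 := d)) = of_bool (avail p (A 1) (\<rho> 7) d)"
    "val A (deadline_tm 29) (\<rho>(29 := d)) = deadline p d"
    "val A (deadline_tm k) (\<rho>(29 := d)) = deadline p (\<rho> k)" if "d < n" for d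
    using val_avail[OF e29 p, of d 29] val_deadline[OF e29 p, of d 29] val_deadline[OF e29 p, of d k] that k
    by simp_all
  moreover have "val A (avail_tm k) \<rho> = of_bool (avail p (A 1) (\<rho> 7) (\<rho> k))"
    using val_avail[OF e p] k by simp
  ultimately show ?thesis by (auto simp: best_tm_def simp del: One_nat_def)
qed

definition ends :: "bool \<Rightarrow> nat list \<Rightarrow> bool" where
  "ends cyc p \<longleftrightarrow> (cyc \<longrightarrow> E (hd p) (last p))"

definition good :: "bool \<Rightarrow> nat list \<Rightarrow> bool" where
  "good cyc p \<longleftrightarrow> ends cyc p \<and> obeys p \<and> (\<exists>g. fills p module g)"

lemma val_checks:
  assumes e: "env p \<rho> A" and p: "seq p"
  shows "val A (ends_tm cyc) \<rho> \<noteq> 0 \<longleftrightarrow> ends cyc p"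
    and "val A obeys_tm \<rho> \<noteq> 0 \<longleftrightarrow> obeys p"
    and "val A covered_tm \<rho> \<noteq> 0 \<longleftrightarrow> (\<forall>c\<in>module. \<exists>i. fits p c i)"
proof -
  have len: "length p \<le> n" using seq_length[OF p] card_outside by simp
  have ne: "p \<noteq> []" using seq_length[OF p] outside_pos by (metis length_greater_0_conv)
  have p5: "\<rho> 5 = length p" using e by (simp add: env_def)
  have arr: "A 0 i = p ! i" "p ! i < n" if "i < length p" for i
    using that e seq_nth[OF p] by (auto simp: env_def)
  show "val A (ends_tm cyc) \<rho> \<noteq> 0 \<longleftrightarrow> ends cyc p"
    using ne len p5 arr[of 0] arr[of "length p - 1"]
    by (cases "length p") (auto simp: ends_tm_def ends_def hd_conv_nth last_conv_nth)
  have "val A obeys_tm \<rho> \<noteq> 0 \<longleftrightarrow>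
    (\<forall>i<n. \<forall>j<n. i < j \<and> j < length p \<longrightarrow> \<not> R (p ! j) (p ! i))"
    using arr p5 by (simp add: obeys_tm_def) (meson less_trans)
  then show "val A obeys_tm \<rho> \<noteq> 0 \<longleftrightarrow> obeys p"
    using len unfolding obeys_def by (meson less_le_trans less_trans)
  have "val A (outside_tm 30) (\<rho>(30 := c)) = of_bool (c \<notin> module)" if "c < n" for c
    using e that by (subst val_outside) (auto simp: env_def)
  moreover have "val A (fits_tm 30 31) (\<rho>(30 := c, 31 := i)) = of_bool (fits p c i)" if "c < n" for c i
    using that e p by (subst val_fits[of p]) (auto simp: env_upd)
  moreover have "i < n" if "fits p c i" for c i using that len by (simp add: fits_def)
  ultimately show "val A covered_tm \<rho> \<noteq> 0 \<longleftrightarrow> (\<forall>c\<in>module. \<exists>i. fits p c i)"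
    using C_sub by (auto simp: covered_tm_def) blast
qed

section \<open>Greedy pass and verdict for one vertex sequence\<close>

definition keeps :: "(nat \<Rightarrow> nat) \<Rightarrow> (nat \<Rightarrow> nat \<Rightarrow> nat) \<Rightarrow> store \<Rightarrow> bool" where
  "keeps \<rho> A z \<longleftrightarrow> snd z 0 = A 0 \<and> (\<forall>x\<in>{1, 3, 4, 5, 6}. fst z x = \<rho> x)"

lemma keeps_env: "env p \<rho> A \<Longrightarrow> keeps \<rho> A (\<rho>', A') \<Longrightarrow> env p \<rho>' A'"
  by (simp add: env_def keeps_def)

text \<open>A raised failure flag certifies that no filling exists, so the loop can run on to the
  last gap and needs no early exit.\<close>

definition gap_inv :: "nat list \<Rightarrow> (nat \<Rightarrow> nat) \<Rightarrow> (nat \<Rightarrow> nat \<Rightarrow> nat) \<Rightarrow> nat \<Rightarrow> store \<Rightarrow> bool" where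
  "gap_inv p \<rho> A i z \<longleftrightarrow> keeps \<rho> A z \<and> fst z 2 = \<rho> 2 \<and> fst z 7 = i \<and>
     (if fst z 9 = 0 then greedy_inv p (snd z 1) i else \<not> (\<exists>g. fills p module g))"

lemma run_assign_gap:
  assumes e: "env p \<rho> A" and p: "seq p" and i: "0 < i" "i < length p"
    and inv: "gap_inv p \<rho> A i (\<rho>', A')"
  shows "run assign_gap (\<rho>', A') 5 (gap_inv p \<rho> A (Suc i))"
proof -
  have len: "length p \<le> n" using seq_length[OF p] card_outside by simp
  have e': "env p \<rho>' A'" using keeps_env[OF e] inv by (simp add: gap_inv_def)
  have r7: "\<rho>' 7 = i" using inv by (simp add: gap_inv_def)
  have arr: "A' 0 j = p ! j" "p ! j < n" if "j < length p" for j
    using that e' seq_nth[OF p] by (auto simp: env_def)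
  have gap: "val A' (Inp False (Arr 0 (Dec (V 7))) (Arr 0 (V 7))) \<rho>' = 0 \<longleftrightarrow> gap p i"
    using arr[of i] arr[of "i - 1"] i r7 len by (auto simp: gap_def)
  let ?c = "val A' (First 30 31 (best_tm 30)) \<rho>'"
  let ?best = "\<lambda>c. avail p (A' 1) i c \<and> (\<forall>d. avail p (A' 1) i d \<longrightarrow> deadline p c \<le> deadline p d)"
  have best: "val A' (best_tm 30) (\<rho>'(31 := j, 30 := c)) \<noteq> 0 \<longleftrightarrow> ?best c" if "c < n" for c j
    using that e' p r7 by (subst val_best[of p]) (auto simp: env_upd)
  note first = tval_First[of n input A' "best_tm 30" \<rho>' 31 30 ?best, OF best]
  have next_gap: "run (Asg 7 (Inc (V 7))) (\<rho>'', A'') 1 (gap_inv p \<rho> A (Suc i))"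
    if "keeps \<rho> A (\<rho>'', A'')" "\<rho>'' 2 = \<rho> 2" "\<rho>'' 7 = i"
      "if \<rho>'' 9 = 0 then greedy_inv p (A'' 1) (Suc i) else \<not> (\<exists>g. fills p module g)" for \<rho>'' A''
    using that by (intro spec_Asg) (auto simp: gap_inv_def keeps_def)
  show ?thesis
    unfolding assign_gap_def
  proof (rule spec_Sq[where N = 4 and N' = 1])
    show "run (Cond (Inp False (Arr 0 (Dec (V 7))) (Arr 0 (V 7))) (Asg 8 (Num 0))
       (Asg 8 (First 30 31 (best_tm 30)) ;;
        Cond (Lt (V 8) Size) (Put 1 (V 8) (V 7)) (Asg 9 (Num 1)))) (\<rho>', A') 4
      (\<lambda>z. run (Asg 7 (Inc (V 7))) z 1 (gap_inv p \<rho> A (Suc i)))"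
    proof (rule spec_Cond[where N = 3])
      assume "val A' (Inp False (Arr 0 (Dec (V 7))) (Arr 0 (V 7))) \<rho>' \<noteq> 0"
      then have "\<not> gap p i" using gap by metis
      then show "run (Asg 8 (Num 0)) (\<rho>', A') 3 (\<lambda>z. run (Asg 7 (Inc (V 7))) z 1 (gap_inv p \<rho> A (Suc i)))"
        using inv greedy_inv_skip
        by (intro spec_Asg next_gap) (auto simp: gap_inv_def keeps_def)
    next
      assume "val A' (Inp False (Arr 0 (Dec (V 7))) (Arr 0 (V 7))) \<rho>' = 0"
      then have g: "gap p i" using gap by metis
      show "run (Asg 8 (First 30 31 (best_tm 30)) ;;
          Cond (Lt (V 8) Size) (Put 1 (V 8) (V 7)) (Asg 9 (Num 1))) (\<rho>', A') 3
        (\<lambda>z. run (Asg 7 (Inc (V 7))) z 1 (gap_inv p \<rho> A (Suc i)))"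
      proof (rule spec_Sq[where N = 1 and N' = 2], rule spec_Asg, rule spec_Cond[where N = 1])
        assume "val A' (Lt (V 8) Size) (\<rho>'(8 := ?c)) \<noteq> 0"
        then have c: "?c < n" by simp
        have best': "?best ?c" by (rule first(1)[OF _ _ c]) simp_all
        have "if \<rho>' 9 = 0 then greedy_inv p ((A' 1)(?c := i)) (Suc i) else \<not> (\<exists>g. fills p module g)"
          using inv greedy_inv_step[OF _ g, of "A' 1" ?c] best' p by (auto simp: gap_inv_def seq_def)
        then show "run (Put 1 (V 8) (V 7)) (\<rho>'(8 := ?c), A') 1
            (\<lambda>z. run (Asg 7 (Inc (V 7))) z 1 (gap_inv p \<rho> A (Suc i)))"
          using inv c by (intro spec_Put next_gap) (auto simp: gap_inv_def keeps_def)
      next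
        assume "val A' (Lt (V 8) Size) (\<rho>'(8 := ?c)) = 0"
        then have c: "\<not> ?c < n" by simp
        have none: "\<not> ?best d" if "d < n" for d using first(2)[OF _ _ c that] by simp
        \<comment> \<open>Deadlines are natural numbers, so any available vertex would entail one of
          least deadline. The absence of a best vertex thus means that none is available.\<close>
        have navail: "\<not> avail p (A' 1) i d" for d
        proof
          assume d: "avail p (A' 1) i d"
          let ?d = "arg_min (deadline p) (avail p (A' 1) i)"
          have "?best ?d" using arg_min_nat_lemma[of "avail p (A' 1) i", OF d] by blast
          moreover have "?d < n" using calculation C_sub by (auto simp: avail_def)
          ultimately show False using none by blast
        qed
        have "\<not> (\<exists>g. fills p module g)"
        proof (cases "\<rho>' 9 = 0")
          case True
          then have "greedy_inv p (A' 1) i" using inv by (simp add: gap_inv_def)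
          then show ?thesis using greedy_avail[OF _ g] fills_matching navail by blast
        next
          case False
          then show ?thesis using inv by (simp add: gap_inv_def)
        qed
        then show "run (Asg 9 (Num 1)) (\<rho>'(8 := ?c), A') 1
            (\<lambda>z. run (Asg 7 (Inc (V 7))) z 1 (gap_inv p \<rho> A (Suc i)))"
          using inv by (intro spec_Asg next_gap) (auto simp: gap_inv_def keeps_def)
      qed simp_all
    qed simp
  qed simp
qed

text \<open>Variable 2 is only ever raised, so the answer accumulates as a disjunction over the
  sequences checked. The bound has slack: clearing array 1 takes \<open>3 * n + 1\<close> steps and
  the greedy pass at most \<open>6 * n + 1\<close>.\<close>

lemma run_check:
  assumes e: "env p \<rho> A" and p: "seq p"
  shows "run (check cyc) (\<rho>, A) (12 * n + 20)
    (\<lambda>z. keeps \<rho> A z \<and> (fst z 2 \<noteq> 0 \<longleftrightarrow> \<rho> 2 \<noteq> 0 \<or> good cyc p))"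
proof -
  let ?m = "length p"
  let ?Q = "\<lambda>z. keeps \<rho> A z \<and> (fst z 2 \<noteq> 0 \<longleftrightarrow> \<rho> 2 \<noteq> 0 \<or> good cyc p)"
  have len: "?m \<le> n" using seq_length[OF p] card_outside by simp
  have m0: "0 < ?m" using seq_length[OF p] outside_pos by simp
  define C1 where "C1 = Cond (Conj (Conj (Equ (V 9) (Num 0)) (ends_tm cyc)) (Conj obeys_tm covered_tm))
       (Asg 2 (Num 1)) (Asg 7 (Num 0))"
  have 1: "run C1 z 2 ?Q" if g: "gap_inv p \<rho> A ?m z" for z
  proof -
    obtain \<rho>' A' where z: "z = (\<rho>', A')" by (cases z)
    have e': "env p \<rho>' A'" using keeps_env[OF e] g z by (simp add: gap_inv_def)
    have "val A' (Conj (Conj (Equ (V 9) (Num 0)) (ends_tm cyc)) (Conj obeys_tm covered_tm)) \<rho>' \<noteq> 0 \<longleftrightarrow>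
      \<rho>' 9 = 0 \<and> ends cyc p \<and> obeys p \<and> (\<forall>c\<in>module. \<exists>i. fits p c i)"
      using val_checks(1)[OF e' p, of cyc] val_checks(2,3)[OF e' p] by auto
    \<comment> \<open>With the flag down, the final greedy invariant and the coverage test yield a
      filling. Conversely, a filling rules out a raised flag and gives every module vertex a
      position.\<close>
    also have "\<dots> \<longleftrightarrow> good cyc p"
      using g z greedy_fills[of p "A' 1"] by (auto simp: gap_inv_def good_def fills_def split: if_splits)
    finally have iff: "val A' (Conj (Conj (Equ (V 9) (Num 0)) (ends_tm cyc)) (Conj obeys_tm covered_tm)) \<rho>' \<noteq> 0 \<longleftrightarrow>
      good cyc p" .
    show ?thesis unfolding z C1_def
      apply (rule spec_Cond[where N = 1])
      using g iff z by (auto intro!: spec_Asg simp: gap_inv_def keeps_def simp del: tval.simps(2-))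
  qed
  have 2: "run (Loop (Lt (V 7) (V 5)) assign_gap) z (6 * n + 1) (\<lambda>z. run C1 z 2 ?Q)"
    if g: "gap_inv p \<rho> A 1 z" for z
  proof (rule spec_mono)
    show "run (Loop (Lt (V 7) (V 5)) assign_gap) z ((?m - 1) * (5 + 1) + 1) (gap_inv p \<rho> A (Suc (?m - 1)))"
    proof (rule spec_Loop_for[where P = "\<lambda>j. gap_inv p \<rho> A (Suc j)"])
      fix j \<rho>' A' assume j: "j < ?m - 1" and g: "gap_inv p \<rho> A (Suc j) (\<rho>', A')"
      have "\<rho>' 7 = Suc j" "\<rho>' 5 = ?m" using g e by (auto simp: gap_inv_def keeps_def env_def)
      then show "val A' (Lt (V 7) (V 5)) \<rho>' \<noteq> 0 \<and> run assign_gap (\<rho>', A') 5 (gap_inv p \<rho> A (Suc (Suc j)))"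
        using j run_assign_gap[OF e p _ _ g] by simp
    next
      fix \<rho>' A' assume g: "gap_inv p \<rho> A (Suc (?m - 1)) (\<rho>', A')"
      have "\<rho>' 7 = Suc (?m - 1)" "\<rho>' 5 = ?m" using g e by (auto simp: gap_inv_def keeps_def env_def)
      then show "val A' (Lt (V 7) (V 5)) \<rho>' = 0" by simp
    qed (use g in simp_all)
    show "run C1 z 2 ?Q" if "gap_inv p \<rho> A (Suc (?m - 1)) z" for z using 1 that m0 by simp
  qed (use len in simp)
  let ?P = "\<lambda>j z. keeps \<rho> A z \<and> fst z 2 = \<rho> 2 \<and> fst z 9 = 0 \<and> fst z 7 = j \<and> (\<forall>c<j. snd z 1 c = 0)"
  have 3: "run (Asg 7 (Num 1) ;; Loop (Lt (V 7) (V 5)) assign_gap ;; C1) z (6 * n + 5) ?Q" if P: "?P n z" for z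
  proof -
    obtain \<rho>' A' where z: "z = (\<rho>', A')" by (cases z)
    have "gap_inv p \<rho> A 1 (\<rho>'(7 := 1), A')"
      using P z greedy_inv_init[of "A' 1" p] C_sub by (auto simp: gap_inv_def keeps_def)
    then show ?thesis unfolding z
      by (intro spec_Sq[where N = 1 and N' = "6 * n + 4"] spec_Asg spec_Sq[where N = "6 * n + 1" and N' = 2] 2) simp_all
  qed
  let ?L = "Loop (Lt (V 7) Size) (Put 1 (V 7) (Num 0) ;; Asg 7 (Inc (V 7)))"
  have 4: "run ?L z (3 * n + 1) (?P n)" if P: "?P 0 z" for z
  proof (rule spec_Loop_for[where P = ?P and N = 2])
    fix j \<rho>' A' assume "j < n" "?P j (\<rho>', A')"
    then show "val A' (Lt (V 7) Size) \<rho>' \<noteq> 0 \<and>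
      run (Put 1 (V 7) (Num 0) ;; Asg 7 (Inc (V 7))) (\<rho>', A') 2 (?P (Suc j))"
      by (auto intro!: spec_Sq[where N = 1 and N' = 1] spec_Put spec_Asg simp: keeps_def less_Suc_eq)
  qed (use P in auto)
  show ?thesis
    unfolding check_def C1_def[symmetric]
    apply (rule spec_Sq[where N = 1 and N' = "12 * n + 19"])
     apply (rule spec_Asg)
      apply (rule spec_Sq[where N = 1 and N' = "12 * n + 18"])
       apply (rule spec_Asg)
        apply (rule spec_Sq[where N = "3 * n + 1" and N' = "6 * n + 5"])
         apply (rule spec_mono[OF 4 order_refl 3])
          apply (auto simp: keeps_def)
    done
qed

subsection \<open>Enumeration of the vertices outside the module\<close>

definition dfs_state :: "nat list \<Rightarrow> nat \<Rightarrow> (nat \<Rightarrow> nat) \<Rightarrow> (nat \<Rightarrow> nat \<Rightarrow> nat) \<Rightarrow> bool" where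
  "dfs_state xs x \<rho> A \<longleftrightarrow> \<rho> 1 = v \<and> \<rho> 3 = a \<and> \<rho> 4 = b \<and> \<rho> 5 = card ({..<n} - module) \<and>
     \<rho> 6 = length xs \<and> (\<forall>i<length xs. A 0 i = xs ! i) \<and> A 0 (length xs) = x"

text \<open>The part of the subtree below prefix \<open>xs\<close> that is still unexplored when
  \<open>x\<close> is the current candidate.\<close>

definition good_from :: "bool \<Rightarrow> nat list \<Rightarrow> nat \<Rightarrow> bool" where
  "good_from cyc xs x \<longleftrightarrow>
     (\<exists>p. seq p \<and> take (length xs) p = xs \<and> x \<le> p ! length xs \<and> good cyc p)"

text \<open>
  An upper bound on the number of steps below a node of the search tree with \<open>q\<close> vertices left,
  where \<open>U\<close> bounds a single iteration.
\<close>

primrec dfs_time :: "nat \<Rightarrow> nat \<Rightarrow> nat" where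
  "dfs_time U 0 = 0"
| "dfs_time U (Suc q) = n * U + Suc q * dfs_time U q + U"

text \<open>After division by \<open>fact q\<close>, the recurrence adds at most
  \<open>U * (n + 1)\<close> per level.\<close>

lemma dfs_time_le: "dfs_time U q \<le> fact q * (q * (U * (n + 1)))"
proof (induction q)
  case (Suc q)
  have "dfs_time U (Suc q) = U * (n + 1) + Suc q * dfs_time U q" by (simp add: algebra_simps)
  also have "\<dots> \<le> fact (Suc q) * (U * (n + 1)) + Suc q * (fact q * (q * (U * (n + 1))))"
    using Suc by (intro add_mono mult_le_mono2) (simp_all add: fact_ge_1 del: fact_Suc)
  also have "\<dots> = fact (Suc q) * (Suc q * (U * (n + 1)))" by (simp add: algebra_simps)
  finally show ?case .
qed simp


abbreviation outside :: "nat set" where "outside \<equiv> {..<n} - module"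

lemma good_from_Suc:
  assumes len: "length xs < card outside"
  shows "good_from cyc xs x \<longleftrightarrow>
    (\<exists>p. seq p \<and> take (Suc (length xs)) p = xs @ [x] \<and> good cyc p) \<or> good_from cyc xs (Suc x)"
proof -
  have "take (Suc (length xs)) p = take (length xs) p @ [p ! length xs]" if "seq p" for p
    using seq_length[OF that] len by (simp add: take_Suc_conv_app_nth)
  then have "seq p \<and> take (length xs) p = xs \<and> x \<le> p ! length xs \<and> good cyc p \<longleftrightarrow>
     (seq p \<and> take (Suc (length xs)) p = xs @ [x] \<and> good cyc p) \<or>
     (seq p \<and> take (length xs) p = xs \<and> Suc x \<le> p ! length xs \<and> good cyc p)" for p
    by (cases "seq p") (auto simp: Suc_le_eq)
  then show ?thesis unfolding good_from_def by blast
qed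

lemma good_from_n:
  assumes "length xs < card outside"
  shows "\<not> good_from cyc xs n"
  using assms seq_nth seq_length by (fastforce simp: good_from_def)

lemma seq_prefix:
  assumes "seq p" "take (Suc (length xs)) p = xs @ [x]"
  shows "x \<in> outside - set xs"
proof -
  have "distinct (xs @ [x])" "set (xs @ [x]) \<subseteq> set p"
    using assms distinct_take[of p "Suc (length xs)"] set_take_subset[of "Suc (length xs)" p]
    by (auto simp: seq_def)
  then show ?thesis using assms(1) by (auto simp: seq_def)
qed

lemma run_next_candidate:
  assumes "dfs_state xs x \<rho> A" "length xs < n"
    and "\<And>A'. dfs_state xs (Suc x) \<rho> A' \<Longrightarrow> Q (\<rho>, A')"
  shows "run next_candidate (\<rho>, A) 1 Q"
  unfolding next_candidate_def
  by (rule spec_Put) (use assms in \<open>auto simp: dfs_state_def\<close>)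

abbreviation dfs_loop :: "bool \<Rightarrow> hcom" where "dfs_loop cyc \<equiv> Loop dfs_test (dfs_body cyc)"

abbreviation iter_time :: nat where "iter_time \<equiv> 12 * n + 30"

text \<open>One iteration on a candidate in range has three outcomes, each with its own hypothesis
  on the postcondition: the candidate is rejected, it completes a sequence, or the search descends.
  A completed sequence costs most, namely one \<open>check\<close> and a few steps.\<close>

lemma run_dfs_body:
  assumes d: "dfs_state xs x \<rho> A" and len: "length xs < card outside" and xn: "x < n"
    and invalid: "\<And>A'. x \<notin> outside - set xs \<Longrightarrow> dfs_state xs (Suc x) (\<rho>(8 := x)) A' \<Longrightarrow>
      Q (\<rho>(8 := x), A')"
    and leaf: "\<And>\<rho>' A'. x \<in> outside - set xs \<Longrightarrow> Suc (length xs) = card outside \<Longrightarrow>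
      seq (xs @ [x]) \<Longrightarrow> dfs_state xs (Suc x) \<rho>' A' \<Longrightarrow>
      (\<rho>' 2 \<noteq> 0 \<longleftrightarrow> \<rho> 2 \<noteq> 0 \<or> good cyc (xs @ [x])) \<Longrightarrow> Q (\<rho>', A')"
    and descend: "\<And>\<rho>' A'. x \<in> outside - set xs \<Longrightarrow> Suc (length xs) < card outside \<Longrightarrow>
      dfs_state (xs @ [x]) 0 \<rho>' A' \<Longrightarrow> \<rho>' 2 = \<rho> 2 \<Longrightarrow> Q (\<rho>', A')"
    and sub: "distinct xs" "set xs \<subseteq> outside"
  shows "run (dfs_body cyc) (\<rho>, A) (12 * n + 28) Q"
proof -
  have len_n: "length xs < n" using len card_outside by linarith
  let ?\<rho> = "\<rho>(8 := x)"
  have d8: "dfs_state xs x ?\<rho> A" using d by (simp add: dfs_state_def)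
  have "val A (outside_tm 8) ?\<rho> = of_bool (x \<notin> module)"
    using d8 xn by (subst val_outside) (auto simp: dfs_state_def)
  moreover have "val A (Forall 20 (Imp (Lt (V 20) (V 6)) (Neg (Equ (Arr 0 (V 20)) (V 8))))) ?\<rho> \<noteq> 0 \<longleftrightarrow>
    (\<forall>i<length xs. xs ! i \<noteq> x)"
    using d8 len_n by (auto simp: dfs_state_def)
  ultimately have cand: "val A (Conj (outside_tm 8) (Forall 20 (Imp (Lt (V 20) (V 6)) (Neg (Equ (Arr 0 (V 20)) (V 8)))))) ?\<rho> \<noteq> 0 \<longleftrightarrow>
    x \<in> outside - set xs"
    using xn by (auto simp: in_set_conv_nth simp del: tval_Forall)
  have x: "val A (Arr 0 (V 6)) \<rho> = x" using d len_n by (simp add: dfs_state_def)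
  show ?thesis
      unfolding dfs_body_def
    proof (rule spec_Sq[where N = 1 and N' = "12 * n + 27"], rule spec_Asg, unfold x,
        rule spec_Cond[where N = "12 * n + 26"], rule spec_Cond[where N = "12 * n + 25"],
        rule spec_Cond[where N = "12 * n + 24"])
      assume "val A (Conj (outside_tm 8) (Forall 20 (Imp (Lt (V 20) (V 6)) (Neg (Equ (Arr 0 (V 20)) (V 8)))))) ?\<rho> \<noteq> 0"
      then have xo: "x \<in> outside - set xs" using cand by blast
      {
        assume "val A (Equ (Inc (V 6)) (V 5)) ?\<rho> \<noteq> 0"
        then have l: "Suc (length xs) = card outside" using d by (simp add: dfs_state_def split: if_splits)
        have "distinct (xs @ [x])" using xo sub by simp
        moreover have "set (xs @ [x]) = outside"
          using xo sub l distinct_card[OF calculation] by (intro card_subset_eq) auto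
        ultimately have p: "seq (xs @ [x])" by (simp add: seq_def)
        have "A 0 i = (xs @ [x]) ! i" if "i < Suc (length xs)" for i
          using that d by (auto simp: dfs_state_def nth_append less_Suc_eq)
        then have e: "env (xs @ [x]) ?\<rho> A" using d8 l by (simp add: env_def dfs_state_def)
        show "run (check cyc ;; next_candidate) (?\<rho>, A) (12 * n + 24) Q"
        proof (rule spec_Sq[where N = "12 * n + 20" and N' = 1], rule spec_mono[OF run_check[OF e p] order_refl])
          fix z assume z: "keeps ?\<rho> A z \<and> (fst z 2 \<noteq> 0 \<longleftrightarrow> ?\<rho> 2 \<noteq> 0 \<or> good cyc (xs @ [x]))"
          obtain \<rho>' A' where zz: "z = (\<rho>', A')" by (cases z)
          have "dfs_state xs x \<rho>' A'" using z zz d8 by (auto simp: keeps_def dfs_state_def)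
          then show "run next_candidate z 1 Q"
            unfolding zz using len_n by (rule run_next_candidate, intro leaf) (use xo l p z zz in auto)
        qed simp
      next
        assume "val A (Equ (Inc (V 6)) (V 5)) ?\<rho> = 0"
        then have "Suc (length xs) \<noteq> card outside" using d by (simp add: dfs_state_def)
        then have l: "Suc (length xs) < card outside" using len by simp
        then have ln: "Suc (length xs) < n" using card_outside by linarith
        have v6: "val A (Inc (V 6)) ?\<rho> = Suc (length xs)" using d by (simp add: dfs_state_def)
        show "run (Asg 6 (Inc (V 6)) ;; Put 0 (V 6) (Num 0)) (?\<rho>, A) (12 * n + 24) Q"
        proof (rule spec_Sq[where N = 1 and N' = 1], rule spec_Asg, unfold v6, rule spec_Put)
          show "Q (?\<rho>(6 := Suc (length xs)), A(0 := (A 0)(val A (V 6) (?\<rho>(6 := Suc (length xs))) :=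
            val A (Num 0) (?\<rho>(6 := Suc (length xs))))))"
            using xo l
            by (rule descend) (use d in \<open>auto simp: dfs_state_def nth_append less_Suc_eq\<close>)
        qed (use ln in simp_all)
      }
    next
      assume "val A (Conj (outside_tm 8) (Forall 20 (Imp (Lt (V 20) (V 6)) (Neg (Equ (Arr 0 (V 20)) (V 8)))))) ?\<rho> = 0"
      then have xo: "x \<notin> outside - set xs" using cand by blast
      show "run next_candidate (?\<rho>, A) (12 * n + 25) Q"
        by (rule spec_mono[OF run_next_candidate[OF d8 len_n]]) (use invalid[OF xo] in auto)
    qed (use xn in auto)
qed

lemma run_dfs_step:
  assumes d: "dfs_state xs x \<rho> A" and len: "length xs < card outside" and xn: "x < n"
    and invalid: "\<And>A'. x \<notin> outside - set xs \<Longrightarrow> dfs_state xs (Suc x) (\<rho>(8 := x)) A' \<Longrightarrow>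
      run (dfs_loop cyc) (\<rho>(8 := x), A') N Q"
    and leaf: "\<And>\<rho>' A'. x \<in> outside - set xs \<Longrightarrow> Suc (length xs) = card outside \<Longrightarrow>
      seq (xs @ [x]) \<Longrightarrow> dfs_state xs (Suc x) \<rho>' A' \<Longrightarrow>
      (\<rho>' 2 \<noteq> 0 \<longleftrightarrow> \<rho> 2 \<noteq> 0 \<or> good cyc (xs @ [x])) \<Longrightarrow> run (dfs_loop cyc) (\<rho>', A') N Q"
    and descend: "\<And>\<rho>' A'. x \<in> outside - set xs \<Longrightarrow> Suc (length xs) < card outside \<Longrightarrow>
      dfs_state (xs @ [x]) 0 \<rho>' A' \<Longrightarrow> \<rho>' 2 = \<rho> 2 \<Longrightarrow> run (dfs_loop cyc) (\<rho>', A') N Q"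
    and sub: "distinct xs" "set xs \<subseteq> outside"
  shows "run (dfs_loop cyc) (\<rho>, A) (iter_time + N) Q"
proof (rule spec_Loop_step[where N = "12 * n + 28" and N' = N])
  have "length xs < n" using len card_outside by linarith
  then show "val A dfs_test \<rho> \<noteq> 0" using d xn by (simp add: dfs_test_def dfs_state_def)
  show "run (dfs_body cyc) (\<rho>, A) (12 * n + 28) (\<lambda>z. run (dfs_loop cyc) z N Q)"
    by (rule run_dfs_body[OF d len xn]) (use invalid leaf descend sub in auto)
qed simp

lemma run_dfs_backtrack:
  assumes d: "dfs_state (xs @ [x]) n \<rho> A" and len: "Suc (length xs) < card outside"
    and K: "\<And>\<rho>' A'. dfs_state xs (Suc x) \<rho>' A' \<Longrightarrow> \<rho>' 2 = \<rho> 2 \<Longrightarrow> run (dfs_loop cyc) (\<rho>', A') N Q"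
  shows "run (dfs_loop cyc) (\<rho>, A) (iter_time + N) Q"
proof (rule spec_Loop_step[where N = "12 * n + 28" and N' = N])
  have len_n: "Suc (length xs) < n" using len card_outside by linarith
  show "val A dfs_test \<rho> \<noteq> 0" using d by (simp add: dfs_test_def dfs_state_def)
  have x: "val A (Arr 0 (V 6)) \<rho> = n" using d len_n by (simp add: dfs_state_def)
  have v6: "val A (Dec (V 6)) (\<rho>(8 := n)) = length xs" using d by (simp add: dfs_state_def)
  have d': "dfs_state xs x (\<rho>(8 := n, 6 := length xs)) A"
    using d by (auto simp: dfs_state_def nth_append less_Suc_eq)
  have "run (dfs_body cyc) (\<rho>, A) (12 * n + 28) Q'"
    if Q': "\<And>\<rho>' A'. dfs_state xs (Suc x) \<rho>' A' \<Longrightarrow> \<rho>' 2 = \<rho> 2 \<Longrightarrow> Q' (\<rho>', A')" for Q'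
    unfolding dfs_body_def
  proof (rule spec_Sq[where N = 1 and N' = 4], rule spec_Asg, unfold x, rule spec_Cond[where N = 3])
    show "run (Asg 6 (Dec (V 6)) ;; next_candidate) (\<rho>(8 := n), A) 3 Q'"
      apply (rule spec_Sq[where N = 1 and N' = 1], rule spec_Asg, unfold v6, rule run_next_candidate[OF d'])
      using len_n Q' by auto
  qed auto
  from this[where Q' = "\<lambda>z. run (dfs_loop cyc) z N Q"] K
  show "run (dfs_body cyc) (\<rho>, A) (12 * n + 28) (\<lambda>z. run (dfs_loop cyc) z N Q)" .
qed simp

text \<open>The program has one flat loop, so a subtree is not a program of its own. The lemma is
  therefore phrased with a continuation: the last hypothesis describes the rest of the loop once the
  candidates at \<open>xs\<close> are exhausted. The outer induction is on the number of vertices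
  left after the next choice, the inner one on the candidates still to be tried.\<close>

lemma run_dfs:
  assumes "distinct xs" "set xs \<subseteq> outside" "length xs + Suc q = card outside"
    and "dfs_state xs x \<rho> A" "x \<le> n"
    and "\<And>\<rho>' A'. dfs_state xs n \<rho>' A' \<Longrightarrow> (\<rho>' 2 \<noteq> 0 \<longleftrightarrow> \<rho> 2 \<noteq> 0 \<or> good_from cyc xs x) \<Longrightarrow>
      run (dfs_loop cyc) (\<rho>', A') N Q"
  shows "run (dfs_loop cyc) (\<rho>, A)
    ((n - x) * iter_time + card {y \<in> outside - set xs. x \<le> y} * dfs_time iter_time q + N) Q"
  using assms
proof (induction q arbitrary: xs x \<rho> A N rule: less_induct)
  case (less q)
  have len: "length xs < card outside" using less.prems(3) by simp
  let ?T = "\<lambda>x. (n - x) * iter_time + card {y \<in> outside - set xs. x \<le> y} * dfs_time iter_time q + N"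
  from less.prems(4,5,6) show ?case
  proof (induction "n - x" arbitrary: x \<rho> A)
    case 0
    then have xn: "x = n" by simp
    have "run (dfs_loop cyc) (\<rho>, A) N Q"
      using "0.prems"(1) unfolding xn
      by (intro "0.prems"(3)) (use good_from_n[OF len] xn in auto)
    then show ?case by (rule spec_mono) auto
  next
    case (Suc j)
    then have xn: "x < n" by simp
    let ?H = "\<exists>p. seq p \<and> take (Suc (length xs)) p = xs @ [x] \<and> good cyc p"
    have rest: "run (dfs_loop cyc) (\<rho>', A') (?T (Suc x)) Q"
      if "dfs_state xs (Suc x) \<rho>' A'" "\<rho>' 2 \<noteq> 0 \<longleftrightarrow> \<rho> 2 \<noteq> 0 \<or> ?H" for \<rho>' A'
    proof (rule Suc.hyps(1))
      show "j = n - Suc x" "Suc x \<le> n" using Suc.hyps(2) xn by simp_all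
      show "dfs_state xs (Suc x) \<rho>' A'" by (rule that(1))
      fix \<rho>'' A'' assume "dfs_state xs n \<rho>'' A''" "\<rho>'' 2 \<noteq> 0 \<longleftrightarrow> \<rho>' 2 \<noteq> 0 \<or> good_from cyc xs (Suc x)"
      then show "run (dfs_loop cyc) (\<rho>'', A'') N Q"
        using that(2) good_from_Suc[OF len, of cyc x] by (intro Suc.prems(3)) blast+
    qed
    have n_x: "(n - x) * iter_time = iter_time + (n - Suc x) * iter_time"
      using xn by (metis Suc_diff_Suc mult_Suc)
    have split: "{y \<in> outside - set xs. x \<le> y} =
      (if x \<in> outside - set xs then insert x {y \<in> outside - set xs. Suc x \<le> y} else {y \<in> outside - set xs. Suc x \<le> y})"
      by (auto simp: Suc_le_eq le_less)
    have cnt: "card {y \<in> outside - set xs. x \<le> y} =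
      (if x \<in> outside - set xs then 1 else 0) + card {y \<in> outside - set xs. Suc x \<le> y}"
      unfolding split by (subst if_distrib[of card], subst card_insert_disjoint) auto
    \<comment> \<open>Candidate \<open>x\<close> accounts for one iteration and, if it is
      admissible, for one subtree; the remainder is the bound for \<open>Suc x\<close>.\<close>
    let ?D = "if x \<in> outside - set xs then dfs_time iter_time q else 0"
    have T: "?T x = iter_time + (?D + ?T (Suc x))"
    proof -
      have aux: "((if P then 1 else 0) + c) * t = (if P then t else 0) + c * t" for P and c t :: nat
        by (simp add: algebra_simps)
      show ?thesis unfolding n_x cnt aux by (simp only: ac_simps)
    qed
    show ?case
      unfolding T
    proof (rule run_dfs_step[OF Suc.prems(1) len xn])
      fix A' assume "x \<notin> outside - set xs" "dfs_state xs (Suc x) (\<rho>(8 := x)) A'"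
      then show "run (dfs_loop cyc) (\<rho>(8 := x), A') (?D + ?T (Suc x)) Q"
        using seq_prefix by (intro spec_mono[OF rest]) auto
    next
      fix \<rho>' A' assume l: "Suc (length xs) = card outside" and p: "seq (xs @ [x])"
        and st: "dfs_state xs (Suc x) \<rho>' A'" "\<rho>' 2 \<noteq> 0 \<longleftrightarrow> \<rho> 2 \<noteq> 0 \<or> good cyc (xs @ [x])"
      have "?H \<longleftrightarrow> good cyc (xs @ [x])"
      proof
        assume ?H
        then obtain p where "seq p" "take (Suc (length xs)) p = xs @ [x]" "good cyc p" by blast
        then show "good cyc (xs @ [x])" using l seq_length[of p] by simp
      next
        assume "good cyc (xs @ [x])"
        then show ?H using p by (intro exI[of _ "xs @ [x]"]) simp
      qed
      then show "run (dfs_loop cyc) (\<rho>', A') (?D + ?T (Suc x)) Q"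
        using st by (intro spec_mono[OF rest]) auto
    next
      fix \<rho>' A' assume xo: "x \<in> outside - set xs" and l: "Suc (length xs) < card outside"
        and st: "dfs_state (xs @ [x]) 0 \<rho>' A'" "\<rho>' 2 = \<rho> 2"
      obtain q' where q': "q = Suc q'" using l less.prems(3) by (cases q) auto
      have H: "?H \<longleftrightarrow> good_from cyc (xs @ [x]) 0" by (simp add: good_from_def)
      have dist: "distinct (xs @ [x])" "set (xs @ [x]) \<subseteq> outside" using xo less.prems by auto
      \<comment> \<open>Scanning \<open>n\<close> candidates at the new depth, exploring the
        subtrees of the \<open>q\<close> vertices left and one backtracking iteration add up to
        \<open>dfs_time iter_time q\<close>, which is the origin of its recurrence.\<close>
      have "run (dfs_loop cyc) (\<rho>', A') ((n - 0) * iter_time +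
        card {y \<in> outside - set (xs @ [x]). 0 \<le> y} * dfs_time iter_time q' + (iter_time + ?T (Suc x))) Q"
      proof (rule less.IH)
        fix \<rho>'' A'' assume "dfs_state (xs @ [x]) n \<rho>'' A''"
          "\<rho>'' 2 \<noteq> 0 \<longleftrightarrow> \<rho>' 2 \<noteq> 0 \<or> good_from cyc (xs @ [x]) 0"
        then show "run (dfs_loop cyc) (\<rho>'', A'') (iter_time + ?T (Suc x)) Q"
          using l st(2) H by (intro run_dfs_backtrack rest) auto
      qed (use q' dist less.prems(3) st in auto)
      moreover have "card {y \<in> outside - set (xs @ [x]). 0 \<le> y} = q"
      proof -
        have "{y \<in> outside - set (xs @ [x]). 0 \<le> y} = outside - set (xs @ [x])" by auto
        also have "card \<dots> = card outside - length (xs @ [x])"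
          using dist distinct_card[OF dist(1)] by (subst card_Diff_subset) auto
        finally show ?thesis using less.prems(3) by simp
      qed
      ultimately show "run (dfs_loop cyc) (\<rho>', A') (?D + ?T (Suc x)) Q"
        using xo q' by (auto elim!: spec_mono)
    qed (use less.prems in auto)
  qed
qed

lemma run_search:
  assumes \<rho>: "\<rho> 1 = v" "\<rho> 3 = a" "\<rho> 4 = b"
    and K: "\<And>\<rho>' A'. \<rho>' 1 = v \<Longrightarrow> \<rho>' 3 = a \<Longrightarrow> \<rho>' 4 = Suc b \<Longrightarrow>
      (\<rho>' 2 \<noteq> 0 \<longleftrightarrow> \<rho> 2 \<noteq> 0 \<or> (\<exists>p. seq p \<and> good cyc p)) \<Longrightarrow> Q (\<rho>', A')"
  shows "run (Asg 5 (Count 25 (outside_tm 25)) ;; Asg 6 (Num 0) ;; Put 0 (V 6) (Num 0) ;;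
      dfs_loop cyc ;; Asg 4 (Inc (V 4))) (\<rho>, A)
    (n * iter_time + fact (card outside) * (n * (iter_time * (n + 1))) + 5) Q"
proof -
  let ?m = "card outside"
  have "val A (outside_tm 25) (\<rho>(25 := i)) = of_bool (i \<notin> module)" if "i < n" for i
    using \<rho> that by (subst val_outside) auto
  then have "{i. i < n \<and> val A (outside_tm 25) (\<rho>(25 := i)) \<noteq> 0} = outside" by auto
  then have c: "val A (Count 25 (outside_tm 25)) \<rho> = ?m" by simp
  have n0: "0 < n" using a by simp
  obtain q where q: "?m = Suc q" using outside_pos by (cases ?m) auto
  let ?\<rho> = "\<rho>(5 := ?m, 6 := 0)" and ?A = "A(0 := (A 0)(0 := 0))"
  let ?T = "n * iter_time + ?m * dfs_time iter_time q + 1"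
  have "run (dfs_loop cyc) (?\<rho>, ?A) ((n - 0) * iter_time +
      card {y \<in> outside - set []. 0 \<le> y} * dfs_time iter_time q + 1) (\<lambda>z. run (Asg 4 (Inc (V 4))) z 1 Q)"
  proof (rule run_dfs)
    show "dfs_state [] 0 ?\<rho> ?A" using \<rho> by (simp add: dfs_state_def)
    fix \<rho>' A' assume st: "dfs_state [] n \<rho>' A'" and r2: "\<rho>' 2 \<noteq> 0 \<longleftrightarrow> ?\<rho> 2 \<noteq> 0 \<or> good_from cyc [] 0"
    show "run (dfs_loop cyc) (\<rho>', A') 1 (\<lambda>z. run (Asg 4 (Inc (V 4))) z 1 Q)"
    proof (rule spec_Loop_stop)
      show "val A' dfs_test \<rho>' = 0" using st n0 by (simp add: dfs_test_def dfs_state_def)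
      show "run (Asg 4 (Inc (V 4))) (\<rho>', A') 1 Q"
        using st r2 by (intro spec_Asg K) (auto simp: dfs_state_def good_from_def)
    qed simp
  qed (use q in auto)
  moreover have "{y \<in> outside - set []. 0 \<le> y} = outside" by auto
  ultimately have loop: "run (dfs_loop cyc) (?\<rho>, ?A) ?T (\<lambda>z. run (Asg 4 (Inc (V 4))) z 1 Q)"
    by (simp only: diff_zero)
  \<comment> \<open>The root has \<open>?m = Suc q\<close> admissible candidates; this factor
    completes \<open>fact q\<close> to \<open>fact ?m\<close>.\<close>
  have "?m * dfs_time iter_time q \<le> ?m * (fact q * (q * (iter_time * (n + 1))))"
    by (intro mult_le_mono2 dfs_time_le)
  also have "\<dots> = fact ?m * (q * (iter_time * (n + 1)))"
    unfolding q by (simp only: fact_Suc of_nat_id mult.assoc)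
  also have "\<dots> \<le> fact ?m * (n * (iter_time * (n + 1)))"
    using q card_outside by (intro mult_le_mono) auto
  finally have T: "?T \<le> n * iter_time + fact ?m * (n * (iter_time * (n + 1))) + 1" by simp
  show ?thesis
  proof (rule spec_Sq[where N = 1 and N' = "?T + 3"], rule spec_Asg, unfold c,
      rule spec_Sq[where N = 1 and N' = "?T + 2"], rule spec_Asg,
      rule spec_Sq[where N = 1 and N' = "?T + 1"], rule spec_Put, simp add: n0)
    show "run (dfs_loop cyc ;; Asg 4 (Inc (V 4)))
      (\<rho>(5 := ?m, 6 := val A (Num 0) (\<rho>(5 := ?m))), A(0 := (A 0)(val A (V 6) (\<rho>(5 := ?m, 6 := val A (Num 0) (\<rho>(5 := ?m)))) :=
        val A (Num 0) (\<rho>(5 := ?m, 6 := val A (Num 0) (\<rho>(5 := ?m))))))) (?T + 1) Q"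
      by (rule spec_Sq[where N = ?T and N' = 1]) (use loop in simp_all)
  qed (use T in simp_all)
qed

end

section \<open>The loops over both guessed ends\<close>

context numbered_graph
begin

definition solution :: "bool \<Rightarrow> nat \<Rightarrow> nat \<Rightarrow> nat \<Rightarrow> bool" where
  "solution cyc v a b \<longleftrightarrow> (\<exists>p g. distinct p \<and> set p = {..<n} - (twins v - {a, b}) \<and>
     (cyc \<longrightarrow> E (hd p) (last p)) \<and> obeys p \<and> fills p (twins v - {a, b}) g)"

lemma (in search) good_iff_solution: "(\<exists>p. seq p \<and> good cyc p) \<longleftrightarrow> solution cyc v a b"
  by (auto simp: seq_def good_def ends_def solution_def)

abbreviation pair_time :: "nat \<Rightarrow> nat" where
  "pair_time k \<equiv> n * (12 * n + 30) + fact (k + 2) * (n * ((12 * n + 30) * (n + 1))) + 5"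

text \<open>The bound \<open>k\<close> concerns the vertices outside a largest twin class. Taking
  \<open>a\<close> and \<open>b\<close> out of the module adds at most two, hence
  \<open>fact (k + 2)\<close> in \<open>pair_time\<close>.\<close>

lemma run_main:
  assumes n: "0 < n"
    and k: "\<And>v. v < n \<Longrightarrow> \<forall>u<n. card (twins u) \<le> card (twins v) \<Longrightarrow> card ({..<n} - twins v) \<le> k"
  shows "run (main cyc) (\<lambda>_. 0, A) (n * (n * (pair_time k + 1) + 4) + 3)
    (\<lambda>z. fst z 2 \<noteq> 0 \<longleftrightarrow> (\<exists>q. ham q \<and> (cyc \<longrightarrow> E (hd q) (last q))))"
proof -
  define v where "v = val A (First 22 23 (largest_tm 22)) (\<lambda>_. 0)"
  have "val A (largest_tm 22) ((\<lambda>_. 0)(23 := j, 22 := i)) \<noteq> 0 \<longleftrightarrow> (\<forall>u<n. card (twins u) \<le> card (twins i))"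
    if "i < n" for i j using that by (subst val_largest) auto
  note first = tval_First[of n input A "largest_tm 22" "\<lambda>_. 0" 23 22, OF this, simplified, folded v_def]
  \<comment> \<open>A largest class exists because \<open>n\<close> is positive, so
    \<open>First\<close> returns a vertex.\<close>
  have "Max ((card \<circ> twins) ` {..<n}) \<in> (card \<circ> twins) ` {..<n}"
    using n by (intro Max_in) auto
  then obtain w where "w < n" "Max ((card \<circ> twins) ` {..<n}) = card (twins w)" by auto
  then have w: "w < n" "\<forall>u<n. card (twins u) \<le> card (twins w)"
    using Max_ge[of "(card \<circ> twins) ` {..<n}"] by fastforce+
  then have vn: "v < n" using first(2) by blast
  then have vmax: "\<forall>u<n. card (twins u) \<le> card (twins v)" using first(1) by blast
  have outside: "card ({..<n} - (twins v - {a, b})) \<le> k + 2" for a b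
  proof -
    have "card ({..<n} - (twins v - {a, b})) \<le> card (({..<n} - twins v) \<union> {a, b})"
      by (intro card_mono) auto
    also have "\<dots> \<le> card ({..<n} - twins v) + card {a, b}" by (rule card_Un_le)
    also have "\<dots> \<le> k + 2" using k[OF vn vmax] by (intro add_mono) (auto simp: card_insert_if)
    finally show ?thesis .
  qed
  let ?D = "pair_time k"
  \<comment> \<open>Variable 2 is the disjunction over all pairs of ends that precede
    \<open>(i, j)\<close> lexicographically.\<close>
  define J where "J i j z \<longleftrightarrow> fst z 1 = v \<and> fst z 3 = i \<and> fst z 4 = j \<and>
    (fst z 2 \<noteq> 0 \<longleftrightarrow> (\<exists>a<i. \<exists>b<n. solution cyc v a b) \<or> (\<exists>b<j. solution cyc v i b))" for i j and z :: store
  define S where "S = Asg 5 (Count 25 (outside_tm 25)) ;; Asg 6 (Num 0) ;; Put 0 (V 6) (Num 0) ;;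
      Loop dfs_test (dfs_body cyc) ;; Asg 4 (Inc (V 4))"
  have S: "run S (\<rho>, A) ?D (J i (Suc j))" if ij: "i < n" "j < n" and inv: "J i j (\<rho>, A)" for i j \<rho> A
  proof -
    interpret search n E R v i j by unfold_locales (use vn ij in auto)
    have "fact (card outside) \<le> (fact (k + 2) :: nat)" by (intro fact_mono outside)
    then have "n * iter_time + fact (card outside) * (n * (iter_time * (n + 1))) + 5 \<le> ?D"
      by (intro add_mono mult_le_mono1) auto
    then show ?thesis
      unfolding S_def
      by (rule spec_mono[OF run_search[where Q = "J i (Suc j)"], rotated 4])
        (use inv good_iff_solution in \<open>auto simp: J_def less_Suc_eq\<close>)
  qed
  have inner: "run (Loop (Lt (V 4) Size) S) z (n * (?D + 1) + 1) (J i n)" if i: "i < n" and "J i 0 z" for i z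
  proof (rule spec_Loop_for[where P = "J i"])
    show "val A (Lt (V 4) Size) \<rho> \<noteq> 0 \<and> run S (\<rho>, A) ?D (J i (Suc j))" if "j < n" "J i j (\<rho>, A)" for j \<rho> A
      using S[OF i that] that by (simp add: J_def)
    show "val A (Lt (V 4) Size) \<rho> = 0" if "J i n (\<rho>, A)" for \<rho> A using that by (simp add: J_def)
  qed (use that in auto)
  let ?J = "\<lambda>i z. fst z 1 = v \<and> fst z 3 = i \<and> (fst z 2 \<noteq> 0 \<longleftrightarrow> (\<exists>a<i. \<exists>b<n. solution cyc v a b))"
  have body: "run (Asg 4 (Num 0) ;; Loop (Lt (V 4) Size) S ;; Asg 3 (Inc (V 3))) (\<rho>, A)
      (n * (?D + 1) + 3) (?J (Suc i))" if i: "i < n" and inv: "?J i (\<rho>, A)" for i \<rho> A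
  proof (rule spec_Sq[where N = 1 and N' = "n * (?D + 1) + 2"], rule spec_Asg,
      rule spec_Sq[where N = "n * (?D + 1) + 1" and N' = 1], rule spec_mono[OF inner[OF i] order_refl])
    show "J i 0 (\<rho>(4 := val A (Num 0) \<rho>), A)" using inv by (simp add: J_def)
    fix z assume z: "J i n z"
    show "run (Asg 3 (Inc (V 3))) z 1 (?J (Suc i))"
      using z by (cases z) (auto intro!: spec_Asg simp: J_def less_Suc_eq)
  qed auto
  have outer: "run (Loop (Lt (V 3) Size) (Asg 4 (Num 0) ;; Loop (Lt (V 4) Size) S ;; Asg 3 (Inc (V 3)))) z
      (n * (n * (?D + 1) + 4) + 1) (?J n)" if "?J 0 z" for z
  proof (rule spec_Loop_for[where P = ?J])
    show "val A (Lt (V 3) Size) \<rho> \<noteq> 0 \<and>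
      run (Asg 4 (Num 0) ;; Loop (Lt (V 4) Size) S ;; Asg 3 (Inc (V 3))) (\<rho>, A) (n * (?D + 1) + 3) (?J (Suc i))"
      if "i < n" "?J i (\<rho>, A)" for i \<rho> A
      using body[OF that] that by simp
    show "val A (Lt (V 3) Size) \<rho> = 0" if "?J n (\<rho>, A)" for \<rho> A using that by simp
  qed (use that in auto)
  have iff: "(\<exists>a<n. \<exists>b<n. solution cyc v a b) \<longleftrightarrow> (\<exists>q. ham q \<and> (cyc \<longrightarrow> E (hd q) (last q)))"
  proof -
    have "{..<n} \<noteq> {}" using n by auto
    from ham_iff_fills[OF this, of "\<lambda>x y. cyc \<longrightarrow> E x y" v] show ?thesis
      unfolding solution_def by (simp only: Bex_def lessThan_iff)
  qed
  show ?thesis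
    unfolding main_def S_def[symmetric] iff[symmetric]
    apply (rule spec_Sq[where N = 1 and N' = "n * (n * (?D + 1) + 4) + 2"], rule spec_Asg)
      apply (rule spec_Sq[where N = 1 and N' = "n * (n * (?D + 1) + 4) + 1"], rule spec_Asg)
        apply (rule spec_mono[OF outer order_refl])
         apply (auto simp: v_def)
    done
qed

end

section \<open>Graph instances\<close>

lemma set_vwalk_arcs: "set (vwalk_arcs p) = {(p ! i, p ! Suc i) | i. Suc i < length p}"
proof (induction p rule: vwalk_arcs.induct)
  case (3 x y xs)
  have "{((x # y # xs) ! i, (x # y # xs) ! Suc i) | i. Suc i < length (x # y # xs)} =
    insert (x, y) {((y # xs) ! i, (y # xs) ! Suc i) | i. Suc i < length (y # xs)}" (is "?L = ?R")
  proof (intro set_eqI iffI)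
    fix e assume "e \<in> ?L"
    then obtain i where "e = ((x # y # xs) ! i, (x # y # xs) ! Suc i)" "Suc i < length (x # y # xs)" by blast
    then show "e \<in> ?R" by (cases i) auto
  next
    fix e assume "e \<in> ?R"
    then consider "e = (x, y)" | i where "e = ((y # xs) ! i, (y # xs) ! Suc i)" "Suc i < length (y # xs)" by blast
    then show "e \<in> ?L"
    proof cases
      case 1
      then show ?thesis by (intro CollectI exI[of _ 0]) simp
    next
      case 2
      then show ?thesis by (intro CollectI exI[of _ "Suc i"]) simp
    qed
  qed
  then show ?case using 3 by simp
qed auto

lemma valid_instance_graph:
  assumes "valid_instance G \<pi> n"
  shows "numbered_graph n (\<lambda>u v. (u, v) \<in> parcs G) (\<lambda>u v. (u, v) \<in> \<pi>)"
proof -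
  have G: "pair_graph G" "pverts G = {..<n}" and po: "partial_order_on (pverts G) \<pi>"
    using assms unfolding valid_instance_def by blast+
  interpret pair_graph G by fact
  have sym: "symmetric G" by (rule pair_sym_arcs)
  show ?thesis
  proof unfold_locales
    show "(y, x) \<in> parcs G" if "(x, y) \<in> parcs G" for x y
      using sym that by (auto simp: symmetric_def elim: symE)
    show "x = y" if "(x, y) \<in> \<pi>" "(y, x) \<in> \<pi>" for x y
      using po that by (auto simp: partial_order_on_def dest: antisymD)
    show "(x, z) \<in> \<pi>" if "(x, y) \<in> \<pi>" "(y, z) \<in> \<pi>" for x y z
      using po that by (auto simp: partial_order_on_def preorder_on_def dest: transD)
    show "(x, x) \<in> \<pi>" if "x \<in> {..<n}" for x
      using po that G by (auto simp: partial_order_on_def preorder_on_def refl_on_def)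
  qed simp
qed

lemma ham_iff_path:
  assumes inst: "valid_instance G \<pi> n"
  shows "ordered_graph.ham {..<n} (\<lambda>u v. (u, v) \<in> parcs G) (\<lambda>u v. (u, v) \<in> \<pi>) q \<longleftrightarrow>
    ordered_hamiltonian_path G q \<and> extending \<pi> q"
proof -
  interpret numbered_graph n "\<lambda>u v. (u, v) \<in> parcs G" "\<lambda>u v. (u, v) \<in> \<pi>"
    by (rule valid_instance_graph[OF inst])
  have V: "pverts G = {..<n}" "n \<ge> 1" using inst unfolding valid_instance_def by blast+
  \<comment> \<open>\<open>vpath\<close> demands a non-empty list, while \<open>ham\<close> excludes
    the empty one only through \<open>n \<ge> 1\<close>.\<close>
  have ne: "q \<noteq> []" if "set q = {..<n}"
  proof
    assume "q = []"
    with that have "{..<n} = {}" by simp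
    then show False using V(2) by (simp add: lessThan_empty_iff)
  qed
  have "arcs_ends (with_proj G) = parcs G" by (simp add: arcs_ends_def arc_to_ends_def)
  then have path: "vpath q (with_proj G) \<longleftrightarrow> set q \<subseteq> {..<n} \<and>
      (\<forall>i. Suc i < length q \<longrightarrow> (q ! i, q ! Suc i) \<in> parcs G) \<and> q \<noteq> [] \<and> distinct q"
    unfolding vpath_def vwalk_def set_vwalk_arcs using V(1) by (simp, blast)
  have ext: "extending \<pi> q \<longleftrightarrow>
      (\<forall>i j. i < length q \<longrightarrow> j < length q \<longrightarrow> (q ! i, q ! j) \<in> \<pi> \<longrightarrow> i \<le> j)"
    unfolding extending_def by blast
  show ?thesis
  proof (cases "set q = {..<n}")
    case True
    then show ?thesis
      unfolding ham_def ordered_hamiltonian_path_def path ext V(1) using ne[OF True] by blast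
  next
    case False
    then show ?thesis unfolding ham_def ordered_hamiltonian_path_def V(1) by blast
  qed
qed

text \<open>The memory behind the two matrices is zero, so every array starts out as zero.\<close>

lemma represents_input:
  "represents n (\<lambda>q u v. if q then (u, v) \<in> \<pi> else (u, v) \<in> parcs G) (input_state G \<pi> n) (\<lambda>_. 0) (\<lambda>_ _. 0)"
  unfolding represents_def
proof (intro conjI allI impI)
  fix u v assume uv: "u < n" "v < n"
  have "u * n + v < n * n" using uv by (rule index_less)
  then show "mem (input_state G \<pi> n) (u * n + v) =
      of_bool (if False then (u, v) \<in> \<pi> else (u, v) \<in> parcs G)"
    using uv by (simp add: input_state_def)
  have 1: "(n + u) * n + v = n * n + (u * n + v)" by (simp add: algebra_simps)
  moreover have "n * n + (u * n + v) < 2 * n * n" using \<open>u * n + v < n * n\<close> by simp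
  ultimately show "mem (input_state G \<pi> n) ((n + u) * n + v) =
      of_bool (if True then (u, v) \<in> \<pi> else (u, v) \<in> parcs G)"
    unfolding 1 using uv by (simp add: input_state_def)
next
  fix j v
  have "(2 * n + j) * n + v = 2 * n * n + (j * n + v)" by (simp add: algebra_simps)
  then show "mem (input_state G \<pi> n) ((2 * n + j) * n + v) = 0"
    by (simp add: input_state_def)
qed (auto simp: input_state_def)

lemma card_outside_twins:
  assumes inst: "valid_instance G \<pi> n" and v: "v < n"
    and max: "\<forall>u<n. card (ordered_graph.twins {..<n} (\<lambda>u v. (u, v) \<in> parcs G) u) \<le>
      card (ordered_graph.twins {..<n} (\<lambda>u v. (u, v) \<in> parcs G) v)"
  shows "card ({..<n} - ordered_graph.twins {..<n} (\<lambda>u v. (u, v) \<in> parcs G) v) \<le> dist_to_clique_module G"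
proof -
  interpret numbered_graph n "\<lambda>u v. (u, v) \<in> parcs G" "\<lambda>u v. (u, v) \<in> \<pi>"
    by (rule valid_instance_graph[OF inst])
  have G: "pair_graph G" and V: "pverts G = {..<n}" "n \<ge> 1" using inst unfolding valid_instance_def by blast+
  \<comment> \<open>In a non-empty graph the set of all vertices is a deletion set, so the
    \<open>LEAST\<close> is attained by some \<open>W\<close>.\<close>
  have "pverts G \<noteq> {}" unfolding V(1) using V(2) by (simp add: lessThan_empty_iff)
  then have "\<exists>k W. clique_module_deletion_set G W \<and> card W = k"
    using clique_module_deletion_set_verts[OF G] by blast
  then have "\<exists>W. clique_module_deletion_set G W \<and> card W = dist_to_clique_module G"
    unfolding dist_to_clique_module_def by (rule LeastI_ex)
  then obtain W where W: "clique_module_deletion_set G W" "card W = dist_to_clique_module G" by blast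
  let ?M = "{..<n} - W"
  have WV: "W \<subseteq> {..<n}" using W V by (simp add: clique_module_deletion_set_def)
  have clique: "(x, y) \<in> parcs G" if "x \<in> ?M" "y \<in> ?M" "x \<noteq> y" for x y
  proof -
    have "arcs_ends (with_proj G \<restriction> ?M) = {(u, v). (u, v) \<in> ?M \<times> ?M \<and> u \<noteq> v}"
      using W V by (simp add: clique_module_deletion_set_def complete_graph_def complete_digraph_def)
    then have "(x, y) \<in> arcs_ends (with_proj G \<restriction> ?M)" using that by auto
    then show ?thesis by (auto simp: arcs_ends_def arc_to_ends_def induce_subgraph_def)
  qed
  have module: "(x, z) \<in> parcs G \<longleftrightarrow> (y, z) \<in> parcs G" if "x \<in> ?M" "y \<in> ?M" "z \<notin> ?M" for x y z
  proof -
    have "neighbors G x - ?M = neighbors G y - ?M"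
      using W V that unfolding clique_module_deletion_set_def nontrivial_module_def by metis
    then show ?thesis using that(3) unfolding neighbors_def by blast
  qed
  have "card ?M \<le> card (twins v)"
  proof (cases "?M = {}")
    case False
    then obtain x where x: "x \<in> ?M" by blast
    have "?M \<subseteq> twins x"
    proof
      fix y assume y: "y \<in> ?M"
      \<comment> \<open>For \<open>z\<close> in \<open>?M\<close> both sides hold by completeness;
        for \<open>z\<close> outside they agree by the module property.\<close>
      have "(z = x \<or> (x, z) \<in> parcs G) \<longleftrightarrow> (z = y \<or> (y, z) \<in> parcs G)" if "z \<in> {..<n}" for z
        using clique[OF x] clique[OF y] module[OF x y] x y by (cases "z \<in> ?M") metis+
      then show "y \<in> twins x" using y by (simp add: twins_def twin_def)
    qed
    then have "card ?M \<le> card (twins x)" by (intro card_mono) (auto simp: twins_def)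
    also have "\<dots> \<le> card (twins v)" using max x by simp
    finally show ?thesis .
  next
    case True
    then show ?thesis by (simp only: card.empty le0)
  qed
  moreover have "card ?M = n - card W" using WV by (subst card_Diff_subset) (auto intro: finite_subset)
  moreover have "card ({..<n} - twins v) = n - card (twins v)"
    by (subst card_Diff_subset) (auto simp: twins_def intro: finite_subset[of _ "{..<n}"])
  moreover have "card W \<le> n" using card_mono[OF _ WV] by simp
  ultimately show ?thesis using W(2) by linarith
qed

lemma dist_to_clique_module_le:
  assumes "valid_instance G \<pi> n"
  shows "dist_to_clique_module G \<le> n"
proof -
  have G: "pair_graph G" and V: "pverts G = {..<n}" "n \<ge> 1" using assms unfolding valid_instance_def by blast+
  have "pverts G \<noteq> {}" unfolding V(1) using V(2) by (simp add: lessThan_empty_iff)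
  then have "clique_module_deletion_set G (pverts G)" by (rule clique_module_deletion_set_verts[OF G])
  then have "clique_module_deletion_set G {..<n} \<and> card {..<n} = n" unfolding V(1) by simp
  then show ?thesis unfolding dist_to_clique_module_def by (intro Least_le exI)
qed

section \<open>The final program and its running time\<close>

definition algorithm :: "bool \<Rightarrow> com" where
  "algorithm cyc = Seq (hcompile (main cyc)) (set_bool 0 (nonzero 2))"

text \<open>The bound of \<open>run_main\<close> with the factorial pulled out:
  \<open>(n + 2) * (n + 1)\<close> is what remains of \<open>fact (k + 2)\<close> for
  \<open>k \<le> n\<close>, and the final 10 pays for copying the answer to register 0.\<close>

definition algorithm_time :: "bool \<Rightarrow> nat \<Rightarrow> nat" where
  "algorithm_time cyc n =
     (n * (n * (n * (12 * n + 30) + (n + 2) * (n + 1) * (n * ((12 * n + 30) * (n + 1))) + 6) + 4) + 3) *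
       step_time (main cyc) n + 10"

lemma poly_bounded_algorithm_time: "poly_bounded (algorithm_time cyc)"
proof -
  have "poly_bounded (\<lambda>n. algorithm_time cyc n)"
    unfolding algorithm_time_def by (intro poly_bounded_intros poly_bounded_step_time)
  then show ?thesis by simp
qed

lemma algorithm_correct:
  assumes inst: "valid_instance G \<pi> n"
  shows "reach (algorithm cyc) (input_state G \<pi> n) (fact (dist_to_clique_module G) * algorithm_time cyc n)
    (\<lambda>s. reg s 0 = of_bool (\<exists>p. ordered_hamiltonian_path G p \<and> extending \<pi> p \<and>
       (cyc \<longrightarrow> (hd p, last p) \<in> parcs G)))" (is "reach _ _ _ (\<lambda>s. reg s 0 = of_bool ?ans)")
proof -
  interpret numbered_graph n "\<lambda>u v. (u, v) \<in> parcs G" "\<lambda>u v. (u, v) \<in> \<pi>"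
    by (rule valid_instance_graph[OF inst])
  let ?k = "dist_to_clique_module G"
  let ?S = "step_time (main cyc) n"
  let ?N = "n * (n * (pair_time ?k + 1) + 4) + 3"
  have n: "0 < n" using inst by (simp add: valid_instance_def)
  have ans: "?ans \<longleftrightarrow> (\<exists>q. ham q \<and> (cyc \<longrightarrow> (hd q, last q) \<in> parcs G))"
    using ham_iff_path[OF inst] by auto
  have "run (main cyc) (\<lambda>_. 0, \<lambda>_ _. 0) ?N (\<lambda>z. fst z 2 \<noteq> 0 \<longleftrightarrow> ?ans)"
    unfolding ans by (rule run_main[OF n card_outside_twins[OF inst]])
  then obtain t z where z: "hexec n input (main cyc) (\<lambda>_. 0, \<lambda>_ _. 0) t z" "t \<le> ?N" "fst z 2 \<noteq> 0 \<longleftrightarrow> ?ans"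
    unfolding spec_def by blast
  have "input = (\<lambda>q u v. if q then (u, v) \<in> \<pi> else (u, v) \<in> parcs G)"
    by (auto simp: fun_eq_iff input_def)
  then have "represents n input (input_state G \<pi> n) (\<lambda>_. 0) (\<lambda>_ _. 0)"
    using represents_input by simp
  then have 1: "reach (hcompile (main cyc)) (input_state G \<pi> n) (t * ?S)
      (\<lambda>s. represents n input s (fst z) (snd z))"
    using hcompile_correct[OF z(1) wf_main] by simp
  have 2: "reach (set_bool 0 (nonzero 2)) s 10 (\<lambda>s. reg s 0 = of_bool ?ans)"
    if "represents n input s (fst z) (snd z)" for s
    using that z(3) unfolding set_bool_def
    by (auto intro!: reach_If[where T = 2] reach_SetReg simp: represents_def)
  have "t * ?S + 10 \<le> fact ?k * algorithm_time cyc n"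
  proof -
    let ?c = "n * ((12 * n + 30) * (n + 1))"
    have k: "?k \<le> n" by (rule dist_to_clique_module_le[OF inst])
    have f1: "1 \<le> (fact ?k :: nat)" by (rule fact_ge_1)
    have "fact (?k + 2) = fact ?k * ((?k + 2) * (?k + 1))" by (simp add: algebra_simps)
    also have "\<dots> \<le> fact ?k * ((n + 2) * (n + 1))" using k by (intro mult_le_mono) auto
    finally have "fact (?k + 2) * ?c \<le> fact ?k * ((n + 2) * (n + 1)) * ?c" by (rule mult_le_mono1)
    then have y: "fact (?k + 2) * ?c \<le> fact ?k * ((n + 2) * (n + 1) * ?c)" by (simp only: mult.assoc)
    \<comment> \<open>Summands without a factorial are absorbed because \<open>fact ?k\<close> is at
      least 1; in this way the factor is pulled out level by level.\<close>
    have le: "x \<le> fact ?k * x" for x :: nat using mult_le_mono1[OF f1, of x] by simp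
    have "x + fact (?k + 2) * ?c + 5 + 1 \<le> fact ?k * (x + (n + 2) * (n + 1) * ?c + 6)" for x
      unfolding add_mult_distrib2[of "fact ?k"] using y le[of x] le[of 6] by linarith
    then have D: "pair_time ?k + 1 \<le> fact ?k * (n * (12 * n + 30) + (n + 2) * (n + 1) * ?c + 6)" .
    let ?D = "n * (12 * n + 30) + (n + 2) * (n + 1) * ?c + 6"
    have "n * (pair_time ?k + 1) + 4 \<le> fact ?k * (n * ?D + 4)"
      using mult_le_mono2[OF D, of n] le[of 4] by (simp only: add_mult_distrib2 mult.left_commute[of n "fact ?k"])
    then have "?N \<le> n * (fact ?k * (n * ?D + 4)) + fact ?k * 3"
      by (intro add_mono mult_le_mono2 le)
    also have "\<dots> = fact ?k * (n * (n * ?D + 4) + 3)"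
      by (simp only: add_mult_distrib2[of "fact ?k" "n * (n * ?D + 4)" 3] mult.left_commute[of n "fact ?k"])
    finally have "?N \<le> fact ?k * (n * (n * ?D + 4) + 3)" .
    then have "t * ?S \<le> fact ?k * (n * (n * ?D + 4) + 3) * ?S"
      using z(2) by (intro mult_le_mono1) (rule le_trans)
    then have "t * ?S \<le> fact ?k * ((n * (n * ?D + 4) + 3) * ?S)" unfolding mult.assoc[of "fact ?k"] .
    then have "t * ?S + 10 \<le> fact ?k * ((n * (n * ?D + 4) + 3) * ?S) + fact ?k * 10"
      by (intro add_mono le)
    then show ?thesis unfolding algorithm_time_def add_mult_distrib2[of "fact ?k" _ 10] .
  qed
  then show ?thesis
    unfolding algorithm_def by (rule reach_Seq[OF reach_mono[OF 1 order_refl 2], rotated])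
qed

lemma algorithm_decides:
  assumes Q: "\<And>G \<pi>. Q G \<pi> \<longleftrightarrow> (\<exists>p. ordered_hamiltonian_path G p \<and> extending \<pi> p \<and>
    (cyc \<longrightarrow> (hd p, last p) \<in> parcs G))"
  shows "\<exists>P c. decides_within P Q (\<lambda>n k. c * (fact k * n ^ c))"
proof -
  obtain c where c: "\<And>n. n \<ge> 1 \<Longrightarrow> algorithm_time cyc n \<le> c * n ^ c"
    using poly_bounded_algorithm_time unfolding poly_bounded_def by blast
  have "decides_within (algorithm cyc) Q (\<lambda>n k. c * (fact k * n ^ c))"
    unfolding decides_within_def
  proof (intro allI impI, elim conjE)
    fix G \<pi> n k assume inst: "valid_instance G \<pi> n" and k: "dist_to_clique_module G = k"
    obtain t s where "exec (algorithm cyc) (input_state G \<pi> n) t s" "t \<le> fact k * algorithm_time cyc n"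
      "reg s 0 = of_bool (Q G \<pi>)"
      using algorithm_correct[OF inst, of cyc] k unfolding reach_def Q by blast
    moreover have "fact k * algorithm_time cyc n \<le> fact k * (c * n ^ c)"
      using c inst by (intro mult_le_mono2) (simp add: valid_instance_def)
    moreover have "fact k * (c * n ^ c) = c * (fact k * n ^ c)" by (rule mult.left_commute)
    ultimately show "\<exists>t s. exec (algorithm cyc) (input_state G \<pi> n) t s \<and> reg s 0 = of_bool (Q G \<pi>) \<and>
      t \<le> c * (fact k * n ^ c)"
      by (metis le_trans)
  qed
  then show ?thesis by blast
qed

theorem theorem4p7:
  shows "(\<exists>P c. decides_within P POHPP (\<lambda>n k. c * (fact k * n ^ c))) \<and>
         (\<exists>P c. decides_within P POHCP (\<lambda>n k. c * (fact k * n ^ c)))"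
  using algorithm_decides[of POHPP False] algorithm_decides[of POHCP True]
  by (simp add: POHPP_def POHCP_def)

end
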